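(* Let $G$ be a Polish group with a right-invariant compatible metric $d$. Suppose there is a sequence of compact subgroups $K_1\le K_2\le\cdots\le G$ whose union is dense in $G$, and suppose that each $K_n$ admits a finite chain of compact subgroups $$\{e\}=H_{n,0}\le H_{n,1}\le\cdots\le H_{n,M_n}=K_n$$ such that the quotient radii $$\rho_{n,i}:=\sup_{g\in H_{n,i}}\ \inf_{h\in H_{n,i-1}}d(e,gh),\qquad 1\le i\le M_n,$$ satisfy $$\sup_{n\ge1}\sum_{i=1}^{M_n}\rho_{n,i}<+\infty\qquad\text{and}\qquad \max_{1\le i\le M_n}\rho_{n,i}\to0\ \text{ as } n\to\infty.$$ Then $G$ is a Wasserstein group (hence also a Lévy group).
   Context: **Measure metric groups and the Wasserstein modulus.** A measure metric group $(K,d,m)$ consists of a compact metrizable group $K$, a compatible right-invariant metric $d$ on $K$ (so $d(xg,yg)=d(x,y)$), and the Haar probability measure $m$ of $K$. Write $e_K$ for the identity and $B_d(r):=\{h\in K: d(e_K,h)\le r\}$. Let $\mathcal{D}(K,m):=\{\phi\in L^1(K,m):\phi\ge 0,\ \int_K\phi\,dm=1\}$; for $\phi\in\mathcal{D}(K,m)$ let $\phi m$ be the probability measure with density $\phi$ with respect to $m$, and for $h\in K$ put $(h.\phi)(g):=\phi(h^{-1}g)$. Put $\mathbf{V}_m(\phi,\phi'):=\frac12\int_K|\phi-\phi'|\,dm$, and for Borel probability measures $\alpha,\beta$ on $K$ put $\mathbf{W}_d(\alpha,\beta):=\sup_f\left|\int f\,d\alpha-\int f\,d\beta\right|$, the supremum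 over all real functions $f$ on $K$ that are $1$-Lipschitz with respect to $d$. A $\mathcal{D}(K,m)$-valued measurable kernel is a family $\Phi=\{\phi_z:z\in Z\}\subset\mathcal{D}(K,m)$ indexed by a probability space $(Z,\zeta)$ and measurable (i.e. $(z,g)\mapsto\phi_z(g)$ is measurable). Put $$\mathbf{v}_m(\Phi,r):=\sup_{h\in B_d(r)}\int_Z\mathbf{V}_m(h.\phi_z,\phi_z)\,d\zeta(z),\qquad \mathbf{w}_d(\Phi):=\int_Z\mathbf{W}_d(\phi_z m,m)\,d\zeta(z),$$ and, for $r,\epsilon>0$, $\Omega_{(K,d,m)}(r,\epsilon):=\sup\{\mathbf{w}_d(\Phi):\mathbf{v}_m(\Phi,r)\le\epsilon\}$, the supremum over all $\mathcal{D}(K,m)$-valued measurable kernels $\Phi$ (over all probability spaces). **Wasserstein families and groups.** A sequence $(K_n,d_n,m_n)_{n\ge1}$ of measure metric groups is a Wasserstein family if there is a sequence of positive numbers $r_n\to0$ such that $\Omega_{(K_n,d_n,m_n)}(r_n,\epsilon_n)\to0$ for every sequence of positive numbers $\epsilon_n\to0$. A Polish group $G$ is a Wasserstein group if it admits a compatible right-invariant metric $d$ and an increasing sequence of compact subgroups $K_1\le K_2\le\cdots$ of $G$ with dense union such that $(K_n,d|_{K_n},m_n)_{n\ge1}$ is a Wasserstein family, where $m_n$ is the Haar probability measure of $K_n$. **Lévy families and groups.** The sequence $(K_n,d_n,m_n)$ is a Lévy family if for every $\epsilon>0$, $\alpha_{(K_n,d_n,m_n)}(\epsilon)\to0$, where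 $\alpha_{(K,d,m)}(\epsilon):=1-\inf\{m(B_d(A,\epsilon)): A\subseteq K \text{ Borel},\ m(A)\ge1/2\}$ and $B_d(A,\epsilon)$ is the $\epsilon$-neighborhood of $A$. A Polish group is a Lévy group if it admits a compatible right-invariant metric $d$ and an increasing sequence of compact subgroups $K_n$ with dense union such that $(K_n,d|_{K_n},m_n)_{n\ge1}$ is a Lévy family. *)

theory Defs
  imports "HOL-Probability.Probability_Measure" "HOL-Algebra.Coset"
begin

definition borel_of :: "'a topology \<Rightarrow> 'a measure" where
  "borel_of T = sigma (topspace T) {U. openin T U}"

locale topological_group = group G for G (structure) +
  fixes T :: "'a topology"
  assumes topspace_eq: "topspace T = carrier G"
    and continuous_mult: "continuous_map (prod_topology T T) T (\<lambda>(x, y). x \<otimes> y)"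
    and continuous_inv: "continuous_map T T (\<lambda>x. inv x)"

locale polish_group = topological_group +
  assumes separable: "separable_space T"
    and completely_metrizable: "completely_metrizable_space T"

text \<open>
  A metric is a function on the whole type of which only the values on the carrier matter, so that
  the restriction of a metric to a subgroup is given by the same function.
\<close>

definition compatible_right_invariant_metric ::
    "('a, 'b) monoid_scheme \<Rightarrow> 'a topology \<Rightarrow> ('a \<Rightarrow> 'a \<Rightarrow> real) \<Rightarrow> bool" where
  "compatible_right_invariant_metric G T d \<longleftrightarrow>
     Metric_space (carrier G) d \<and> Metric_space.mtopology (carrier G) d = T \<and>
     (\<forall>x\<in>carrier G. \<forall>y\<in>carrier G. \<forall>g\<in>carrier G. d (x \<otimes>\<^bsub>G\<^esub> g) (y \<otimes>\<^bsub>G\<^esub> g) = d x y)"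

text \<open>
  On a compact metrizable group every Borel probability measure is regular and left-invariance implies
  right-invariance, so this determines the Haar probability measure.
\<close>

definition haar_probability ::
    "('a, 'b) monoid_scheme \<Rightarrow> 'a topology \<Rightarrow> 'a measure \<Rightarrow> bool" where
  "haar_probability K T m \<longleftrightarrow>
     prob_space m \<and> sets m = sets (borel_of T) \<and>
     (\<forall>g\<in>carrier K. \<forall>A\<in>sets m. emeasure m (g <#\<^bsub>K\<^esub> A) = emeasure m A)"

locale measure_metric_group =
  topological_group K "Metric_space.mtopology (carrier K) d" for K (structure) and d +
  fixes m :: "'a measure"
  assumes metric:
      "compatible_right_invariant_metric K (Metric_space.mtopology (carrier K) d) d"
    and compact: "compact_space (Metric_space.mtopology (carrier K) d)"
    and haar: "haar_probability K (Metric_space.mtopology (carrier K) d) m"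

text \<open>Elements of L1 are represented by functions, hence the non-negativity almost everywhere.\<close>

definition densities :: "'a measure \<Rightarrow> ('a \<Rightarrow> real) set" where
  "densities m = {\<phi>. integrable m \<phi> \<and> (AE g in m. 0 \<le> \<phi> g) \<and> (\<integral>g. \<phi> g \<partial>m) = 1}"

definition translate :: "('a, 'b) monoid_scheme \<Rightarrow> 'a \<Rightarrow> ('a \<Rightarrow> real) \<Rightarrow> 'a \<Rightarrow> real" where
  "translate K h \<phi> = (\<lambda>g. \<phi> (inv\<^bsub>K\<^esub> h \<otimes>\<^bsub>K\<^esub> g))"

definition total_variation :: "'a measure \<Rightarrow> ('a \<Rightarrow> real) \<Rightarrow> ('a \<Rightarrow> real) \<Rightarrow> real" where
  "total_variation m \<phi> \<phi>' = (1/2) * (\<integral>g. \<bar>\<phi> g - \<phi>' g\<bar> \<partial>m)"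

definition lipschitz1 :: "'a set \<Rightarrow> ('a \<Rightarrow> 'a \<Rightarrow> real) \<Rightarrow> ('a \<Rightarrow> real) set" where
  "lipschitz1 X d = {f. \<forall>x\<in>X. \<forall>y\<in>X. \<bar>f x - f y\<bar> \<le> d x y}"

definition wasserstein ::
    "'a set \<Rightarrow> ('a \<Rightarrow> 'a \<Rightarrow> real) \<Rightarrow> 'a measure \<Rightarrow> 'a measure \<Rightarrow> ennreal" where
  "wasserstein X d \<alpha> \<beta> = (SUP f\<in>lipschitz1 X d. ennreal \<bar>(\<integral>x. f x \<partial>\<alpha>) - (\<integral>x. f x \<partial>\<beta>)\<bar>)"

definition measurable_kernel :: "'a measure \<Rightarrow> 'z measure \<Rightarrow> ('z \<Rightarrow> 'a \<Rightarrow> real) \<Rightarrow> bool" where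
  "measurable_kernel m \<zeta> \<Phi> \<longleftrightarrow>
     prob_space \<zeta> \<and> (\<lambda>(z, g). \<Phi> z g) \<in> borel_measurable (\<zeta> \<Otimes>\<^sub>M m) \<and>
     (\<forall>z\<in>space \<zeta>. \<Phi> z \<in> densities m)"

definition kernel_v ::
    "('a, 'b) monoid_scheme \<Rightarrow> ('a \<Rightarrow> 'a \<Rightarrow> real) \<Rightarrow> 'a measure \<Rightarrow>
     'z measure \<Rightarrow> ('z \<Rightarrow> 'a \<Rightarrow> real) \<Rightarrow> real \<Rightarrow> ennreal" where
  "kernel_v K d m \<zeta> \<Phi> r =
     (SUP h\<in>{h \<in> carrier K. d \<one>\<^bsub>K\<^esub> h \<le> r}.
        \<integral>\<^sup>+z. ennreal (total_variation m (translate K h (\<Phi> z)) (\<Phi> z)) \<partial>\<zeta>)"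

definition kernel_w ::
    "('a, 'b) monoid_scheme \<Rightarrow> ('a \<Rightarrow> 'a \<Rightarrow> real) \<Rightarrow> 'a measure \<Rightarrow>
     'z measure \<Rightarrow> ('z \<Rightarrow> 'a \<Rightarrow> real) \<Rightarrow> ennreal" where
  "kernel_w K d m \<zeta> \<Phi> =
     (\<integral>\<^sup>+z. wasserstein (carrier K) d (density m (\<lambda>g. ennreal (\<Phi> z g))) m \<partial>\<zeta>)"

text \<open>
  A definition cannot quantify over all types, so the index spaces of the kernels are all probability
  spaces on \<^typ>\<open>nat \<Rightarrow> bool\<close>. The theorem \<open>kernel_w_le_modulus\<close> below shows that the
  supremum over the kernels on probability spaces of any other type is not larger.
\<close>

definition wasserstein_modulus ::
    "('a, 'b) monoid_scheme \<Rightarrow> ('a \<Rightarrow> 'a \<Rightarrow> real) \<Rightarrow> 'a measure \<Rightarrow> real \<Rightarrow> real \<Rightarrow> ennreal" where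
  "wasserstein_modulus K d m r \<epsilon> =
     (SUP (\<zeta>, \<Phi>)\<in>{(\<zeta> :: (nat \<Rightarrow> bool) measure, \<Phi>).
          measurable_kernel m \<zeta> \<Phi> \<and> kernel_v K d m \<zeta> \<Phi> r \<le> ennreal \<epsilon>}. kernel_w K d m \<zeta> \<Phi>)"

definition cantor :: "(nat \<Rightarrow> bool) measure" where
  "cantor = (\<Pi>\<^sub>M i\<in>UNIV. count_space UNIV)"

lemma space_cantor [simp]: "space cantor = UNIV"
  by (simp add: cantor_def space_PiM PiE_UNIV_domain)

lemma measurable_cantor_coord [measurable]: "(\<lambda>c. c i) \<in> measurable cantor (count_space UNIV)"
  unfolding cantor_def by (rule measurable_component_singleton) simp

lemma measurable_cantorI:
  assumes "\<And>i. {z \<in> space M. f z i} \<in> sets M"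
  shows "f \<in> measurable M cantor"
  unfolding cantor_def
proof (rule measurable_PiM_single')
  fix i
  show "(\<lambda>z. f z i) \<in> measurable M (count_space UNIV)"
    using assms[of i] by (simp add: pred_def)
qed (auto simp: PiE_UNIV_domain)

definition set_factor ::
    "'z measure \<Rightarrow> 'a measure \<Rightarrow> (nat \<Rightarrow> 'z set) \<Rightarrow> ('z \<times> 'a) set \<Rightarrow> ((nat \<Rightarrow> bool) \<times> 'a) set \<Rightarrow> bool"
  where "set_factor M N A S S' \<longleftrightarrow>
     range A \<subseteq> sets M \<and> S' \<in> sets (cantor \<Otimes>\<^sub>M N) \<and>
     (\<forall>z\<in>space M. \<forall>y\<in>space N. (z, y) \<in> S \<longleftrightarrow> ((\<lambda>i. z \<in> A i), y) \<in> S')"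

lemma set_factor_seq:
  fixes S :: "nat \<Rightarrow> ('z \<times> 'a) set"
  assumes "\<And>k. \<exists>A S'. set_factor M N A (S k) S'"
  shows "\<exists>A S'. \<forall>k. set_factor M N A (S k) (S' k)"
proof -
  obtain A S' where A: "\<And>k. set_factor M N (A k) (S k) (S' k)"
    using assms by metis
  define B where "B j = A (fst (prod_decode j)) (snd (prod_decode j))" for j
  define p where "p k = (\<lambda>(c :: nat \<Rightarrow> bool, y :: 'a). (\<lambda>i. c (prod_encode (k, i)), y))" for k
  have p1: "(\<lambda>c. (\<lambda>i. c (prod_encode (k, i)))) \<in> measurable cantor cantor" for k
    by (rule measurable_cantorI) measurable
  have p [measurable]: "p k \<in> measurable (cantor \<Otimes>\<^sub>M N) (cantor \<Otimes>\<^sub>M N)" for k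
    unfolding p_def case_prod_unfold
    by (rule measurable_Pair) (use measurable_compose[OF measurable_fst p1] in simp_all)
  have "set_factor M N B (S k) (p k -` S' k \<inter> space (cantor \<Otimes>\<^sub>M N))" for k
    unfolding set_factor_def
  proof (intro conjI ballI)
    show "range B \<subseteq> sets M"
      using A unfolding set_factor_def B_def image_subset_iff by blast
    show "p k -` S' k \<inter> space (cantor \<Otimes>\<^sub>M N) \<in> sets (cantor \<Otimes>\<^sub>M N)"
      using A[of k] p[of k] by (auto simp: set_factor_def intro: measurable_sets)
    fix z y assume "z \<in> space M" "y \<in> space N"
    then show "(z, y) \<in> S k \<longleftrightarrow>
        ((\<lambda>i. z \<in> B i), y) \<in> p k -` S' k \<inter> space (cantor \<Otimes>\<^sub>M N)"
      using A[of k] by (auto simp: set_factor_def p_def B_def space_pair_measure)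
  qed
  then show ?thesis
    by (intro exI[of _ B] exI[of _ "\<lambda>k. p k -` S' k \<inter> space (cantor \<Otimes>\<^sub>M N)"] allI)
qed

lemma set_factor_exists:
  assumes "S \<in> sets (M \<Otimes>\<^sub>M N)"
  shows "\<exists>A S'. set_factor M N A S S'"
proof -
  have "S \<in> sigma_sets (space M \<times> space N) {a \<times> b | a b. a \<in> sets M \<and> b \<in> sets N}"
    using assms by (simp add: sets_pair_measure)
  then show ?thesis
  proof induction
    case (Basic S)
    then obtain a b where ab: "S = a \<times> b" "a \<in> sets M" "b \<in> sets N" by auto
    have "{c \<in> space cantor. c 0} \<in> sets cantor" by measurable
    then have "{c. c 0} \<times> b \<in> sets (cantor \<Otimes>\<^sub>M N)" using ab by simp
    then have "set_factor M N (\<lambda>_. a) S ({c. c 0} \<times> b)"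
      using ab by (auto simp: set_factor_def)
    then show ?case by blast
  next
    case Empty
    have "set_factor M N (\<lambda>_. {}) {} {}" by (auto simp: set_factor_def)
    then show ?case by blast
  next
    case (Compl S)
    then obtain A S' where "set_factor M N A S S'" by blast
    then have "set_factor M N A (space M \<times> space N - S) (space (cantor \<Otimes>\<^sub>M N) - S')"
      using sets.compl_sets[of S' "cantor \<Otimes>\<^sub>M N"]
      by (auto simp: set_factor_def space_pair_measure)
    then show ?case by blast
  next
    case (Union S)
    then obtain A S' where "\<And>k. set_factor M N A (S k) (S' k)"
      using set_factor_seq[of M N S] by blast
    then have "set_factor M N A (\<Union>k. S k) (\<Union>k. S' k)"
      by (auto simp: set_factor_def)
    then show ?case by blast
  qed
qed

lemma function_factor:
  fixes f :: "'z \<Rightarrow> 'a \<Rightarrow> real"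
  assumes f: "(\<lambda>(z, y). f z y) \<in> borel_measurable (M \<Otimes>\<^sub>M N)"
  obtains t f' where "t \<in> measurable M cantor"
    "(\<lambda>(c, y). f' c y) \<in> borel_measurable (cantor \<Otimes>\<^sub>M N)"
    "\<And>z y. z \<in> space M \<Longrightarrow> y \<in> space N \<Longrightarrow> f' (t z) y = (f z y :: real)"
proof -
  define q :: "nat \<Rightarrow> real" where "q k = of_rat (from_nat k)" for k
  define S where "S k = {x \<in> space (M \<Otimes>\<^sub>M N). q k < (\<lambda>(z, y). f z y) x}" for k
  have "S k \<in> sets (M \<Otimes>\<^sub>M N)" for k
    unfolding S_def by (rule borel_measurable_less[OF borel_measurable_const f])
  then have "\<exists>A S'. set_factor M N A (S k) S'" for k
    by (rule set_factor_exists)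
  then obtain A S' where A: "\<And>k. set_factor M N A (S k) (S' k)"
    using set_factor_seq[of M N S] by blast
  define t where "t z = (\<lambda>i. z \<in> A i)" for z
  define F where "F x = (SUP k. if x \<in> S' k then ereal (q k) else -\<infinity>)" for x
  have S' [measurable]: "S' k \<in> sets (cantor \<Otimes>\<^sub>M N)" for k
    using A[of k] unfolding set_factor_def by blast
  have A_sets: "A i \<in> sets M" for i
    using A[of 0] by (auto simp: set_factor_def)
  have t: "t \<in> measurable M cantor"
  proof (rule measurable_cantorI)
    fix i
    have "{z \<in> space M. t z i} = A i"
      using sets.sets_into_space[OF A_sets[of i]] by (auto simp: t_def)
    then show "{z \<in> space M. t z i} \<in> sets M"
      by (simp add: A_sets)
  qed
  have F: "F \<in> borel_measurable (cantor \<Otimes>\<^sub>M N)"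
    unfolding F_def using S'
    by (intro borel_measurable_SUP measurable_If_set) simp_all
  have eq: "F (t z, y) = ereal (f z y)" if zy: "z \<in> space M" "y \<in> space N" for z y
  proof -
    have mem: "(t z, y) \<in> S' k \<longleftrightarrow> q k < f z y" for k
      using A[of k] zy by (auto simp: set_factor_def t_def S_def space_pair_measure)
    show ?thesis
    proof (rule antisym)
      show "F (t z, y) \<le> ereal (f z y)"
        unfolding F_def by (rule SUP_least) (auto simp: mem)
      show "ereal (f z y) \<le> F (t z, y)"
      proof (rule dense_le)
        fix x assume "x < ereal (f z y)"
        then obtain u where u: "x < ereal u" "ereal u < ereal (f z y)"
          using ereal_dense2 by blast
        then obtain k' where k': "u < of_rat k'" "of_rat k' < f z y"
          using of_rat_dense[of u "f z y"] by auto
        define k where "k = to_nat k'"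
        have k: "q k = of_rat k'" by (simp add: q_def k_def)
        have "ereal u < ereal (q k)" using k' by (simp add: k)
        then have "x \<le> (if (t z, y) \<in> S' k then ereal (q k) else -\<infinity>)"
          using u k' less_trans[of x "ereal u" "ereal (q k)"] by (simp add: mem k)
        also have "\<dots> \<le> F (t z, y)" unfolding F_def by (rule SUP_upper) simp
        finally show "x \<le> F (t z, y)" .
      qed
    qed
  qed
  show ?thesis
  proof (rule that[of t "\<lambda>c y. real_of_ereal (F (c, y))"])
    show "(\<lambda>(c, y). real_of_ereal (F (c, y))) \<in> borel_measurable (cantor \<Otimes>\<^sub>M N)"
      using F by (simp add: case_prod_unfold)
  qed (use t eq in auto)
qed

context measure_metric_group
begin

sublocale Metric_space "carrier K" d
  using metric by (simp add: compatible_right_invariant_metric_def)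

sublocale prob_space m
  using haar by (simp add: haar_probability_def)

lemma sets_haar: "sets m = sets (borel_of mtopology)"
  using haar by (simp add: haar_probability_def)

lemma space_haar: "space m = carrier K"
proof -
  have "space m = space (borel_of mtopology)"
    using sets_haar by (rule sets_eq_imp_space_eq)
  then show ?thesis by (simp add: borel_of_def space_measure_of_conv)
qed

lemma sets_borel_of: "sets (borel_of mtopology) = sigma_sets (carrier K) {U. openin mtopology U}"
proof -
  have "{U. openin mtopology U} \<subseteq> Pow (carrier K)"
    using openin_subset[of mtopology] by auto
  from sets_measure_of[OF this] show ?thesis by (simp add: borel_of_def)
qed

lemma openin_sets_haar: "openin mtopology U \<Longrightarrow> U \<in> sets m"
  by (simp add: sets_haar sets_borel_of sigma_sets.Basic)

lemma translate_measurable: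
  assumes "h \<in> carrier K"
  shows "(\<lambda>g. inv h \<otimes> g) \<in> measurable m m"
proof -
  have "continuous_map mtopology mtopology (\<lambda>g. (\<lambda>(x, y). x \<otimes> y) (inv h, g))"
    by (rule continuous_map_compose[OF _ continuous_mult, unfolded comp_def])
      (use assms in \<open>simp add: continuous_map_pairwise comp_def\<close>)
  then have cont: "continuous_map mtopology mtopology (\<lambda>g. inv h \<otimes> g)" by simp
  have "(\<lambda>g. inv h \<otimes> g) \<in> measurable m (sigma (carrier K) {U. openin mtopology U})"
  proof (rule measurable_measure_of)
    show "{U. openin mtopology U} \<subseteq> Pow (carrier K)"
      using openin_subset[of mtopology] by auto
    show "(\<lambda>g. inv h \<otimes> g) \<in> space m \<rightarrow> carrier K"
      using assms by (auto simp: space_haar)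
    fix U assume "U \<in> {U. openin mtopology U}"
    then show "(\<lambda>g. inv h \<otimes> g) -` U \<inter> space m \<in> sets m"
      using openin_continuous_map_preimage[OF cont, of U]
      by (auto simp: space_haar vimage_def Int_def conj_commute intro!: openin_sets_haar)
  qed
  moreover have "sets (sigma (carrier K) {U. openin mtopology U}) = sets m"
    by (simp add: sets_haar borel_of_def)
  ultimately show ?thesis
    using measurable_cong_sets by blast
qed

lemma lipschitz1_measurable:
  assumes "f \<in> lipschitz1 (carrier K) d"
  shows "f \<in> borel_measurable m"
proof (rule borel_measurableI)
  fix U :: "real set" assume U: "open U"
  have "openin mtopology {x \<in> carrier K. f x \<in> U}"
    unfolding openin_mtopology
  proof (intro conjI allI impI)
    fix x assume x: "x \<in> {x \<in> carrier K. f x \<in> U}"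
    then obtain e where e: "e > 0" "ball (f x) e \<subseteq> U"
      using U open_contains_ball by blast
    have "mball x e \<subseteq> {x \<in> carrier K. f x \<in> U}"
    proof
      fix y assume y: "y \<in> mball x e"
      then have "\<bar>f x - f y\<bar> < e"
        using assms x by (fastforce simp: lipschitz1_def)
      then have "f y \<in> ball (f x) e" by (simp add: dist_real_def)
      then show "y \<in> {x \<in> carrier K. f x \<in> U}" using e y by auto
    qed
    then show "\<exists>r>0. mball x r \<subseteq> {x \<in> carrier K. f x \<in> U}" using e by blast
  qed auto
  then show "f -` U \<inter> space m \<in> sets m"
    using openin_sets_haar by (simp add: space_haar vimage_def Int_def conj_commute)
qed

lemma lipschitz1_bounded:
  assumes "f \<in> lipschitz1 (carrier K) d"
  obtains B where "\<And>x. x \<in> carrier K \<Longrightarrow> \<bar>f x\<bar> \<le> B"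
proof -
  have "mbounded (carrier K)"
    using compactin_imp_mbounded compact by (simp add: compact_space_def)
  then obtain D where D: "\<And>x y. x \<in> carrier K \<Longrightarrow> y \<in> carrier K \<Longrightarrow> d x y \<le> D"
    unfolding mbounded_alt by blast
  have "\<bar>f x\<bar> \<le> \<bar>f \<one>\<bar> + D" if "x \<in> carrier K" for x
  proof -
    have "\<bar>f x - f \<one>\<bar> \<le> d x \<one>" using assms that by (simp add: lipschitz1_def)
    then show ?thesis using D[of x \<one>] that by simp
  qed
  then show ?thesis by (rule that)
qed

lemma lipschitz1_integrable:
  assumes "f \<in> lipschitz1 (carrier K) d" "prob_space \<alpha>" "sets \<alpha> = sets m"
  shows "integrable \<alpha> f"
proof -
  interpret \<alpha>: prob_space \<alpha> by fact
  have "space \<alpha> = carrier K"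
    using sets_eq_imp_space_eq[OF assms(3)] by (simp add: space_haar)
  moreover obtain B where "\<And>x. x \<in> carrier K \<Longrightarrow> \<bar>f x\<bar> \<le> B"
    using lipschitz1_bounded assms(1) by blast
  moreover have "f \<in> borel_measurable \<alpha>"
    using lipschitz1_measurable[OF assms(1)] measurable_cong_sets[OF assms(3) refl] by blast
  ultimately show ?thesis
    by (intro \<alpha>.integrable_const_bound[of _ B]) auto
qed

lemma countable_lipschitz1:
  obtains L where "countable L" "L \<subseteq> lipschitz1 (carrier K) d"
    "\<And>f e. f \<in> lipschitz1 (carrier K) d \<Longrightarrow> e > 0 \<Longrightarrow>
       \<exists>g\<in>L. \<forall>x\<in>carrier K. \<bar>f x - g x\<bar> \<le> (e :: real)"
proof -
  have "mtotally_bounded (carrier K)"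
    using compactin_imp_mtotally_bounded compact by (simp add: compact_space_def)
  then have "\<exists>N. finite N \<and> N \<subseteq> carrier K \<and> carrier K \<subseteq> (\<Union>x\<in>N. mball x (1 / Suc n))" for n
    unfolding mtotally_bounded_def by simp
  then obtain N where N: "\<And>n. finite (N n)" "\<And>n. N n \<subseteq> carrier K"
      "\<And>n. carrier K \<subseteq> (\<Union>x\<in>N n. mball x (1 / Suc n))"
    by metis
  have ne: "N n \<noteq> {}" for n using N(3)[of n] one_closed by auto
  define G where "G n q x = Min ((\<lambda>p. q p + d x p) ` N n)" for n :: nat and q :: "'a \<Rightarrow> real" and x
  define L where "L = (\<Union>n. G n ` (N n \<rightarrow>\<^sub>E \<rat>))"
  have G_le: "G n q x \<le> q p + d x p" if "p \<in> N n" for n q x p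
    unfolding G_def using N that by (intro Min_le) auto
  have G_ex: "\<exists>p\<in>N n. G n q x = q p + d x p" for n q x
  proof -
    have "G n q x \<in> (\<lambda>p. q p + d x p) ` N n"
      unfolding G_def using N ne by (intro Min_in) auto
    then show ?thesis by auto
  qed
  have G_lip1: "G n q x - G n q y \<le> d x y" if xy: "x \<in> carrier K" "y \<in> carrier K" for n q x y
  proof -
    obtain p where p: "p \<in> N n" "G n q y = q p + d y p" using G_ex by blast
    have "d x p \<le> d x y + d y p" using xy p N(2)[of n] triangle by blast
    then show ?thesis using G_le[OF p(1), of q x] p by linarith
  qed
  show ?thesis
  proof (rule that[of L])
    show "countable L"
      unfolding L_def by (intro countable_UN countable_image countable_PiE N countable_rat) auto
    show "L \<subseteq> lipschitz1 (carrier K) d"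
    proof
      fix g assume "g \<in> L"
      then obtain n q where g: "g = G n q" by (auto simp: L_def)
      show "g \<in> lipschitz1 (carrier K) d"
        unfolding lipschitz1_def g
      proof (intro CollectI ballI)
        fix x y assume "x \<in> carrier K" "y \<in> carrier K"
        then show "\<bar>G n q x - G n q y\<bar> \<le> d x y"
          using G_lip1[of x y n q] G_lip1[of y x n q] commute[of x y] by linarith
      qed
    qed
    fix f and e :: real
    assume f: "f \<in> lipschitz1 (carrier K) d" and e: "e > 0"
    obtain n where n: "1 / Suc n < e / 3"
      using nat_approx_posE[of "e / 3"] e by auto
    have "\<exists>q\<in>\<rat>. f p < q \<and> q < f p + e / 3" for p
      using Rats_dense_in_real[of "f p" "f p + e / 3"] e by auto
    then obtain q where q: "\<And>p. q p \<in> \<rat>" "\<And>p. f p < q p" "\<And>p. q p < f p + e / 3"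
      by metis
    define q' where "q' = restrict q (N n)"
    have "q' \<in> N n \<rightarrow>\<^sub>E \<rat>" using q by (simp add: q'_def)
    then have "G n q' \<in> L" unfolding L_def by blast
    moreover have "\<bar>f x - G n q' x\<bar> \<le> e" if x: "x \<in> carrier K" for x
    proof -
      obtain p where p: "p \<in> N n" "G n q' x = q' p + d x p" using G_ex by blast
      have "\<bar>f x - f p\<bar> \<le> d x p" using f x p N(2)[of n] by (auto simp: lipschitz1_def)
      then have 1: "f x \<le> G n q' x" using p q(2)[of p] by (simp add: q'_def)
      obtain p' where p': "p' \<in> N n" "x \<in> mball p' (1 / Suc n)" using N(3)[of n] x by blast
      then have d: "d x p' < e / 3" using n commute[of x p'] by simp
      have "\<bar>f x - f p'\<bar> \<le> d x p'" using f x p' by (auto simp: lipschitz1_def)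
      then have "G n q' x \<le> f x + e"
        using G_le[OF p'(1), of q' x] q(3)[of p'] p'(1) d by (simp add: q'_def)
      then show ?thesis using 1 by simp
    qed
    ultimately show "\<exists>g\<in>L. \<forall>x\<in>carrier K. \<bar>f x - g x\<bar> \<le> e" by blast
  qed
qed

lemma wasserstein_countable:
  assumes L: "L \<subseteq> lipschitz1 (carrier K) d"
    and dense: "\<And>f e. f \<in> lipschitz1 (carrier K) d \<Longrightarrow> e > 0 \<Longrightarrow>
       \<exists>g\<in>L. \<forall>x\<in>carrier K. \<bar>f x - g x\<bar> \<le> (e :: real)"
    and \<alpha>: "prob_space \<alpha>" "sets \<alpha> = sets m" and \<beta>: "prob_space \<beta>" "sets \<beta> = sets m"
  shows "wasserstein (carrier K) d \<alpha> \<beta> =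
    (SUP f\<in>L. ennreal \<bar>(\<integral>x. f x \<partial>\<alpha>) - (\<integral>x. f x \<partial>\<beta>)\<bar>)" (is "_ = ?R")
  unfolding wasserstein_def
proof (rule antisym)
  show "?R \<le> (SUP f\<in>lipschitz1 (carrier K) d. ennreal \<bar>(\<integral>x. f x \<partial>\<alpha>) - (\<integral>x. f x \<partial>\<beta>)\<bar>)"
    by (rule SUP_subset_mono[OF L]) simp
  have close: "\<bar>(\<integral>x. f x \<partial>\<gamma>) - (\<integral>x. g x \<partial>\<gamma>)\<bar> \<le> e"
    if fg: "f \<in> lipschitz1 (carrier K) d" "g \<in> lipschitz1 (carrier K) d"
      "\<forall>x\<in>carrier K. \<bar>f x - g x\<bar> \<le> e"
      and \<gamma>: "prob_space \<gamma>" "sets \<gamma> = sets m" for f g e \<gamma>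
  proof -
    interpret \<gamma>: prob_space \<gamma> by fact
    have sp: "space \<gamma> = carrier K"
      using sets_eq_imp_space_eq[OF \<gamma>(2)] by (simp add: space_haar)
    have int: "integrable \<gamma> f" "integrable \<gamma> g"
      using fg \<gamma> lipschitz1_integrable by auto
    have "\<bar>(\<integral>x. f x \<partial>\<gamma>) - (\<integral>x. g x \<partial>\<gamma>)\<bar> = \<bar>\<integral>x. f x - g x \<partial>\<gamma>\<bar>" using int by simp
    also have "\<dots> \<le> (\<integral>x. \<bar>f x - g x\<bar> \<partial>\<gamma>)" by (rule integral_abs_bound)
    also have "\<dots> \<le> (\<integral>x. e \<partial>\<gamma>)"
      using int fg by (intro integral_mono) (auto simp: sp)
    finally show ?thesis by (simp add: \<gamma>.prob_space)
  qed
  show "(SUP f\<in>lipschitz1 (carrier K) d. ennreal \<bar>(\<integral>x. f x \<partial>\<alpha>) - (\<integral>x. f x \<partial>\<beta>)\<bar>) \<le> ?R"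
  proof (rule SUP_least)
    fix f assume f: "f \<in> lipschitz1 (carrier K) d"
    show "ennreal \<bar>(\<integral>x. f x \<partial>\<alpha>) - (\<integral>x. f x \<partial>\<beta>)\<bar> \<le> ?R"
    proof (rule ennreal_le_epsilon)
      fix e :: real assume e: "0 < e"
      then obtain g where g: "g \<in> L" "\<forall>x\<in>carrier K. \<bar>f x - g x\<bar> \<le> e / 2"
        using dense[OF f, of "e / 2"] by auto
      have gl: "g \<in> lipschitz1 (carrier K) d" using g L by auto
      have "\<bar>(\<integral>x. f x \<partial>\<alpha>) - (\<integral>x. f x \<partial>\<beta>)\<bar> \<le> \<bar>(\<integral>x. g x \<partial>\<alpha>) - (\<integral>x. g x \<partial>\<beta>)\<bar> + e"
        using close[OF f gl g(2) \<alpha>] close[OF f gl g(2) \<beta>] by linarith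
      then have "ennreal \<bar>(\<integral>x. f x \<partial>\<alpha>) - (\<integral>x. f x \<partial>\<beta>)\<bar>
          \<le> ennreal \<bar>(\<integral>x. g x \<partial>\<alpha>) - (\<integral>x. g x \<partial>\<beta>)\<bar> + ennreal e"
        using e by (simp add: ennreal_leI flip: ennreal_plus)
      also have "\<dots> \<le> ?R + ennreal e"
        using g(1) by (intro add_right_mono SUP_upper)
      finally show "ennreal \<bar>(\<integral>x. f x \<partial>\<alpha>) - (\<integral>x. f x \<partial>\<beta>)\<bar> \<le> ?R + ennreal e" .
    qed
  qed
qed

lemma prob_space_density:
  assumes "\<phi> \<in> densities m"
  shows "prob_space (density m (\<lambda>g. ennreal (\<phi> g)))"
proof
  have "(\<integral>\<^sup>+g. ennreal (\<phi> g) \<partial>m) = ennreal (\<integral>g. \<phi> g \<partial>m)"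
    using assms by (intro nn_integral_eq_integral) (auto simp: densities_def)
  moreover have "(\<lambda>g. ennreal (\<phi> g)) \<in> borel_measurable m"
    using assms by (auto simp: densities_def)
  ultimately show "emeasure (density m (\<lambda>g. ennreal (\<phi> g)))
      (space (density m (\<lambda>g. ennreal (\<phi> g)))) = 1"
    using assms by (subst emeasure_density) (auto simp: densities_def cong: nn_integral_cong)
qed

lemma wasserstein_measurable:
  assumes "measurable_kernel m \<zeta> \<Phi>"
  shows "(\<lambda>z. wasserstein (carrier K) d (density m (\<lambda>g. ennreal (\<Phi> z g))) m) \<in> borel_measurable \<zeta>"
proof -
  obtain L where L: "countable L" "L \<subseteq> lipschitz1 (carrier K) d"
    "\<And>f e. f \<in> lipschitz1 (carrier K) d \<Longrightarrow> e > 0 \<Longrightarrow>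
       \<exists>g\<in>L. \<forall>x\<in>carrier K. \<bar>f x - g x\<bar> \<le> (e :: real)"
    using countable_lipschitz1 by blast
  have \<Phi>: "(\<lambda>x. \<Phi> (fst x) (snd x)) \<in> borel_measurable (\<zeta> \<Otimes>\<^sub>M m)"
    and dens: "\<And>z. z \<in> space \<zeta> \<Longrightarrow> \<Phi> z \<in> densities m"
    using assms by (auto simp: measurable_kernel_def case_prod_unfold)
  have eq: "wasserstein (carrier K) d (density m (\<lambda>g. ennreal (\<Phi> z g))) m =
      (SUP f\<in>L. ennreal \<bar>(\<integral>g. \<Phi> z g * f g \<partial>m) - (\<integral>g. f g \<partial>m)\<bar>)" if z: "z \<in> space \<zeta>" for z
  proof -
    have "(\<integral>g. f g \<partial>density m (\<lambda>g. ennreal (\<Phi> z g))) = (\<integral>g. \<Phi> z g * f g \<partial>m)" if "f \<in> L" for f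
      using that L(2) dens[OF z] lipschitz1_measurable[of f]
      by (intro integral_real_density) (auto simp: densities_def)
    then show ?thesis
      using wasserstein_countable[OF L(2,3) prob_space_density[OF dens[OF z]] _ prob_space_axioms]
      by simp
  qed
  have "(\<lambda>z. SUP f\<in>L. ennreal \<bar>(\<integral>g. \<Phi> z g * f g \<partial>m) - (\<integral>g. f g \<partial>m)\<bar>) \<in> borel_measurable \<zeta>"
  proof (intro borel_measurable_SUP L)
    fix f assume "f \<in> L"
    then have f: "f \<in> borel_measurable m" using L lipschitz1_measurable by auto
    have "(\<lambda>(z, g). \<Phi> z g * f g) \<in> borel_measurable (\<zeta> \<Otimes>\<^sub>M m)"
      unfolding case_prod_unfold
      by (rule borel_measurable_times[OF \<Phi> measurable_compose[OF measurable_snd f]])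
    then have "(\<lambda>z. \<integral>g. \<Phi> z g * f g \<partial>m) \<in> borel_measurable \<zeta>"
      by (rule borel_measurable_lebesgue_integral)
    then show "(\<lambda>z. ennreal \<bar>(\<integral>g. \<Phi> z g * f g \<partial>m) - (\<integral>g. f g \<partial>m)\<bar>) \<in> borel_measurable \<zeta>"
      by measurable
  qed
  then show ?thesis using eq by (subst measurable_cong) auto
qed

lemma total_variation_measurable:
  assumes "measurable_kernel m \<zeta> \<Phi>" and h: "h \<in> carrier K"
  shows "(\<lambda>z. ennreal (total_variation m (translate K h (\<Phi> z)) (\<Phi> z))) \<in> borel_measurable \<zeta>"
proof -
  have \<Phi>: "(\<lambda>x. \<Phi> (fst x) (snd x)) \<in> borel_measurable (\<zeta> \<Otimes>\<^sub>M m)"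
    using assms by (auto simp: measurable_kernel_def case_prod_unfold)
  have "(\<lambda>x. (fst x, inv h \<otimes> snd x)) \<in> measurable (\<zeta> \<Otimes>\<^sub>M m) (\<zeta> \<Otimes>\<^sub>M m)"
    by (rule measurable_Pair[OF measurable_fst
          measurable_compose[OF measurable_snd translate_measurable[OF h]]])
  from measurable_compose[OF this \<Phi>]
  have "(\<lambda>x. \<Phi> (fst x) (inv h \<otimes> snd x)) \<in> borel_measurable (\<zeta> \<Otimes>\<^sub>M m)" by simp
  then have "(\<lambda>(z, g). \<bar>\<Phi> z (inv h \<otimes> g) - \<Phi> z g\<bar>) \<in> borel_measurable (\<zeta> \<Otimes>\<^sub>M m)"
    using \<Phi> unfolding case_prod_unfold by measurable
  then have "(\<lambda>z. \<integral>g. \<bar>\<Phi> z (inv h \<otimes> g) - \<Phi> z g\<bar> \<partial>m) \<in> borel_measurable \<zeta>"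
    by (rule borel_measurable_lebesgue_integral)
  then show ?thesis
    unfolding total_variation_def translate_def by measurable
qed

lemma densities_measurable:
  assumes f: "(\<lambda>(c, g). f c g) \<in> borel_measurable (M \<Otimes>\<^sub>M m)"
  shows "{c \<in> space M. f c \<in> densities m} \<in> sets M"
proof -
  have slice: "f c \<in> borel_measurable m" if "c \<in> space M" for c
    using measurable_Pair2[OF f that] by simp
  have f': "(\<lambda>x. f (fst x) (snd x)) \<in> borel_measurable (M \<Otimes>\<^sub>M m)"
    using f by (simp add: case_prod_unfold)
  have pos: "(AE g in m. 0 \<le> f c g) \<longleftrightarrow> (\<integral>\<^sup>+g. ennreal (- f c g) \<partial>m) = 0" if "c \<in> space M" for c
    using slice[OF that] by (subst nn_integral_0_iff_AE) (auto simp: ennreal_eq_0_iff)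
  have int: "integrable m (f c) \<longleftrightarrow> (\<integral>\<^sup>+g. ennreal \<bar>f c g\<bar> \<partial>m) < \<infinity>" if "c \<in> space M" for c
    using slice[OF that] by (simp add: integrable_iff_bounded)
  have 1: "(\<lambda>c. \<integral>\<^sup>+g. ennreal (- f c g) \<partial>m) \<in> borel_measurable M"
    by (rule borel_measurable_nn_integral) (use f' in \<open>simp add: case_prod_unfold\<close>)
  have 2: "(\<lambda>c. \<integral>\<^sup>+g. ennreal \<bar>f c g\<bar> \<partial>m) \<in> borel_measurable M"
    by (rule borel_measurable_nn_integral) (use f' in \<open>simp add: case_prod_unfold\<close>)
  have 3: "(\<lambda>c. \<integral>g. f c g \<partial>m) \<in> borel_measurable M"
    by (rule borel_measurable_lebesgue_integral[OF f])
  have "{c \<in> space M. f c \<in> densities m} =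
      {c \<in> space M. (\<integral>\<^sup>+g. ennreal \<bar>f c g\<bar> \<partial>m) < \<infinity>} \<inter>
      {c \<in> space M. (\<integral>\<^sup>+g. ennreal (- f c g) \<partial>m) = 0} \<inter> {c \<in> space M. (\<integral>g. f c g \<partial>m) = 1}"
    using pos int by (auto simp: densities_def)
  then show ?thesis using 1 2 3 by simp
qed

lemma translate_cong:
  assumes "\<And>g. g \<in> carrier K \<Longrightarrow> \<phi> g = \<psi> g" "h \<in> carrier K" "g \<in> carrier K"
  shows "translate K h \<phi> g = translate K h \<psi> g"
  using assms by (simp add: translate_def)

lemma kernel_on_cantor:
  assumes ker: "measurable_kernel m \<zeta> \<Phi>"
  obtains \<zeta>' :: "(nat \<Rightarrow> bool) measure" and \<Phi>' where
    "measurable_kernel m \<zeta>' \<Phi>'"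
    "\<And>r. kernel_v K d m \<zeta>' \<Phi>' r = kernel_v K d m \<zeta> \<Phi> r"
    "kernel_w K d m \<zeta>' \<Phi>' = kernel_w K d m \<zeta> \<Phi>"
proof -
  interpret \<zeta>: prob_space \<zeta> using ker by (simp add: measurable_kernel_def)
  have "(\<lambda>(z, g). \<Phi> z g) \<in> borel_measurable (\<zeta> \<Otimes>\<^sub>M m)"
    using ker by (simp add: measurable_kernel_def)
  then obtain t f where t: "t \<in> measurable \<zeta> cantor"
    and f: "(\<lambda>(c, g). f c g) \<in> borel_measurable (cantor \<Otimes>\<^sub>M m)"
    and eq0: "\<And>z g. z \<in> space \<zeta> \<Longrightarrow> g \<in> space m \<Longrightarrow> f (t z) g = \<Phi> z g"
    by (rule function_factor) blast
  define \<Phi>' where "\<Phi>' c g = (if f c \<in> densities m then f c g else 1)" for c g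
  define \<zeta>' where "\<zeta>' = distr \<zeta> cantor t"
  have sets: "sets \<zeta>' = sets cantor" by (simp add: \<zeta>'_def)
  have dens_eq: "f (t z) \<in> densities m" if "z \<in> space \<zeta>" for z
  proof -
    have "\<Phi> z \<in> densities m" using ker that by (simp add: measurable_kernel_def)
    moreover have "integrable m (f (t z)) = integrable m (\<Phi> z)"
      using eq0[OF that] by (intro Bochner_Integration.integrable_cong) auto
    moreover have "(\<integral>g. f (t z) g \<partial>m) = (\<integral>g. \<Phi> z g \<partial>m)"
      using eq0[OF that] by (intro Bochner_Integration.integral_cong) auto
    moreover have "(AE g in m. 0 \<le> f (t z) g) \<longleftrightarrow> (AE g in m. 0 \<le> \<Phi> z g)"
      using eq0[OF that] by (intro AE_cong) auto
    ultimately show ?thesis by (simp add: densities_def)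
  qed
  have eq: "\<Phi>' (t z) g = \<Phi> z g" if "z \<in> space \<zeta>" "g \<in> carrier K" for z g
    using that eq0 dens_eq by (simp add: \<Phi>'_def space_haar)
  have one: "(\<lambda>g. 1) \<in> densities m" by (simp add: densities_def prob_space)
  have Gd: "{c. f c \<in> densities m} \<in> sets cantor"
    using densities_measurable[OF f] by simp
  have "(\<lambda>x. \<Phi>' (fst x) (snd x)) \<in> borel_measurable (cantor \<Otimes>\<^sub>M m)"
    unfolding \<Phi>'_def
  proof (rule measurable_If)
    have "{x \<in> space (cantor \<Otimes>\<^sub>M m). f (fst x) \<in> densities m} = {c. f c \<in> densities m} \<times> space m"
      by (auto simp: space_pair_measure)
    then show "{x \<in> space (cantor \<Otimes>\<^sub>M m). f (fst x) \<in> densities m} \<in> sets (cantor \<Otimes>\<^sub>M m)"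
      using Gd by simp
  qed (use f in \<open>simp_all add: case_prod_unfold\<close>)
  moreover have "\<Phi>' c \<in> densities m" for c
    using one by (cases "f c \<in> densities m") (simp_all add: \<Phi>'_def[abs_def])
  moreover have "prob_space \<zeta>'"
    unfolding \<zeta>'_def by (rule \<zeta>.prob_space_distr[OF t])
  ultimately have ker': "measurable_kernel m \<zeta>' \<Phi>'"
    unfolding measurable_kernel_def case_prod_unfold
    using measurable_cong_sets[OF sets_pair_measure_cong[OF sets refl] refl] by blast
  have v: "(\<integral>\<^sup>+c. ennreal (total_variation m (translate K h (\<Phi>' c)) (\<Phi>' c)) \<partial>\<zeta>') =
      (\<integral>\<^sup>+z. ennreal (total_variation m (translate K h (\<Phi> z)) (\<Phi> z)) \<partial>\<zeta>)"
    if h: "h \<in> carrier K" for h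
  proof -
    have "(\<lambda>c. ennreal (total_variation m (translate K h (\<Phi>' c)) (\<Phi>' c))) \<in> borel_measurable cantor"
      using total_variation_measurable[OF ker' h] measurable_cong_sets[OF sets refl] by blast
    then have "(\<integral>\<^sup>+c. ennreal (total_variation m (translate K h (\<Phi>' c)) (\<Phi>' c)) \<partial>\<zeta>') =
        (\<integral>\<^sup>+z. ennreal (total_variation m (translate K h (\<Phi>' (t z))) (\<Phi>' (t z))) \<partial>\<zeta>)"
      unfolding \<zeta>'_def by (intro nn_integral_distr t)
        (simp_all add: measurable_cong_sets[OF sets_distr refl])
    also have "\<dots> = (\<integral>\<^sup>+z. ennreal (total_variation m (translate K h (\<Phi> z)) (\<Phi> z)) \<partial>\<zeta>)"
    proof (rule nn_integral_cong)
      fix z assume z: "z \<in> space \<zeta>"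
      have "total_variation m (translate K h (\<Phi>' (t z))) (\<Phi>' (t z)) =
          total_variation m (translate K h (\<Phi> z)) (\<Phi> z)"
        unfolding total_variation_def
        using eq[OF z] translate_cong[OF eq[OF z] h]
        by (intro arg_cong2[where f = "(*)"] refl Bochner_Integration.integral_cong)
          (auto simp: space_haar)
      then show "ennreal (total_variation m (translate K h (\<Phi>' (t z))) (\<Phi>' (t z))) =
          ennreal (total_variation m (translate K h (\<Phi> z)) (\<Phi> z))" by simp
    qed
    finally show ?thesis .
  qed
  have w: "kernel_w K d m \<zeta>' \<Phi>' = kernel_w K d m \<zeta> \<Phi>"
  proof -
    let ?W = "\<lambda>\<phi>. wasserstein (carrier K) d (density m (\<lambda>g. ennreal (\<phi> g))) m"
    have "(\<lambda>c. ?W (\<Phi>' c)) \<in> borel_measurable cantor"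
      using wasserstein_measurable[OF ker'] measurable_cong_sets[OF sets refl] by blast
    then have "(\<integral>\<^sup>+c. ?W (\<Phi>' c) \<partial>\<zeta>') = (\<integral>\<^sup>+z. ?W (\<Phi>' (t z)) \<partial>\<zeta>)"
      unfolding \<zeta>'_def by (intro nn_integral_distr t)
        (simp_all add: measurable_cong_sets[OF sets_distr refl])
    also have "\<dots> = (\<integral>\<^sup>+z. ?W (\<Phi> z) \<partial>\<zeta>)"
    proof (rule nn_integral_cong)
      fix z assume z: "z \<in> space \<zeta>"
      have "\<Phi>' (t z) \<in> borel_measurable m"
        using ker' dens_eq[OF z] \<open>\<And>c. \<Phi>' c \<in> densities m\<close> by (auto simp: densities_def)
      moreover have "\<Phi> z \<in> borel_measurable m"
        using ker z by (auto simp: measurable_kernel_def densities_def)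
      ultimately have "density m (\<lambda>g. ennreal (\<Phi>' (t z) g)) = density m (\<lambda>g. ennreal (\<Phi> z g))"
        using eq[OF z] by (intro density_cong AE_I2) (auto simp: space_haar)
      then show "?W (\<Phi>' (t z)) = ?W (\<Phi> z)" by simp
    qed
    finally show ?thesis by (simp add: kernel_w_def)
  qed
  show ?thesis
  proof (rule that[OF ker' _ w])
    show "kernel_v K d m \<zeta>' \<Phi>' r = kernel_v K d m \<zeta> \<Phi> r" for r
      unfolding kernel_v_def using v by (intro SUP_cong) auto
  qed
qed

theorem kernel_w_le_modulus:
  fixes \<zeta> :: "'z measure"
  assumes "measurable_kernel m \<zeta> \<Phi>" "kernel_v K d m \<zeta> \<Phi> r \<le> ennreal \<epsilon>"
  shows "kernel_w K d m \<zeta> \<Phi> \<le> wasserstein_modulus K d m r \<epsilon>"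
proof -
  obtain \<zeta>' :: "(nat \<Rightarrow> bool) measure" and \<Phi>' where *: "measurable_kernel m \<zeta>' \<Phi>'"
    "\<And>r. kernel_v K d m \<zeta>' \<Phi>' r = kernel_v K d m \<zeta> \<Phi> r"
    "kernel_w K d m \<zeta>' \<Phi>' = kernel_w K d m \<zeta> \<Phi>"
    using kernel_on_cantor[OF assms(1)] by blast
  have "kernel_w K d m \<zeta>' \<Phi>' \<le> wasserstein_modulus K d m r \<epsilon>"
    unfolding wasserstein_modulus_def
    by (rule SUP_upper2[of "(\<zeta>', \<Phi>')"]) (use * assms in auto)
  then show ?thesis using * by simp
qed

end

definition wasserstein_family ::
    "(nat \<Rightarrow> ('a, 'b) monoid_scheme) \<Rightarrow> (nat \<Rightarrow> 'a \<Rightarrow> 'a \<Rightarrow> real) \<Rightarrow> (nat \<Rightarrow> 'a measure) \<Rightarrow> bool" where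
  "wasserstein_family K d m \<longleftrightarrow>
     (\<forall>n. measure_metric_group (K n) (d n) (m n)) \<and>
     (\<exists>r :: nat \<Rightarrow> real. (\<forall>n. 0 < r n) \<and> r \<longlonglongrightarrow> 0 \<and>
        (\<forall>\<epsilon> :: nat \<Rightarrow> real. (\<forall>n. 0 < \<epsilon> n) \<longrightarrow> \<epsilon> \<longlonglongrightarrow> 0 \<longrightarrow>
           (\<lambda>n. wasserstein_modulus (K n) (d n) (m n) (r n) (\<epsilon> n)) \<longlonglongrightarrow> 0))"

definition concentration_function ::
    "('a, 'b) monoid_scheme \<Rightarrow> ('a \<Rightarrow> 'a \<Rightarrow> real) \<Rightarrow> 'a measure \<Rightarrow> real \<Rightarrow> real" where
  "concentration_function K d m \<epsilon> =
     1 - (INF A\<in>{A \<in> sets m. 1/2 \<le> measure m A}.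
            measure m (\<Union>a\<in>A. Metric_space.mball (carrier K) d a \<epsilon>))"

definition levy_family ::
    "(nat \<Rightarrow> ('a, 'b) monoid_scheme) \<Rightarrow> (nat \<Rightarrow> 'a \<Rightarrow> 'a \<Rightarrow> real) \<Rightarrow> (nat \<Rightarrow> 'a measure) \<Rightarrow> bool" where
  "levy_family K d m \<longleftrightarrow>
     (\<forall>n. measure_metric_group (K n) (d n) (m n)) \<and>
     (\<forall>\<epsilon>>0. (\<lambda>n. concentration_function (K n) (d n) (m n) \<epsilon>) \<longlonglongrightarrow> 0)"

definition exhausting_compact_subgroups ::
    "('a, 'b) monoid_scheme \<Rightarrow> 'a topology \<Rightarrow> (nat \<Rightarrow> 'a set) \<Rightarrow> bool" where
  "exhausting_compact_subgroups G T K \<longleftrightarrow>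
     (\<forall>n. subgroup (K n) G \<and> compactin T (K n) \<and> K n \<subseteq> K (Suc n)) \<and>
     T closure_of (\<Union>n. K n) = carrier G"

definition wasserstein_group :: "('a, 'b) monoid_scheme \<Rightarrow> 'a topology \<Rightarrow> bool" where
  "wasserstein_group G T \<longleftrightarrow> polish_group G T \<and>
     (\<exists>d K m. compatible_right_invariant_metric G T d \<and> exhausting_compact_subgroups G T K \<and>
        wasserstein_family (\<lambda>n. G\<lparr>carrier := K n\<rparr>) (\<lambda>n. d) m)"

definition levy_group :: "('a, 'b) monoid_scheme \<Rightarrow> 'a topology \<Rightarrow> bool" where
  "levy_group G T \<longleftrightarrow> polish_group G T \<and>
     (\<exists>d K m. compatible_right_invariant_metric G T d \<and> exhausting_compact_subgroups G T K \<and>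
        levy_family (\<lambda>n. G\<lparr>carrier := K n\<rparr>) (\<lambda>n. d) m)"

definition quotient_radius ::
    "('a, 'b) monoid_scheme \<Rightarrow> ('a \<Rightarrow> 'a \<Rightarrow> real) \<Rightarrow> 'a set \<Rightarrow> 'a set \<Rightarrow> real" where
  "quotient_radius G d H H' = (SUP g\<in>H. INF h\<in>H'. d \<one>\<^bsub>G\<^esub> (g \<otimes>\<^bsub>G\<^esub> h))"

end

theory Submission
  imports Defs
begin

text \<open>
  Let \<open>A \<subseteq> B\<close> be consecutive members \<open>H n i\<close>, \<open>H n (i + 1)\<close> of a chain and let \<open>f\<close> be 1-Lipschitz. Write
  \<open>f\<^sub>A(y)\<close> for the mean of \<open>f(k y)\<close> over \<open>k \<in> A\<close>. By right-invariance of \<open>d\<close>, the function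
  \<open>D = f\<^sub>A - f\<^sub>B\<close> is bounded by the quotient radius \<open>\<rho>\<close>. It is left \<open>A\<close>-invariant and its mean
  over \<open>B\<close> vanishes; every \<open>b \<in> B\<close> is \<open>b = a u\<close> with \<open>a \<in> A\<close> and \<open>d(e, u) \<le> \<rho>\<close>, so that
  \<open>D(b y) = D(u y)\<close>. Hence the integral of \<open>D\<close> against a density \<open>\<phi>\<close> is at most \<open>2 \<rho>\<close> times an
  average of total variations between \<open>\<phi>\<close> and its translates by such \<open>u\<close>. Summing along the chain
  and integrating over the kernel gives \<open>\<Omega>(r, \<epsilon>) \<le> 2 (\<Sum> \<rho>) \<epsilon>\<close> as soon as no \<open>\<rho>\<close> exceeds \<open>r\<close>.

  The averages over the subgroups are taken over finite lists which are invariant up to an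
  arbitrarily small error; this avoids Haar integrals over subgroups, and the limit of such
  averages over a whole compact group also yields the Haar measure.
\<close>

section \<open>Approximately invariant finite means\<close>

text \<open>The metric is only right-invariant: k -> f(k y) is 1-Lipschitz, but y -> f(k y) need not
  be. The averaged functions are therefore controlled by sup bounds and measurability, and Lipschitz
  estimates are always applied in the variable k. In the definition of w the supremum over f stands
  inside the integral over z, whereas v controls one fixed translate at a time, and only after
  integration over z. So the bound found at each z must not mention f, and the averaging lists and
  the elements u must be chosen before f and z. With finite lists, the average over u commutes with
  the integral over z as a finite sum. The factor 2 is the normalisation of total variation as half
  of an L1 norm. The length of a chain is not bounded in n, so the error of the finite means must be
  chosen after the chain is known. A Wasserstein group requires Haar measures on the subgroups K_n
  to exist. They are constructed from limits of finite means of Lipschitz functions, by a Riesz-type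
  outer measure.\<close>

definition mean :: "'i list \<Rightarrow> ('i \<Rightarrow> real) \<Rightarrow> real" where
  "mean xs F = (\<Sum>i<length xs. F (xs ! i)) / length xs"

lemma mean_cong: "(\<And>x. x \<in> set xs \<Longrightarrow> F x = F' x) \<Longrightarrow> mean xs F = mean xs F'"
  unfolding mean_def by (auto intro!: sum.cong)

lemma mean_sum_list: "mean xs F = sum_list (map F xs) / length xs"
  unfolding mean_def by (simp add: sum_list_sum_nth atLeast0LessThan)

lemma mean_const [simp]: "xs \<noteq> [] \<Longrightarrow> mean xs (\<lambda>_. c) = c"
  by (simp add: mean_def)

lemma mean_add: "mean xs (\<lambda>x. F x + F' x) = mean xs F + mean xs F'"
  by (simp add: mean_def sum.distrib add_divide_distrib)

lemma mean_diff: "mean xs (\<lambda>x. F x - F' x) = mean xs F - mean xs F'"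
  by (simp add: mean_def sum_subtractf diff_divide_distrib)

lemma mean_mult: "mean xs (\<lambda>x. c * F x) = c * mean xs F"
  by (simp add: mean_def sum_distrib_left)

lemma mean_mono: "(\<And>x. x \<in> set xs \<Longrightarrow> F x \<le> F' x) \<Longrightarrow> mean xs F \<le> mean xs F'"
  unfolding mean_def by (intro divide_right_mono sum_mono) auto

lemma mean_abs_le:
  assumes "xs \<noteq> []" "\<And>x. x \<in> set xs \<Longrightarrow> \<bar>F x - F' x\<bar> \<le> c"
  shows "\<bar>mean xs F - mean xs F'\<bar> \<le> c"
proof -
  have "mean xs F \<le> mean xs (\<lambda>x. F' x + c)" "mean xs F' \<le> mean xs (\<lambda>x. F x + c)"
    using assms(2) by (auto intro!: mean_mono simp: abs_le_iff algebra_simps)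
  then show ?thesis using assms(1) by (simp add: mean_add)
qed

lemma mean_swap: "mean xs (\<lambda>x. mean ys (F x)) = mean ys (\<lambda>y. mean xs (\<lambda>x. F x y))"
  unfolding mean_def sum_divide_distrib[symmetric]
  by (subst sum.swap) (simp only: divide_divide_eq_left mult.commute[of "real (length xs)"])

lemma mean_map: "mean (map g xs) F = mean xs (\<lambda>x. F (g x))"
  by (simp add: mean_sum_list comp_def)

text \<open>With \<open>mean_map\<close> this evaluates averages over lists of products, that is, it
  convolves two uniform distributions. Lists instead of finite sets count coinciding products with
  their multiplicity.\<close>

lemma mean_product: "mean (List.product xs ys) F = mean xs (\<lambda>x. mean ys (\<lambda>y. F (x, y)))"
proof -
  have "sum_list (map F (List.product xs ys)) = (\<Sum>x\<leftarrow>xs. \<Sum>y\<leftarrow>ys. F (x, y))"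
    by (induction xs) (simp_all add: comp_def)
  moreover have "(\<Sum>x\<leftarrow>xs. (\<Sum>y\<leftarrow>ys. F (x, y)) / length ys) = (\<Sum>x\<leftarrow>xs. \<Sum>y\<leftarrow>ys. F (x, y)) / length ys"
    by (induction xs) (simp_all add: add_divide_distrib)
  ultimately show ?thesis
    unfolding mean_sum_list by (simp add: divide_divide_eq_left mult.commute[of "real (length xs)"])
qed

lemma mean_abs_bound:
  assumes "\<And>x. x \<in> set xs \<Longrightarrow> \<bar>F x\<bar> \<le> F' x"
  shows "\<bar>mean xs F\<bar> \<le> mean xs F'"
proof -
  have "mean xs F \<le> mean xs F'" using assms by (intro mean_mono) (auto simp: abs_le_iff)
  moreover have "mean xs (\<lambda>x. - F' x) \<le> mean xs F"
  proof (rule mean_mono)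
    show "- F' x \<le> F x" if "x \<in> set xs" for x using assms[OF that] by linarith
  qed
  moreover have "mean xs (\<lambda>x. - F' x) = - mean xs F'" by (simp add: mean_def sum_negf)
  ultimately show ?thesis by linarith
qed

section \<open>Lists that are nearly invariant on both sides\<close>

lemma lipschitz1D: "\<lbrakk>f \<in> lipschitz1 X d; x \<in> X; y \<in> X\<rbrakk> \<Longrightarrow> \<bar>f x - f y\<bar> \<le> d x y"
  by (simp add: lipschitz1_def)

text \<open>The list is fixed before \<open>F\<close>, so one list serves all test functions. Both
  sides are used: left translations shift the argument of an average, right translations express
  that the averaged function is nearly left \<open>A\<close>-invariant. The group enters through its
  multiplication only, so the notion for a subgroup can be stated in the ambient group.\<close>

definition invariant_mean ::
    "('a, 'b) monoid_scheme \<Rightarrow> ('a \<Rightarrow> 'a \<Rightarrow> real) \<Rightarrow> 'a set \<Rightarrow> real \<Rightarrow> 'a list \<Rightarrow> bool" where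
  "invariant_mean G d A \<delta> xs \<longleftrightarrow> xs \<noteq> [] \<and> set xs \<subseteq> A \<and>
     (\<forall>F\<in>lipschitz1 A d. \<forall>x\<in>A.
        \<bar>mean xs (\<lambda>k. F (x \<otimes>\<^bsub>G\<^esub> k)) - mean xs F\<bar> \<le> \<delta> \<and>
        \<bar>mean xs (\<lambda>k. F (k \<otimes>\<^bsub>G\<^esub> x)) - mean xs F\<bar> \<le> \<delta>)"

lemma invariant_meanD:
  assumes "invariant_mean G d A \<delta> xs"
  shows "xs \<noteq> []" "set xs \<subseteq> A"
    "\<lbrakk>F \<in> lipschitz1 A d; x \<in> A\<rbrakk> \<Longrightarrow> \<bar>mean xs (\<lambda>k. F (x \<otimes>\<^bsub>G\<^esub> k)) - mean xs F\<bar> \<le> \<delta>"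
    "\<lbrakk>F \<in> lipschitz1 A d; x \<in> A\<rbrakk> \<Longrightarrow> \<bar>mean xs (\<lambda>k. F (k \<otimes>\<^bsub>G\<^esub> x)) - mean xs F\<bar> \<le> \<delta>"
proof -
  note D = assms[unfolded invariant_mean_def]
  show "xs \<noteq> []" by (rule D[THEN conjunct1])
  show "set xs \<subseteq> A" by (rule D[THEN conjunct2, THEN conjunct1])
  assume *: "F \<in> lipschitz1 A d" "x \<in> A"
  note E = D[THEN conjunct2, THEN conjunct2, THEN bspec, OF *(1), THEN bspec, OF *(2)]
  show "\<bar>mean xs (\<lambda>k. F (x \<otimes>\<^bsub>G\<^esub> k)) - mean xs F\<bar> \<le> \<delta>" by (rule E[THEN conjunct1])
  show "\<bar>mean xs (\<lambda>k. F (k \<otimes>\<^bsub>G\<^esub> x)) - mean xs F\<bar> \<le> \<delta>" by (rule E[THEN conjunct2])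
qed

section \<open>Invariant means on compact groups with a right-invariant metric\<close>

locale compact_metric_group =
  topological_group K "Metric_space.mtopology (carrier K) d" for K (structure) and d +
  assumes metric:
      "compatible_right_invariant_metric K (Metric_space.mtopology (carrier K) d) d"
    and compact: "compact_space (Metric_space.mtopology (carrier K) d)"
begin

sublocale Metric_space "carrier K" d
  using metric by (simp add: compatible_right_invariant_metric_def)

lemma right_invariant:
  "\<lbrakk>x \<in> carrier K; y \<in> carrier K; g \<in> carrier K\<rbrakk> \<Longrightarrow> d (x \<otimes> g) (y \<otimes> g) = d x y"
  using metric by (simp add: compatible_right_invariant_metric_def)

lemma totally_bounded: "mtotally_bounded (carrier K)"
  using compactin_imp_mtotally_bounded compact by (simp add: compact_space_def)

lemma diameter_bounded: "\<exists>D\<ge>0. \<forall>x\<in>carrier K. \<forall>y\<in>carrier K. d x y \<le> D"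
proof -
  have "mbounded (carrier K)"
    using compactin_imp_mbounded compact by (simp add: compact_space_def)
  then obtain D where "\<And>x y. x \<in> carrier K \<Longrightarrow> y \<in> carrier K \<Longrightarrow> d x y \<le> D"
    unfolding mbounded_alt by blast
  moreover from this have "0 \<le> D" by (metis nonneg one_closed order_trans)
  ultimately show ?thesis by blast
qed

text \<open>Left multiplication is not an isometry, so this replaces left-invariance: (w, a) -> w
  a^{-1} is continuous on a compact product, hence uniformly continuous, and the modulus does not
  depend on w.\<close>

lemma division_uniformly_continuous:
  assumes "e > 0"
  shows "\<exists>t>0. \<forall>w\<in>carrier K. \<forall>a\<in>carrier K. \<forall>b\<in>carrier K. d a b < t \<longrightarrow>
       d (w \<otimes> inv a) (w \<otimes> inv b) < e"
proof -
  interpret MM: Metric_space12 "carrier K" d "carrier K" d ..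
  let ?m = "metric (carrier K, d)"
  let ?f = "\<lambda>p. fst p \<otimes> inv (snd p)"
  have m: "mspace ?m = carrier K" "mdist ?m = d" "mtopology_of ?m = mtopology"
    unfolding mtopology_of_def by simp_all
  have top: "mtopology_of (prod_metric ?m ?m) = prod_topology mtopology mtopology"
    using mtopology_of_prod_metric[of ?m ?m] unfolding m .
  have inv': "continuous_map (prod_topology mtopology mtopology) mtopology (\<lambda>p. inv (snd p))"
    using continuous_map_compose[OF continuous_map_snd continuous_inv] by (simp add: comp_def)
  have "continuous_map (prod_topology mtopology mtopology) mtopology
      ((\<lambda>(x, y). x \<otimes> y) \<circ> (\<lambda>p. (fst p, inv (snd p))))"
    by (rule continuous_map_compose[OF _ continuous_mult])
      (use inv' in \<open>simp add: continuous_map_pairwise comp_def continuous_map_fst\<close>)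
  then have "continuous_map (prod_topology mtopology mtopology) mtopology ?f"
    by (simp add: comp_def)
  then have "uniformly_continuous_map (prod_metric ?m ?m) ?m ?f"
    using compact by (intro continuous_imp_uniformly_continuous_map)
      (simp add: top m compact_space_prod_topology)
  then have "\<exists>t>0. \<forall>p\<in>mspace (prod_metric ?m ?m). \<forall>q\<in>mspace (prod_metric ?m ?m).
      mdist (prod_metric ?m ?m) q p < t \<longrightarrow> mdist ?m (?f q) (?f p) < e"
    unfolding uniformly_continuous_map_def using assms by blast
  then have "\<exists>t>0. \<forall>p\<in>carrier K \<times> carrier K. \<forall>q\<in>carrier K \<times> carrier K.
      prod_dist d d q p < t \<longrightarrow> d (?f q) (?f p) < e"
    by (simp only: mspace_prod_metric mdist_prod_metric m)
  then obtain t where t: "t > 0" and t': "\<And>p q. \<lbrakk>p \<in> carrier K \<times> carrier K;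
      q \<in> carrier K \<times> carrier K; prod_dist d d q p < t\<rbrakk> \<Longrightarrow> d (?f q) (?f p) < e"
    by blast
  show ?thesis
  proof (intro exI[of _ t] conjI ballI impI t)
    fix w a b assume w: "w \<in> carrier K" "a \<in> carrier K" "b \<in> carrier K" "d a b < t"
    have "prod_dist d d (w, a) (w, b) = \<bar>d a b\<bar>" using w(1) by (simp add: prod_dist_def)
    then show "d (w \<otimes> inv a) (w \<otimes> inv b) < e"
      using t'[of "(w, b)" "(w, a)"] w by simp
  qed
qed

text \<open>The equation x g = y is solved by the inverse of y^{-1} x. Approximating y^{-1} x in a
  finite net and inverting the net points gives finitely many g that move every x close to every
  y.\<close>

lemma translates_of_finite_net:
  assumes "e > 0"
  shows "\<exists>N. N \<noteq> [] \<and> set N \<subseteq> carrier K \<and>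
    (\<forall>x\<in>carrier K. \<forall>y\<in>carrier K. \<exists>g\<in>set N. d (x \<otimes> g) y < e)"
proof -
  obtain t where t: "t > 0"
    "\<forall>w\<in>carrier K. \<forall>a\<in>carrier K. \<forall>b\<in>carrier K. d a b < t \<longrightarrow> d (w \<otimes> inv a) (w \<otimes> inv b) < e"
    using division_uniformly_continuous[OF assms] by (elim exE conjE)
  have "\<exists>F. finite F \<and> F \<subseteq> carrier K \<and> carrier K \<subseteq> (\<Union>x\<in>F. mball x t)"
    using totally_bounded t(1) unfolding mtotally_bounded_def by simp
  then obtain F where F: "finite F" "F \<subseteq> carrier K" "carrier K \<subseteq> (\<Union>x\<in>F. mball x t)"
    by (elim exE conjE)
  obtain xs where xs: "set xs = F" using finite_list[OF F(1)] by blast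
  show ?thesis
  proof (intro exI[of _ "map (\<lambda>g. inv g) xs"] conjI ballI)
    have "F \<noteq> {}" using F(3) one_closed by auto
    then show "map (\<lambda>g. inv g) xs \<noteq> []" using xs by auto
    show "set (map (\<lambda>g. inv g) xs) \<subseteq> carrier K" using F(2) xs by auto
    fix x y assume xy: "x \<in> carrier K" "y \<in> carrier K"
    then have yx: "inv y \<otimes> x \<in> carrier K" by simp
    with F(3) obtain g where g: "g \<in> F" "inv y \<otimes> x \<in> mball g t" by (meson UN_E subsetD)
    have gc: "g \<in> carrier K" using g(1) F(2) by (rule subsetD[rotated])
    have "d g (inv y \<otimes> x) < t" using g(2) by simp
    then have "d (x \<otimes> inv g) (x \<otimes> inv (inv y \<otimes> x)) < e"
      by (rule t(2)[rule_format, OF xy(1) gc yx])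
    moreover have "x \<otimes> inv (inv y \<otimes> x) = x \<otimes> (inv x \<otimes> y)"
      using xy by (simp only: inv_mult_group inv_inv inv_closed)
    moreover have "x \<otimes> (inv x \<otimes> y) = y"
      using xy by (metis inv_closed m_assoc r_inv l_one)
    ultimately have "d (x \<otimes> inv g) y < e" by (simp only:)
    then show "\<exists>g\<in>set (map (\<lambda>g. inv g) xs). d (x \<otimes> g) y < e"
      using g(1) unfolding set_map xs by blast
  qed
qed

text \<open>\<open>C\<close> bounds the oscillation and \<omega> is a common modulus of continuity,
  so a single list can contract all members at once. A general modulus is kept because functions c
  -> F (a c^{-1}), which need not be Lipschitz, have to be averaged as well.\<close>

definition equicontinuous_class :: "real \<Rightarrow> (real \<Rightarrow> real) \<Rightarrow> ('a \<Rightarrow> real) set" where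
  "equicontinuous_class C \<omega> = {F. (\<forall>x\<in>carrier K. \<forall>y\<in>carrier K. \<bar>F x - F y\<bar> \<le> C) \<and>
     (\<forall>e>0. \<forall>x\<in>carrier K. \<forall>y\<in>carrier K. d x y < \<omega> e \<longrightarrow> \<bar>F x - F y\<bar> \<le> e)}"

text \<open>Right translations are isometries, so each x -> F (x g) has the same oscillation bound
  and modulus as \<open>F\<close>; averages inherit both.\<close>

lemma equicontinuous_class_mean:
  assumes F: "F \<in> equicontinuous_class C \<omega>" and N: "N \<noteq> []" "set N \<subseteq> carrier K"
  shows "(\<lambda>x. mean N (\<lambda>g. F (x \<otimes> g))) \<in> equicontinuous_class C \<omega>"
proof -
  have "\<bar>mean N (\<lambda>g. F (x \<otimes> g)) - mean N (\<lambda>g. F (y \<otimes> g))\<bar> \<le> C"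
    if xy: "x \<in> carrier K" "y \<in> carrier K" for x y
  proof (rule mean_abs_le[OF N(1)])
    fix g assume "g \<in> set N"
    then have "x \<otimes> g \<in> carrier K" "y \<otimes> g \<in> carrier K" using N(2) xy by auto
    then show "\<bar>F (x \<otimes> g) - F (y \<otimes> g)\<bar> \<le> C"
      using F unfolding equicontinuous_class_def by blast
  qed
  moreover have "\<bar>mean N (\<lambda>g. F (x \<otimes> g)) - mean N (\<lambda>g. F (y \<otimes> g))\<bar> \<le> e"
    if xy: "x \<in> carrier K" "y \<in> carrier K" and e: "e > 0" "d x y < \<omega> e" for x y e
  proof (rule mean_abs_le[OF N(1)])
    fix g assume "g \<in> set N"
    then have g: "g \<in> carrier K" using N(2) by auto
    then have "x \<otimes> g \<in> carrier K" "y \<otimes> g \<in> carrier K" "d (x \<otimes> g) (y \<otimes> g) < \<omega> e"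
      using xy e(2) by (simp_all add: right_invariant)
    then show "\<bar>F (x \<otimes> g) - F (y \<otimes> g)\<bar> \<le> e"
      using F e(1) unfolding equicontinuous_class_def by blast
  qed
  ultimately show ?thesis unfolding equicontinuous_class_def by blast
qed

text \<open>The two sums may be paired term by term in any order. Some x g with g in
  \<open>N\<close> is close to a chosen point of the second sum, so one pair contributes at most
  \<open>e\<close> and every other pair at most \<open>c + e\<close>. The gain \<open>c\<close> is
  divided by the length of the list, and the additive \<open>e\<close> does not grow.\<close>

lemma mean_contracts:
  assumes F: "F \<in> equicontinuous_class C \<omega>" and e: "e > 0"
    and N: "N \<noteq> []" "set N \<subseteq> carrier K"
      "\<And>x y. x \<in> carrier K \<Longrightarrow> y \<in> carrier K \<Longrightarrow> \<exists>g\<in>set N. d (x \<otimes> g) y < \<omega> e"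
    and osc: "\<And>x y. x \<in> carrier K \<Longrightarrow> y \<in> carrier K \<Longrightarrow> F x - F y \<le> c + e"
    and x: "x \<in> carrier K" and y: "y \<in> carrier K"
  shows "mean N (\<lambda>g. F (x \<otimes> g)) - mean N (\<lambda>g. F (y \<otimes> g)) \<le> (1 - 1 / length N) * c + e"
proof -
  obtain i where i: "i < length N" "N ! i \<in> carrier K"
    using N(1,2) by (metis length_greater_0_conv nth_mem subset_iff)
  let ?q = "y \<otimes> N ! i"
  obtain g where g: "g \<in> set N" "d (x \<otimes> g) ?q < \<omega> e"
    using N(3)[OF x, of ?q] y i by auto
  obtain j where j: "j < length N" "g = N ! j" using g(1) by (metis in_set_conv_nth)
  have gc: "g \<in> carrier K" using g(1) N(2) by auto
  have close: "F (x \<otimes> N ! j) - F ?q \<le> e"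
  proof -
    have "\<bar>F (x \<otimes> g) - F ?q\<bar> \<le> e"
      using F e g gc x y i unfolding equicontinuous_class_def by blast
    then show ?thesis by (simp add: j)
  qed
  have mem: "N ! k \<in> carrier K" if "k < length N" for k using N(2) that by auto
  \<comment> \<open>Swapping the indices i and j pairs the i-th term of the second sum with the j-th
    term of the first, which is the close pair found above.\<close>
  define \<pi> where "\<pi> = Transposition.transpose i j"
  have "bij_betw \<pi> {..<length N} {..<length N}"
    unfolding \<pi>_def using i j by (simp add: bij_betw_transpose_iff)
  then have "(\<Sum>k<length N. F (x \<otimes> N ! k)) = (\<Sum>k<length N. F (x \<otimes> N ! \<pi> k))"
    by (rule sum.reindex_bij_betw[symmetric])
  then have "(\<Sum>k<length N. F (x \<otimes> N ! k)) - (\<Sum>k<length N. F (y \<otimes> N ! k)) =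
      (\<Sum>k<length N. F (x \<otimes> N ! \<pi> k) - F (y \<otimes> N ! k))"
    by (simp add: sum_subtractf)
  also have "\<dots> \<le> (\<Sum>k<length N. if k = i then e else c + e)"
  proof (rule sum_mono)
    fix k assume k: "k \<in> {..<length N}"
    then have "\<pi> k < length N" using i j by (auto simp: \<pi>_def Transposition.transpose_def)
    then have "F (x \<otimes> N ! \<pi> k) - F (y \<otimes> N ! k) \<le> c + e"
      using k x y by (intro osc m_closed mem) auto
    moreover have "\<pi> i = j" by (simp add: \<pi>_def)
    ultimately show "F (x \<otimes> N ! \<pi> k) - F (y \<otimes> N ! k) \<le> (if k = i then e else c + e)"
      using close by simp
  qed
  also have "\<dots> = (\<Sum>k<length N. (c + e) - (if k = i then c else 0))"
    by (rule sum.cong) simp_all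
  also have "\<dots> = (\<Sum>k<length N. c + e) - c"
    using i(1) unfolding sum_subtractf by (subst sum.delta) simp_all
  also have "\<dots> = length N * (c + e) - c" by simp
  finally have "(\<Sum>k<length N. F (x \<otimes> N ! k)) - (\<Sum>k<length N. F (y \<otimes> N ! k))
      \<le> length N * (c + e) - c" .
  then have "((\<Sum>k<length N. F (x \<otimes> N ! k)) - (\<Sum>k<length N. F (y \<otimes> N ! k))) / length N
      \<le> (length N * (c + e) - c) / length N"
    by (rule divide_right_mono) simp
  also have "\<dots> = length N * (c + e) / length N - c / length N"
    by (rule diff_divide_distrib)
  also have "length N * (c + e) / length N = c + e"
    using N(1) by simp
  also have "c + e - c / length N = (1 - 1 / length N) * c + e"
    by (simp add: left_diff_distrib)
  finally show ?thesis
    by (simp add: mean_def diff_divide_distrib)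
qed

text \<open>Convolving repeatedly with one fixed list \<open>N\<close> multiplies the part of the
  oscillation above \<open>e\<close> by q < 1 each time, uniformly over the class, while the
  additive \<open>e\<close> stays the same.\<close>

lemma approximately_left_invariant_mean:
  assumes C: "0 \<le> C" and \<omega>: "\<forall>e>0. \<omega> e > 0" and \<delta>: "\<delta> > 0"
  shows "\<exists>xs. xs \<noteq> [] \<and> set xs \<subseteq> carrier K \<and>
    (\<forall>F\<in>equicontinuous_class C \<omega>. \<forall>x\<in>carrier K. \<forall>y\<in>carrier K.
       \<bar>mean xs (\<lambda>k. F (x \<otimes> k)) - mean xs (\<lambda>k. F (y \<otimes> k))\<bar> \<le> \<delta>)"
proof -
  \<comment> \<open>One half of \<delta> pays for the persistent additive error, the other half for
    the decaying term q^n C.\<close>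
  define e where "e = \<delta> / 2"
  have e: "e > 0" using \<delta> by (simp add: e_def)
  obtain N where N: "N \<noteq> []" "set N \<subseteq> carrier K"
    "\<forall>x\<in>carrier K. \<forall>y\<in>carrier K. \<exists>g\<in>set N. d (x \<otimes> g) y < \<omega> e"
    using translates_of_finite_net[OF \<omega>[rule_format, OF e]] by (elim exE conjE)
  define q where "q = 1 - 1 / real (length N)"
  have q: "0 \<le> q" "q < 1" using N(1) by (auto simp: q_def divide_simps Suc_le_eq)
  have main: "\<exists>xs. xs \<noteq> [] \<and> set xs \<subseteq> carrier K \<and> (\<forall>F\<in>equicontinuous_class C \<omega>. \<forall>x\<in>carrier K. \<forall>y\<in>carrier K.
      mean xs (\<lambda>k. F (x \<otimes> k)) - mean xs (\<lambda>k. F (y \<otimes> k)) \<le> q ^ n * C + e)" for n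
  proof (induction n)
    case 0
    have "F x - F y \<le> C + e"
      if "F \<in> equicontinuous_class C \<omega>" "x \<in> carrier K" "y \<in> carrier K" for F x y
    proof -
      have "\<bar>F x - F y\<bar> \<le> C" using that unfolding equicontinuous_class_def by blast
      then show ?thesis using e by linarith
    qed
    then show ?case by (intro exI[of _ "[\<one>]"]) (simp add: mean_def)
  next
    case (Suc n)
    then obtain xs where xs: "xs \<noteq> []" "set xs \<subseteq> carrier K"
      "\<And>F x y. \<lbrakk>F \<in> equicontinuous_class C \<omega>; x \<in> carrier K; y \<in> carrier K\<rbrakk> \<Longrightarrow>
        mean xs (\<lambda>k. F (x \<otimes> k)) - mean xs (\<lambda>k. F (y \<otimes> k)) \<le> q ^ n * C + e"
      by blast
    \<comment> \<open>The new factor stands between x and the old list, so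
      \<open>mean_contracts\<close> applies to the function x -> mean of F (x k) over the old list,
      which is still in the class.\<close>
    let ?ys = "map (\<lambda>(g, k). g \<otimes> k) (List.product N xs)"
    have eq: "mean ?ys (\<lambda>k. F (x \<otimes> k)) = mean N (\<lambda>g. mean xs (\<lambda>k. F (x \<otimes> g \<otimes> k)))"
      if x: "x \<in> carrier K" for F x
      unfolding mean_map mean_product using N(2) xs(2) x
      by (intro mean_cong) (auto simp: m_assoc subset_iff)
    have "mean ?ys (\<lambda>k. F (x \<otimes> k)) - mean ?ys (\<lambda>k. F (y \<otimes> k)) \<le> q ^ Suc n * C + e"
      if F: "F \<in> equicontinuous_class C \<omega>" and x: "x \<in> carrier K" and y: "y \<in> carrier K" for F x y
      using mean_contracts[OF equicontinuous_class_mean[OF F xs(1,2)] e N(1,2) N(3)[rule_format] xs(3)[OF F] x y]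
      unfolding eq[OF x] eq[OF y] q_def[symmetric] power_Suc mult.assoc .
    moreover have "?ys \<noteq> []" using xs(1) N(1) by (cases N; cases xs) simp_all
    moreover have "set ?ys \<subseteq> carrier K" using xs(2) N(2) by (auto simp: subset_iff)
    ultimately show ?case by blast
  qed
  \<comment> \<open>The divisor \<open>C + 1\<close> is positive even if \<open>C\<close>
    vanishes.\<close>
  obtain n where "q ^ n < e / (C + 1)"
    using real_arch_pow_inv[of "e / (C + 1)" q] q e C by auto
  then have "q ^ n * (C + 1) < e" using C by (simp add: pos_less_divide_eq)
  moreover have "q ^ n * C \<le> q ^ n * (C + 1)" using q by (intro mult_left_mono) auto
  ultimately have n: "q ^ n * C + e \<le> \<delta>" by (simp add: e_def)
  from main[of n] obtain xs where xs: "xs \<noteq> []" "set xs \<subseteq> carrier K"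
      "\<And>F x y. \<lbrakk>F \<in> equicontinuous_class C \<omega>; x \<in> carrier K; y \<in> carrier K\<rbrakk> \<Longrightarrow>
        mean xs (\<lambda>k. F (x \<otimes> k)) - mean xs (\<lambda>k. F (y \<otimes> k)) \<le> q ^ n * C + e"
    by blast
  show ?thesis
  proof (intro exI[of _ xs] conjI ballI xs(1,2))
    fix F x y assume F: "F \<in> equicontinuous_class C \<omega>" and xy: "x \<in> carrier K" "y \<in> carrier K"
    show "\<bar>mean xs (\<lambda>k. F (x \<otimes> k)) - mean xs (\<lambda>k. F (y \<otimes> k))\<bar> \<le> \<delta>"
      using xs(3)[OF F xy] xs(3)[OF F xy(2,1)] n by linarith
  qed
qed

lemma lipschitz1_right_translate:
  assumes "F \<in> lipschitz1 (carrier K) d" "y \<in> carrier K"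
  shows "(\<lambda>x. F (x \<otimes> y)) \<in> lipschitz1 (carrier K) d"
  unfolding lipschitz1_def
proof (intro CollectI ballI)
  fix a b assume ab: "a \<in> carrier K" "b \<in> carrier K"
  then have "\<bar>F (a \<otimes> y) - F (b \<otimes> y)\<bar> \<le> d (a \<otimes> y) (b \<otimes> y)"
    using assms unfolding lipschitz1_def by simp
  then show "\<bar>F (a \<otimes> y) - F (b \<otimes> y)\<bar> \<le> d a b"
    using ab assms(2) by (simp add: right_invariant)
qed

text \<open>Take products a b^{-1} with a and b from two nearly left-invariant lists. A left
  translation acts on a. A right translation by x replaces b by x^{-1} b, hence acts from the left
  on the argument of c -> F (a c^{-1}); these functions share one modulus \<omega> for all F and
  a.\<close>

lemma invariant_mean_carrier_exists:
  assumes \<delta>: "\<delta> > 0"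
  shows "\<exists>xs. invariant_mean K d (carrier K) \<delta> xs"
proof -
  obtain D where D: "0 \<le> D" "\<forall>x\<in>carrier K. \<forall>y\<in>carrier K. d x y \<le> D"
    using diameter_bounded by (elim exE conjE)
  have "\<forall>e. \<exists>t. e > 0 \<longrightarrow> t > 0 \<and> (\<forall>w\<in>carrier K. \<forall>a\<in>carrier K. \<forall>b\<in>carrier K. d a b < t \<longrightarrow>
       d (w \<otimes> inv a) (w \<otimes> inv b) < e)"
    using division_uniformly_continuous by blast
  then obtain \<omega> where \<omega>: "\<forall>e. e > 0 \<longrightarrow> \<omega> e > 0 \<and> (\<forall>w\<in>carrier K. \<forall>a\<in>carrier K. \<forall>b\<in>carrier K.
       d a b < \<omega> e \<longrightarrow> d (w \<otimes> inv a) (w \<otimes> inv b) < e)"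
    by (rule choice[THEN exE])
  have \<omega>1: "\<forall>e>0. \<omega> e > 0" using \<omega> by blast
  have \<omega>2: "d (w \<otimes> inv a) (w \<otimes> inv b) < e"
    if "e > 0" "w \<in> carrier K" "a \<in> carrier K" "b \<in> carrier K" "d a b < \<omega> e" for e w a b
    using \<omega> that by blast
  have 1: "F \<in> equicontinuous_class D (\<lambda>e. e)" if F: "F \<in> lipschitz1 (carrier K) d" for F
    unfolding equicontinuous_class_def
  proof (intro CollectI conjI ballI allI impI)
    fix x y assume xy: "x \<in> carrier K" "y \<in> carrier K"
    show "\<bar>F x - F y\<bar> \<le> D" using lipschitz1D[OF F xy] D(2)[rule_format, OF xy] by linarith
    show "\<bar>F x - F y\<bar> \<le> e" if "d x y < e" for e using lipschitz1D[OF F xy] that by linarith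
  qed
  have 2: "(\<lambda>c. F (a \<otimes> inv c)) \<in> equicontinuous_class D \<omega>"
    if F: "F \<in> lipschitz1 (carrier K) d" and a: "a \<in> carrier K" for F a
    unfolding equicontinuous_class_def
  proof (intro CollectI conjI ballI allI impI)
    fix x y assume xy: "x \<in> carrier K" "y \<in> carrier K"
    then have c: "a \<otimes> inv x \<in> carrier K" "a \<otimes> inv y \<in> carrier K" using a by simp_all
    show "\<bar>F (a \<otimes> inv x) - F (a \<otimes> inv y)\<bar> \<le> D" using lipschitz1D[OF F c] D(2)[rule_format, OF c] by linarith
    show "\<bar>F (a \<otimes> inv x) - F (a \<otimes> inv y)\<bar> \<le> e" if "0 < e" "d x y < \<omega> e" for e
      using lipschitz1D[OF F c] \<omega>2[OF that(1) a xy that(2)] by linarith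
  qed
  have id_pos: "\<forall>e>0. (e :: real) > 0" by simp
  obtain as where as: "as \<noteq> []" "set as \<subseteq> carrier K"
    "\<forall>F\<in>equicontinuous_class D (\<lambda>e. e). \<forall>x\<in>carrier K. \<forall>y\<in>carrier K.
       \<bar>mean as (\<lambda>k. F (x \<otimes> k)) - mean as (\<lambda>k. F (y \<otimes> k))\<bar> \<le> \<delta>"
    using approximately_left_invariant_mean[of D "\<lambda>e. e", OF D(1) id_pos \<delta>] by (elim exE conjE)
  obtain bs where bs: "bs \<noteq> []" "set bs \<subseteq> carrier K"
    "\<forall>F\<in>equicontinuous_class D \<omega>. \<forall>x\<in>carrier K. \<forall>y\<in>carrier K.
       \<bar>mean bs (\<lambda>k. F (x \<otimes> k)) - mean bs (\<lambda>k. F (y \<otimes> k))\<bar> \<le> \<delta>"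
    using approximately_left_invariant_mean[of D \<omega>, OF D(1) \<omega>1 \<delta>] by (elim exE conjE)
  let ?xs = "map (\<lambda>(a, b). a \<otimes> inv b) (List.product as bs)"
  have ac: "a \<in> carrier K" if "a \<in> set as" for a using that as(2) by (rule subsetD[rotated])
  have bc: "b \<in> carrier K" if "b \<in> set bs" for b using that bs(2) by (rule subsetD[rotated])
  have mean1: "mean ?xs F = mean bs (\<lambda>b. mean as (\<lambda>a. F (a \<otimes> inv b)))" for F
    unfolding mean_map mean_product by (subst mean_swap) simp
  have mean2: "mean ?xs F = mean as (\<lambda>a. mean bs (\<lambda>b. F (a \<otimes> inv b)))" for F
    unfolding mean_map mean_product by simp
  show ?thesis
    unfolding invariant_mean_def
  proof (intro exI[of _ ?xs] conjI ballI)
    show "?xs \<noteq> []" using as(1) bs(1) by (cases as; cases bs) simp_all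
    show "set ?xs \<subseteq> carrier K" using ac bc by auto
    fix F assume F: "F \<in> lipschitz1 (carrier K) d"
    fix x assume x: "x \<in> carrier K"
    have "\<bar>mean as (\<lambda>a. F (x \<otimes> (a \<otimes> inv b))) - mean as (\<lambda>a. F (a \<otimes> inv b))\<bar> \<le> \<delta>"
      if b: "b \<in> set bs" for b
    proof -
      have "mean as (\<lambda>a. F (x \<otimes> (a \<otimes> inv b))) = mean as (\<lambda>a. F (x \<otimes> a \<otimes> inv b))"
        using bc[OF b] x by (intro mean_cong) (simp add: ac m_assoc)
      moreover have "mean as (\<lambda>a. F (a \<otimes> inv b)) = mean as (\<lambda>a. F (\<one> \<otimes> a \<otimes> inv b))"
        by (intro mean_cong) (simp add: ac)
      ultimately show ?thesis
        using as(3)[rule_format, OF 1[OF lipschitz1_right_translate[OF F inv_closed[OF bc[OF b]]]] x one_closed]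
        by simp
    qed
    then show "\<bar>mean ?xs (\<lambda>k. F (x \<otimes> k)) - mean ?xs F\<bar> \<le> \<delta>"
      unfolding mean1 by (rule mean_abs_le[OF bs(1)])
    have "\<bar>mean bs (\<lambda>b. F (a \<otimes> inv b \<otimes> x)) - mean bs (\<lambda>b. F (a \<otimes> inv b))\<bar> \<le> \<delta>"
      if a: "a \<in> set as" for a
    proof -
      have "a \<otimes> inv b \<otimes> x = a \<otimes> inv (inv x \<otimes> b)" if "b \<in> set bs" for b
        using bc[OF that] ac[OF a] x by (simp add: inv_mult_group m_assoc)
      then have "mean bs (\<lambda>b. F (a \<otimes> inv b \<otimes> x)) = mean bs (\<lambda>b. F (a \<otimes> inv (inv x \<otimes> b)))"
        by (intro mean_cong) simp
      moreover have "mean bs (\<lambda>b. F (a \<otimes> inv b)) = mean bs (\<lambda>b. F (a \<otimes> inv (\<one> \<otimes> b)))"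
        by (intro mean_cong) (simp add: bc)
      ultimately show ?thesis
        using bs(3)[rule_format, OF 2[OF F ac[OF a]] inv_closed[OF x] one_closed] by simp
    qed
    then show "\<bar>mean ?xs (\<lambda>k. F (k \<otimes> x)) - mean ?xs F\<bar> \<le> \<delta>"
      unfolding mean2 by (rule mean_abs_le[OF as(1)])
  qed
qed

section \<open>The Haar integral of Lipschitz functions as a limit of finite means\<close>

definition haar_net :: "nat \<Rightarrow> 'a list" where
  "haar_net n = (SOME xs. invariant_mean K d (carrier K) (1 / Suc n) xs)"

lemma invariant_mean_haar_net: "invariant_mean K d (carrier K) (1 / Suc n) (haar_net n)"
  unfolding haar_net_def by (rule someI_ex[OF invariant_mean_carrier_exists]) simp

lemmas haar_net = invariant_meanD[OF invariant_mean_haar_net]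

text \<open>This is the uniqueness argument for invariant means: both averages are compared with the
  double average of F (k y), using right-invariance of the list for k and left-invariance of the
  list for y.\<close>

lemma mean_haar_net_close:
  assumes F: "F \<in> lipschitz1 (carrier K) d"
  shows "\<bar>mean (haar_net n) F - mean (haar_net p) F\<bar> \<le> 1 / Suc n + 1 / Suc p"
proof -
  let ?m = "mean (haar_net p) (\<lambda>y. mean (haar_net n) (\<lambda>k. F (k \<otimes> y)))"
  have "\<bar>mean (haar_net p) (\<lambda>y. mean (haar_net n) (\<lambda>k. F (k \<otimes> y))) -
      mean (haar_net p) (\<lambda>_. mean (haar_net n) F)\<bar> \<le> 1 / Suc n"
    by (rule mean_abs_le[OF haar_net(1)]) (rule haar_net(4)[OF F subsetD[OF haar_net(2)]])
  then have "\<bar>?m - mean (haar_net n) F\<bar> \<le> 1 / Suc n"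
    by (simp only: mean_const[OF haar_net(1)])
  moreover have "\<bar>mean (haar_net n) (\<lambda>k. mean (haar_net p) (\<lambda>y. F (k \<otimes> y))) -
      mean (haar_net n) (\<lambda>_. mean (haar_net p) F)\<bar> \<le> 1 / Suc p"
    by (rule mean_abs_le[OF haar_net(1)]) (rule haar_net(3)[OF F subsetD[OF haar_net(2)]])
  then have "\<bar>?m - mean (haar_net p) F\<bar> \<le> 1 / Suc p"
    by (simp only: mean_const[OF haar_net(1)] mean_swap[of "haar_net p" "haar_net n"])
  ultimately show ?thesis by linarith
qed

text \<open>Arbitrary Lipschitz constants, unlike those of \<open>lipschitz1\<close>, give a vector
  space, on which the limit functional can be linear.\<close>

definition lipschitz :: "('a \<Rightarrow> real) set" where
  "lipschitz = {f. \<exists>c\<ge>0. \<forall>x\<in>carrier K. \<forall>y\<in>carrier K. \<bar>f x - f y\<bar> \<le> c * d x y}"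

definition haar_functional :: "('a \<Rightarrow> real) \<Rightarrow> real" where
  "haar_functional F = lim (\<lambda>n. mean (haar_net n) F)"

lemma lipschitz_scaled:
  assumes "F \<in> lipschitz"
  obtains c G where "c > 0" "G \<in> lipschitz1 (carrier K) d" "F = (\<lambda>x. c * G x)"
proof -
  obtain c where c: "c \<ge> 0" "\<And>x y. x \<in> carrier K \<Longrightarrow> y \<in> carrier K \<Longrightarrow> \<bar>F x - F y\<bar> \<le> c * d x y"
    using assms unfolding lipschitz_def by blast
  \<comment> \<open>Dividing by \<open>c + 1\<close> instead of \<open>c\<close> covers constant
    functions, for which \<open>c\<close> may be 0.\<close>
  have 1: "(\<lambda>x. F x / (c + 1)) \<in> lipschitz1 (carrier K) d"
    unfolding lipschitz1_def
  proof (intro CollectI ballI)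
    fix x y assume xy: "x \<in> carrier K" "y \<in> carrier K"
    have "\<bar>F x - F y\<bar> \<le> c * d x y" by (rule c(2)[OF xy])
    also have "\<dots> \<le> (c + 1) * d x y" by (intro mult_right_mono) auto
    finally have "\<bar>F x - F y\<bar> / (c + 1) \<le> d x y"
      using c(1) by (simp add: pos_divide_le_eq mult.commute)
    moreover have "F x / (c + 1) - F y / (c + 1) = (F x - F y) / (c + 1)"
      by (rule diff_divide_distrib[symmetric])
    ultimately show "\<bar>F x / (c + 1) - F y / (c + 1)\<bar> \<le> d x y"
      using c(1) by (simp add: abs_divide)
  qed
  have 2: "c + 1 > 0" using c(1) by simp
  then have 3: "F = (\<lambda>x. (c + 1) * (F x / (c + 1)))" by (intro ext) simp
  show thesis by (rule that[OF 2 1 3])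
qed

lemma mean_haar_net_tendsto:
  assumes "F \<in> lipschitz"
  shows "(\<lambda>n. mean (haar_net n) F) \<longlonglongrightarrow> haar_functional F"
proof -
  obtain c G where c: "c > 0" and G: "G \<in> lipschitz1 (carrier K) d" and F: "F = (\<lambda>x. c * G x)"
    by (rule lipschitz_scaled[OF assms])
  have "Cauchy (\<lambda>n. mean (haar_net n) G)"
  proof (rule metric_CauchyI)
    fix e :: real assume "e > 0"
    then have "e / 2 > 0" by simp
    then obtain N where N: "1 / Suc N < e / 2" by (rule nat_approx_posE)
    show "\<exists>N. \<forall>n\<ge>N. \<forall>p\<ge>N. dist (mean (haar_net n) G) (mean (haar_net p) G) < e"
    proof (intro exI allI impI)
      fix n p assume "N \<le> n" "N \<le> p"
      then have "1 / real (Suc n) \<le> 1 / Suc N" "1 / real (Suc p) \<le> 1 / Suc N"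
        by (simp_all add: frac_le)
      then show "dist (mean (haar_net n) G) (mean (haar_net p) G) < e"
        using mean_haar_net_close[OF G, of n p] N unfolding dist_real_def by linarith
    qed
  qed
  then have "convergent (\<lambda>n. mean (haar_net n) F)"
    unfolding F mean_mult by (rule convergent_mult[OF convergent_const Cauchy_convergent])
  then show ?thesis
    unfolding haar_functional_def by (rule convergent_LIMSEQ_iff[THEN iffD1])
qed

end

section \<open>Existence of the Haar measure\<close>

context Metric_space
begin

text \<open>Inserting \<open>c\<close> into the set truncates the distance to \<open>A\<close> at
  level \<open>c\<close> and yields the value \<open>c\<close> for empty \<open>A\<close>, a case
  that occurs when \<open>A\<close> is the complement of the whole space.\<close>

definition truncated_distance :: "real \<Rightarrow> 'a set \<Rightarrow> 'a \<Rightarrow> real" where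
  "truncated_distance c A x = Inf (insert c (d x ` A))"

lemma truncated_distance_bdd: "bdd_below (insert c (d x ` A))"
  by (rule bdd_belowI[of _ "min c 0"]) (auto simp: min.coboundedI2)

lemma truncated_distance_le: "truncated_distance c A x \<le> c"
  unfolding truncated_distance_def by (rule cInf_lower[OF _ truncated_distance_bdd]) simp

lemma truncated_distance_le_dist: "a \<in> A \<Longrightarrow> truncated_distance c A x \<le> d x a"
  unfolding truncated_distance_def by (rule cInf_lower[OF _ truncated_distance_bdd]) simp

lemma truncated_distance_ge:
  "t \<le> c \<Longrightarrow> (\<And>a. a \<in> A \<Longrightarrow> t \<le> d x a) \<Longrightarrow> t \<le> truncated_distance c A x"
  unfolding truncated_distance_def by (rule cInf_greatest) auto

lemma truncated_distance_nonneg: "0 \<le> c \<Longrightarrow> 0 \<le> truncated_distance c A x"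
  by (rule truncated_distance_ge) auto

lemma truncated_distance_eq_0: "\<lbrakk>0 \<le> c; x \<in> A; x \<in> M\<rbrakk> \<Longrightarrow> truncated_distance c A x = 0"
  using truncated_distance_le_dist[of x A c x] truncated_distance_nonneg[of c A x] by simp

lemma truncated_distance_lipschitz1:
  assumes "A \<subseteq> M"
  shows "truncated_distance c A \<in> lipschitz1 M d"
proof -
  have *: "truncated_distance c A x - d x y \<le> truncated_distance c A y" if xy: "x \<in> M" "y \<in> M" for x y
  proof (rule truncated_distance_ge)
    show "truncated_distance c A x - d x y \<le> c"
      using truncated_distance_le[of c A x] nonneg[of x y] by linarith
    fix a assume a: "a \<in> A"
    then have "a \<in> M" using assms by blast
    then show "truncated_distance c A x - d x y \<le> d y a"
      using truncated_distance_le_dist[OF a, of c x] triangle[OF xy, of a] by linarith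
  qed
  show ?thesis
    unfolding lipschitz1_def
  proof (intro CollectI ballI)
    fix x y assume "x \<in> M" "y \<in> M"
    then show "\<bar>truncated_distance c A x - truncated_distance c A y\<bar> \<le> d x y"
      using *[of x y] *[of y x] commute[of x y] by linarith
  qed
qed

end

section \<open>Linearity, positivity and right-invariance of the Haar functional\<close>

context compact_metric_group
begin

lemma lipschitz1_lipschitz: "F \<in> lipschitz1 (carrier K) d \<Longrightarrow> F \<in> lipschitz"
  unfolding lipschitz1_def lipschitz_def by (intro CollectI exI[of _ 1]) simp

lemma lipschitz_const: "(\<lambda>_. c) \<in> lipschitz"
  unfolding lipschitz_def by (intro CollectI exI[of _ 0]) simp

lemma lipschitz_add:
  assumes "f \<in> lipschitz" "g \<in> lipschitz"
  shows "(\<lambda>x. f x + g x) \<in> lipschitz"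
proof -
  obtain a b where a: "a \<ge> 0" "\<forall>x\<in>carrier K. \<forall>y\<in>carrier K. \<bar>f x - f y\<bar> \<le> a * d x y"
    and b: "b \<ge> 0" "\<forall>x\<in>carrier K. \<forall>y\<in>carrier K. \<bar>g x - g y\<bar> \<le> b * d x y"
    using assms unfolding lipschitz_def mem_Collect_eq by (elim exE conjE)
  have "\<bar>(f x + g x) - (f y + g y)\<bar> \<le> (a + b) * d x y" if "x \<in> carrier K" "y \<in> carrier K" for x y
    using a(2)[rule_format, OF that] b(2)[rule_format, OF that] unfolding distrib_right by linarith
  then show ?thesis
    unfolding lipschitz_def using a(1) b(1) by (intro CollectI exI[of _ "a + b"]) simp
qed

lemma lipschitz_mult:
  assumes "f \<in> lipschitz"
  shows "(\<lambda>x. c * f x) \<in> lipschitz"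
proof -
  obtain a where a: "a \<ge> 0" "\<forall>x\<in>carrier K. \<forall>y\<in>carrier K. \<bar>f x - f y\<bar> \<le> a * d x y"
    using assms unfolding lipschitz_def mem_Collect_eq by (elim exE conjE)
  have "\<bar>c * f x - c * f y\<bar> \<le> (\<bar>c\<bar> * a) * d x y" if "x \<in> carrier K" "y \<in> carrier K" for x y
    using mult_left_mono[OF a(2)[rule_format, OF that], of "\<bar>c\<bar>"]
    by (simp add: abs_mult[symmetric] right_diff_distrib mult.assoc)
  then show ?thesis
    unfolding lipschitz_def using a(1) by (intro CollectI exI[of _ "\<bar>c\<bar> * a"]) simp
qed

lemma lipschitz_max:
  assumes "f \<in> lipschitz"
  shows "(\<lambda>x. max 0 (f x - e)) \<in> lipschitz"
proof -
  obtain a where a: "a \<ge> 0" "\<forall>x\<in>carrier K. \<forall>y\<in>carrier K. \<bar>f x - f y\<bar> \<le> a * d x y"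
    using assms unfolding lipschitz_def mem_Collect_eq by (elim exE conjE)
  have "\<bar>max 0 (f x - e) - max 0 (f y - e)\<bar> \<le> a * d x y" if "x \<in> carrier K" "y \<in> carrier K" for x y
  proof -
    have "\<bar>max 0 (f x - e) - max 0 (f y - e)\<bar> \<le> \<bar>f x - f y\<bar>" by (simp add: max_def abs_if)
    then show ?thesis using a(2)[rule_format, OF that] by linarith
  qed
  then show ?thesis
    unfolding lipschitz_def using a(1) by (intro CollectI exI[of _ a]) simp
qed

lemma lipschitz_sum:
  assumes "finite I" "\<And>i. i \<in> I \<Longrightarrow> f i \<in> lipschitz"
  shows "(\<lambda>x. \<Sum>i\<in>I. f i x) \<in> lipschitz"
  using assms by (induction I) (auto intro: lipschitz_const lipschitz_add)

lemma lipschitz_right_translate: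
  assumes "f \<in> lipschitz" "g \<in> carrier K"
  shows "(\<lambda>x. f (x \<otimes> g)) \<in> lipschitz"
proof -
  obtain a where a: "a \<ge> 0" "\<forall>x\<in>carrier K. \<forall>y\<in>carrier K. \<bar>f x - f y\<bar> \<le> a * d x y"
    using assms(1) unfolding lipschitz_def mem_Collect_eq by (elim exE conjE)
  have "\<bar>f (x \<otimes> g) - f (y \<otimes> g)\<bar> \<le> a * d x y" if "x \<in> carrier K" "y \<in> carrier K" for x y
    using a(2)[rule_format, of "x \<otimes> g" "y \<otimes> g"] that assms(2) by (simp add: right_invariant)
  then show ?thesis
    unfolding lipschitz_def using a(1) by (intro CollectI exI[of _ a]) simp
qed

lemma haar_functional_const: "haar_functional (\<lambda>_. c) = c"
  using LIMSEQ_unique[OF mean_haar_net_tendsto[OF lipschitz_const[of c]]] by (simp add: haar_net(1))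

lemma haar_functional_add:
  assumes "f \<in> lipschitz" "g \<in> lipschitz"
  shows "haar_functional (\<lambda>x. f x + g x) = haar_functional f + haar_functional g"
proof (rule LIMSEQ_unique[OF mean_haar_net_tendsto[OF lipschitz_add[OF assms]]])
  show "(\<lambda>n. mean (haar_net n) (\<lambda>x. f x + g x)) \<longlonglongrightarrow> haar_functional f + haar_functional g"
    unfolding mean_add by (intro tendsto_add mean_haar_net_tendsto assms)
qed

lemma haar_functional_sum:
  assumes "finite I" "\<And>i. i \<in> I \<Longrightarrow> f i \<in> lipschitz"
  shows "haar_functional (\<lambda>x. \<Sum>i\<in>I. f i x) = (\<Sum>i\<in>I. haar_functional (f i))"
  using assms by (induction I) (simp_all add: haar_functional_const haar_functional_add lipschitz_sum)

lemma haar_functional_mono: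
  assumes "f \<in> lipschitz" "g \<in> lipschitz" "\<And>x. x \<in> carrier K \<Longrightarrow> f x \<le> g x"
  shows "haar_functional f \<le> haar_functional g"
proof (rule LIMSEQ_le[OF mean_haar_net_tendsto[OF assms(1)] mean_haar_net_tendsto[OF assms(2)]])
  show "\<exists>N. \<forall>n\<ge>N. mean (haar_net n) f \<le> mean (haar_net n) g"
    by (intro exI allI impI mean_mono assms(3) subsetD[OF haar_net(2)])
qed

text \<open>The right-hand side is singled out because right translations preserve Lipschitz
  functions; a left translate of a Lipschitz function need not be Lipschitz for a right-invariant
  metric.\<close>

lemma haar_functional_right_translate:
  assumes f: "f \<in> lipschitz" and y: "y \<in> carrier K"
  shows "haar_functional (\<lambda>x. f (x \<otimes> y)) = haar_functional f"
proof -
  obtain c G where c: "c > 0" and G: "G \<in> lipschitz1 (carrier K) d" and F: "f = (\<lambda>x. c * G x)"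
    by (rule lipschitz_scaled[OF f])
  have "(\<lambda>n. mean (haar_net n) (\<lambda>k. f (k \<otimes> y)) - mean (haar_net n) f) \<longlonglongrightarrow> 0"
  proof (rule Lim_null_comparison[OF always_eventually])
    show "(\<lambda>n. c * (1 / Suc n)) \<longlonglongrightarrow> 0"
      using tendsto_mult_right_zero[OF LIMSEQ_Suc[OF lim_1_over_n]] .
    show "\<forall>n. norm (mean (haar_net n) (\<lambda>k. f (k \<otimes> y)) - mean (haar_net n) f) \<le> c * (1 / Suc n)"
    proof
      fix n
      have "\<bar>mean (haar_net n) (\<lambda>k. G (k \<otimes> y)) - mean (haar_net n) G\<bar> \<le> 1 / Suc n"
        by (rule haar_net(4)[OF G y])
      from mult_left_mono[OF this, of c] c
      show "norm (mean (haar_net n) (\<lambda>k. f (k \<otimes> y)) - mean (haar_net n) f) \<le> c * (1 / Suc n)"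
        unfolding F mean_mult real_norm_def right_diff_distrib[symmetric] abs_mult by simp
    qed
  qed
  moreover have "(\<lambda>n. mean (haar_net n) (\<lambda>k. f (k \<otimes> y)) - mean (haar_net n) f)
      \<longlonglongrightarrow> haar_functional (\<lambda>x. f (x \<otimes> y)) - haar_functional f"
    by (intro tendsto_diff mean_haar_net_tendsto f lipschitz_right_translate y)
  ultimately show ?thesis using LIMSEQ_unique by fastforce
qed

section \<open>The Riesz construction of an outer measure\<close>

definition subordinate :: "'a set \<Rightarrow> ('a \<Rightarrow> real) set" where
  "subordinate U = {f \<in> lipschitz. (\<forall>x\<in>carrier K. 0 \<le> f x \<and> f x \<le> 1) \<and> (\<forall>x\<in>carrier K - U. f x = 0)}"

text \<open>The measure of an open set in the Riesz representation theorem. The test functions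
  merely vanish off \<open>U\<close>; compactness enters below through their superlevel sets at
  positive heights.\<close>

definition haar_content :: "'a set \<Rightarrow> ennreal" where
  "haar_content U = (SUP f\<in>subordinate U. ennreal (haar_functional f))"

definition haar_outer :: "'a set \<Rightarrow> ennreal" where
  "haar_outer A = (INF U\<in>{U. openin mtopology U \<and> A \<subseteq> U}. haar_content U)"

lemma haar_content_upper: "f \<in> subordinate U \<Longrightarrow> ennreal (haar_functional f) \<le> haar_content U"
  unfolding haar_content_def by (rule SUP_upper)

lemma subordinate_mono: "U \<subseteq> V \<Longrightarrow> subordinate U \<subseteq> subordinate V"
  unfolding subordinate_def by blast

lemma haar_content_mono: "U \<subseteq> V \<Longrightarrow> haar_content U \<le> haar_content V"
  unfolding haar_content_def by (rule SUP_subset_mono[OF subordinate_mono]) simp_all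

text \<open>The suprema over \<open>subordinate U\<close> are thus over nonempty sets, so that a
  constant summand can be moved inside them.\<close>

lemma zero_subordinate: "(\<lambda>_. 0) \<in> subordinate U"
  unfolding subordinate_def by (simp add: lipschitz_const)

lemma haar_content_empty: "haar_content {} = 0"
proof -
  have "ennreal (haar_functional f) \<le> 0" if "f \<in> subordinate {}" for f
  proof -
    have "haar_functional f \<le> haar_functional (\<lambda>_. 0)"
      using that by (intro haar_functional_mono) (auto simp: subordinate_def lipschitz_const)
    then show ?thesis by (simp add: haar_functional_const ennreal_neg)
  qed
  then have "haar_content {} \<le> 0" unfolding haar_content_def by (rule SUP_least)
  then show ?thesis by simp
qed

lemma haar_content_carrier: "haar_content (carrier K) = 1"
proof (rule antisym)
  show "haar_content (carrier K) \<le> 1"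
    unfolding haar_content_def
  proof (rule SUP_least)
    fix f assume "f \<in> subordinate (carrier K)"
    then have "haar_functional f \<le> haar_functional (\<lambda>_. 1)"
      by (intro haar_functional_mono) (auto simp: subordinate_def lipschitz_const)
    then show "ennreal (haar_functional f) \<le> 1" by (simp add: haar_functional_const)
  qed
  have "(\<lambda>_. 1) \<in> subordinate (carrier K)" by (simp add: subordinate_def lipschitz_const)
  from haar_content_upper[OF this] show "1 \<le> haar_content (carrier K)"
    by (simp add: haar_functional_const)
qed

text \<open>In a compact group these closed sets are compact. They supply the compact sets that the
  finite subcovers below require.\<close>

lemma lipschitz_superlevel_closed:
  assumes "f \<in> lipschitz"
  shows "closedin mtopology {x \<in> carrier K. e \<le> f x}"
proof -
  obtain a where a: "a \<ge> 0" "\<forall>x\<in>carrier K. \<forall>y\<in>carrier K. \<bar>f x - f y\<bar> \<le> a * d x y"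
    using assms unfolding lipschitz_def mem_Collect_eq by (elim exE conjE)
  have "openin mtopology {x \<in> carrier K. f x < e}"
    unfolding openin_mtopology
  proof (intro conjI allI impI)
    fix x assume x: "x \<in> {x \<in> carrier K. f x < e}"
    define r where "r = (e - f x) / (a + 1)"
    have r: "r > 0" "a * r < e - f x"
    proof -
      show "r > 0" unfolding r_def using x a(1) by simp
      have "(a + 1) * r = e - f x" unfolding r_def using a(1) by simp
      then show "a * r < e - f x" using \<open>r > 0\<close> by (simp add: distrib_right)
    qed
    have "mball x r \<subseteq> {x \<in> carrier K. f x < e}"
    proof
      fix y assume y: "y \<in> mball x r"
      then have "a * d x y \<le> a * r" using a(1) by (intro mult_left_mono) auto
      moreover have "\<bar>f x - f y\<bar> \<le> a * d x y" using a(2) x y by auto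
      ultimately have "f y < e" using r(2) by linarith
      then show "y \<in> {x \<in> carrier K. f x < e}" using y by simp
    qed
    with r(1) show "\<exists>r>0. mball x r \<subseteq> {x \<in> carrier K. f x < e}" by blast
  qed auto
  moreover have "carrier K - {x \<in> carrier K. e \<le> f x} = {x \<in> carrier K. f x < e}" by auto
  ultimately show ?thesis unfolding closedin_def by simp
qed

text \<open>Up to an error \<open>e\<close> only the compact set where f is at least
  \<open>e\<close> matters. Finitely many \<open>U k\<close> cover it, and f is dominated there by a
  sum of functions subordinate to these sets.\<close>

lemma haar_content_countably_subadditive:
  fixes U :: "nat \<Rightarrow> 'a set"
  assumes U: "\<And>k. openin mtopology (U k)"
  shows "haar_content (\<Union>k. U k) \<le> (\<Sum>k. haar_content (U k))"
  unfolding haar_content_def[of "\<Union>k. U k"]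
proof (rule SUP_least)
  fix f assume f: "f \<in> subordinate (\<Union>k. U k)"
  then have fl: "f \<in> lipschitz" and f01: "\<And>x. x \<in> carrier K \<Longrightarrow> 0 \<le> f x" "\<And>x. x \<in> carrier K \<Longrightarrow> f x \<le> 1"
    and f0: "\<And>x. x \<in> carrier K \<Longrightarrow> x \<notin> (\<Union>k. U k) \<Longrightarrow> f x = 0"
    unfolding subordinate_def by blast+
  show "ennreal (haar_functional f) \<le> (\<Sum>k. haar_content (U k))"
  proof (rule ennreal_le_epsilon)
    fix e :: real assume e: "0 < e"
    define C where "C = {x \<in> carrier K. e \<le> f x}"
    have C: "compactin mtopology C"
      unfolding C_def using compact lipschitz_superlevel_closed[OF fl] closedin_compact_space by blast
    have "C \<subseteq> \<Union>(range U)" using f0 e by (force simp: C_def)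
    then obtain \<F> where \<F>: "finite \<F>" "\<F> \<subseteq> range U" "C \<subseteq> \<Union>\<F>"
      using compactinD[OF C, of "range U"] U by blast
    obtain I where I: "finite I" "\<F> = U ` I"
      using finite_subset_image[OF \<F>(1,2)] by blast
    obtain l where l: "l > 0" "\<forall>x\<in>C. \<exists>V\<in>\<F>. mball x l \<subseteq> V"
      using lebesgue_number[OF C \<F>(3)] I(2) U by blast
    \<comment> \<open>With the Lebesgue number \<open>l\<close> of the finite cover, \<phi> k is 1
      at each point whose \<open>l\<close>-ball lies in \<open>U k\<close>. Every point of
      \<open>C\<close> is of this kind for some k in \<open>I\<close>, so the sum is at least 1,
      hence at least f, on \<open>C\<close>.\<close>
    define \<phi> where "\<phi> k x = (1 / l) * truncated_distance l (carrier K - U k) x" for k x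
    have \<phi>_lip: "\<phi> k \<in> lipschitz" for k
      unfolding \<phi>_def by (intro lipschitz_mult lipschitz1_lipschitz truncated_distance_lipschitz1) auto
    have \<phi>0: "0 \<le> \<phi> k x" for k x
      unfolding \<phi>_def using l(1) truncated_distance_nonneg[of l "carrier K - U k" x] by simp
    have \<phi>_sub: "\<phi> k \<in> subordinate (U k)" for k
      unfolding subordinate_def
    proof (intro CollectI conjI ballI \<phi>_lip \<phi>0)
      show "\<phi> k x \<le> 1" for x
        unfolding \<phi>_def using l(1) truncated_distance_le[of l "carrier K - U k" x] by simp
      show "\<phi> k x = 0" if "x \<in> carrier K - U k" for x
        unfolding \<phi>_def using l(1) that truncated_distance_eq_0[of l x "carrier K - U k"] by simp
    qed
    have le: "max 0 (f x - e) \<le> (\<Sum>k\<in>I. \<phi> k x)" if x: "x \<in> carrier K" for x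
    proof (cases "x \<in> C")
      case True
      then obtain k where k: "k \<in> I" "mball x l \<subseteq> U k" using l(2) I(2) by blast
      have "l \<le> truncated_distance l (carrier K - U k) x"
      proof (rule truncated_distance_ge)
        fix a assume "a \<in> carrier K - U k"
        then have "a \<notin> mball x l" "a \<in> carrier K" using k(2) by auto
        then show "l \<le> d x a" using x by simp
      qed simp
      then have "1 \<le> \<phi> k x" unfolding \<phi>_def using l(1) by simp
      also have "\<dots> \<le> (\<Sum>k\<in>I. \<phi> k x)" using k(1) I(1) \<phi>0 by (intro member_le_sum) auto
      finally show ?thesis using f01(2)[OF x] e by simp
    next
      case False
      then have "f x < e" using x by (simp add: C_def)
      moreover have "0 \<le> (\<Sum>k\<in>I. \<phi> k x)" by (intro sum_nonneg \<phi>0)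
      ultimately show ?thesis by simp
    qed
    have sum_lip: "(\<lambda>x. \<Sum>k\<in>I. \<phi> k x) \<in> lipschitz" by (intro lipschitz_sum I(1) \<phi>_lip)
    have I0: "0 \<le> haar_functional (\<phi> k)" for k
      using haar_functional_mono[OF lipschitz_const[of 0] \<phi>_lip[of k]] \<phi>0 by (simp add: haar_functional_const)
    have "haar_functional f \<le> haar_functional (\<lambda>x. (\<Sum>k\<in>I. \<phi> k x) + e)"
    proof (rule haar_functional_mono[OF fl lipschitz_add[OF sum_lip lipschitz_const]])
      show "f x \<le> (\<Sum>k\<in>I. \<phi> k x) + e" if "x \<in> carrier K" for x
        using le[OF that] by linarith
    qed
    also have "\<dots> = (\<Sum>k\<in>I. haar_functional (\<phi> k)) + e"
      by (simp add: haar_functional_add[OF sum_lip lipschitz_const] haar_functional_const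
          haar_functional_sum I(1) \<phi>_lip)
    finally have "ennreal (haar_functional f) \<le> ennreal ((\<Sum>k\<in>I. haar_functional (\<phi> k)) + e)"
      by (rule ennreal_leI)
    also have "\<dots> = (\<Sum>k\<in>I. ennreal (haar_functional (\<phi> k))) + ennreal e"
      using e I0 by (simp add: sum_nonneg sum_ennreal)
    also have "\<dots> \<le> (\<Sum>k\<in>I. haar_content (U k)) + ennreal e"
      by (intro add_right_mono sum_mono haar_content_upper \<phi>_sub)
    also have "\<dots> \<le> (\<Sum>k. haar_content (U k)) + ennreal e"
      by (intro add_right_mono sum_le_suminf I(1)) auto
    finally show "ennreal (haar_functional f) \<le> (\<Sum>k. haar_content (U k)) + ennreal e" .
  qed
qed

lemma haar_outer_le: "openin mtopology U \<Longrightarrow> A \<subseteq> U \<Longrightarrow> haar_outer A \<le> haar_content U"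
  unfolding haar_outer_def by (rule INF_lower) simp

lemma haar_outer_open: "openin mtopology U \<Longrightarrow> haar_outer U = haar_content U"
  by (rule antisym[OF haar_outer_le]) (auto simp: haar_outer_def intro!: INF_greatest haar_content_mono)

lemma haar_outer_mono: "A \<subseteq> B \<Longrightarrow> haar_outer A \<le> haar_outer B"
  unfolding haar_outer_def by (rule INF_superset_mono) auto

lemma haar_outer_measure_space: "outer_measure_space (Pow (carrier K)) haar_outer"
  unfolding outer_measure_space_def
proof (intro conjI)
  show "positive (Pow (carrier K)) haar_outer"
    using haar_outer_open[of "{}"] by (simp add: positive_def haar_content_empty)
  show "increasing (Pow (carrier K)) haar_outer"
    unfolding increasing_def by (intro ballI impI haar_outer_mono)
  show "countably_subadditive (Pow (carrier K)) haar_outer"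
    unfolding countably_subadditive_def
  proof (intro allI impI)
    fix A :: "nat \<Rightarrow> 'a set" assume A: "range A \<subseteq> Pow (carrier K)"
    show "haar_outer (\<Union>i. A i) \<le> (\<Sum>i. haar_outer (A i))"
    proof (rule ennreal_le_epsilon)
      fix e :: real assume e: "0 < e" and fin: "(\<Sum>i. haar_outer (A i)) < top_class.top"
      have "\<exists>U. openin mtopology U \<and> A i \<subseteq> U \<and> haar_content U \<le> haar_outer (A i) + ennreal (e * (1 / 2) ^ Suc i)" for i
      proof -
        have "haar_outer (A i) \<noteq> top_class.top"
          using ennreal_suminf_lessD[OF fin, of i] by simp
        then have "haar_outer (A i) < haar_outer (A i) + ennreal (e * (1 / 2) ^ Suc i)"
          using e by (simp add: less_top)
        then obtain U where "openin mtopology U" "A i \<subseteq> U"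
            "haar_content U < haar_outer (A i) + ennreal (e * (1 / 2) ^ Suc i)"
          unfolding haar_outer_def[of "A i"] by (auto simp: INF_less_iff)
        then show ?thesis using less_imp_le by blast
      qed
      then have "\<exists>U. \<forall>i. openin mtopology (U i) \<and> A i \<subseteq> U i \<and>
          haar_content (U i) \<le> haar_outer (A i) + ennreal (e * (1 / 2) ^ Suc i)"
        by (intro choice allI)
      then obtain U where U: "\<forall>i. openin mtopology (U i) \<and> A i \<subseteq> U i \<and>
          haar_content (U i) \<le> haar_outer (A i) + ennreal (e * (1 / 2) ^ Suc i)" ..
      have "haar_outer (\<Union>i. A i) \<le> haar_content (\<Union>i. U i)"
        using U by (intro haar_outer_le) blast+
      also have "\<dots> \<le> (\<Sum>i. haar_content (U i))"
        using U by (intro haar_content_countably_subadditive) blast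
      also have "\<dots> \<le> (\<Sum>i. haar_outer (A i) + ennreal (e * (1 / 2) ^ Suc i))"
        using U by (intro suminf_le) auto
      also have "\<dots> = (\<Sum>i. haar_outer (A i)) + (\<Sum>i. ennreal (e * (1 / 2) ^ Suc i))"
        by (intro suminf_add[symmetric]) auto
      also have "(\<Sum>i. ennreal (e * (1 / 2) ^ Suc i)) = ennreal e"
        using e sums_mult[OF power_half_series, of e] by (intro suminf_ennreal_eq) simp_all
      finally show "haar_outer (\<Union>i. A i) \<le> (\<Sum>i. haar_outer (A i)) + ennreal e" .
    qed
  qed
qed

text \<open>A test function for \<open>W \<inter> V\<close> is cut down so that it lives on a closed
  set \<open>C\<close> inside \<open>W \<inter> V\<close>. The open set \<open>W - C\<close>
  contains \<open>W - V\<close>, and a test function g for it vanishes on \<open>C\<close>, so the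
  two can be added without exceeding 1.\<close>

lemma haar_content_split:
  assumes V: "openin mtopology V" and W: "openin mtopology W"
  shows "haar_outer (W \<inter> V) + haar_outer (W - V) \<le> haar_content W"
proof (rule ennreal_le_epsilon)
  fix e :: real assume e: "0 < e" and fin: "haar_content W < top_class.top"
  have WV: "openin mtopology (W \<inter> V)" using V W by (rule openin_Int[rotated])
  have le: "haar_content (W \<inter> V) + haar_outer (W - V) \<le> haar_content W + ennreal e"
  proof -
    have "ennreal (haar_functional f) + haar_outer (W - V) \<le> haar_content W + ennreal e"
      if f: "f \<in> subordinate (W \<inter> V)" for f
    proof -
      have fl: "f \<in> lipschitz" using f by (simp add: subordinate_def)
      define C where "C = {x \<in> carrier K. e \<le> f x}"
      \<comment> \<open>Lowering f by \<open>e\<close> makes it vanish off \<open>C\<close>; the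
        functional changes by at most \<open>e\<close>, which is the error allowed in the
        claim.\<close>
      define f' where "f' x = max 0 (f x - e)" for x
      have f'l: "f' \<in> lipschitz" unfolding f'_def by (rule lipschitz_max[OF fl])
      have C: "openin mtopology (W - C)"
        using W lipschitz_superlevel_closed[OF fl] unfolding C_def by (rule openin_diff)
      have "C \<subseteq> W \<inter> V" using f e by (force simp: C_def subordinate_def)
      then have "W - V \<subseteq> W - C" by blast
      then have "haar_outer (W - V) \<le> haar_content (W - C)" by (rule haar_outer_le[OF C])
      also have "ennreal (haar_functional f') + haar_content (W - C) \<le> haar_content W"
      proof -
        have "ennreal (haar_functional f') + ennreal (haar_functional g) \<le> haar_content W"
          if g: "g \<in> subordinate (W - C)" for g
        proof -
          have gl: "g \<in> lipschitz" using g by (simp add: subordinate_def)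
          have "(\<lambda>x. f' x + g x) \<in> subordinate W"
            unfolding subordinate_def
          proof (intro CollectI conjI ballI lipschitz_add f'l gl)
            fix x assume x: "x \<in> carrier K"
            show "0 \<le> f' x + g x" using g x by (auto simp: f'_def subordinate_def)
            show "f' x + g x \<le> 1"
            proof (cases "x \<in> C")
              case True
              then have "g x = 0" using g x by (auto simp: subordinate_def)
              moreover have "f x \<le> 1" using f x by (auto simp: subordinate_def)
              ultimately show ?thesis using e by (simp add: f'_def)
            next
              case False
              then have "f' x = 0" using x by (simp add: C_def f'_def)
              then show ?thesis using g x by (auto simp: subordinate_def)
            qed
          next
            fix x assume x: "x \<in> carrier K - W"
            then have "f x = 0" "g x = 0" using f g by (auto simp: subordinate_def)
            then show "f' x + g x = 0" using e by (simp add: f'_def)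
          qed
          from haar_content_upper[OF this]
          have "ennreal (haar_functional f' + haar_functional g) \<le> haar_content W"
            by (simp add: haar_functional_add[OF f'l gl])
          moreover have "0 \<le> haar_functional f'" "0 \<le> haar_functional g"
            using haar_functional_mono[OF lipschitz_const[of 0] f'l]
              haar_functional_mono[OF lipschitz_const[of 0] gl] g
            by (auto simp: haar_functional_const f'_def subordinate_def)
          ultimately show ?thesis by simp
        qed
        then have "(SUP g\<in>subordinate (W - C). ennreal (haar_functional f') + ennreal (haar_functional g))
            \<le> haar_content W"
          by (rule SUP_least)
        then show ?thesis
          unfolding haar_content_def[of "W - C"]
          using zero_subordinate[of "W - C"] by (subst ennreal_SUP_add_right) auto
      qed
      finally have *: "ennreal (haar_functional f') + haar_outer (W - V) \<le> haar_content W"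
        by (simp add: add_left_mono)
      have "haar_functional f \<le> haar_functional (\<lambda>x. f' x + e)"
        by (rule haar_functional_mono[OF fl lipschitz_add[OF f'l lipschitz_const]]) (simp add: f'_def)
      also have "\<dots> = haar_functional f' + e"
        by (simp add: haar_functional_add[OF f'l lipschitz_const] haar_functional_const)
      finally have "ennreal (haar_functional f) \<le> ennreal (haar_functional f' + e)" by (rule ennreal_leI)
      also have "\<dots> \<le> ennreal (haar_functional f') + ennreal e" using e by (simp add: ennreal_plus_if)
      finally have "ennreal (haar_functional f) + haar_outer (W - V)
          \<le> ennreal (haar_functional f') + ennreal e + haar_outer (W - V)" by (rule add_right_mono)
      also have "\<dots> = ennreal (haar_functional f') + haar_outer (W - V) + ennreal e" by (simp add: ac_simps)
      also have "\<dots> \<le> haar_content W + ennreal e" by (rule add_right_mono[OF *])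
      finally show ?thesis .
    qed
    then have "(SUP f\<in>subordinate (W \<inter> V). ennreal (haar_functional f) + haar_outer (W - V))
        \<le> haar_content W + ennreal e" by (rule SUP_least)
    then show ?thesis
      unfolding haar_content_def[of "W \<inter> V"]
      using zero_subordinate[of "W \<inter> V"] by (subst ennreal_SUP_add_left[symmetric]) auto
  qed
  then show "haar_outer (W \<inter> V) + haar_outer (W - V) \<le> haar_content W + ennreal e"
    unfolding haar_outer_open[OF WV] .
qed

text \<open>This is Caratheodory measurability of open sets. The outer measure is an infimum over
  open supersets, so an arbitrary test set \<open>A\<close> reduces to the open sets
  \<open>W\<close> of \<open>haar_content_split\<close>.\<close>

lemma openin_lambda_system:
  assumes V: "openin mtopology V"
  shows "V \<in> lambda_system (carrier K) (Pow (carrier K)) haar_outer"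
proof -
  interpret P: sigma_algebra "carrier K" "Pow (carrier K)" by (rule sigma_algebra_Pow)
  have sub: "subadditive (Pow (carrier K)) haar_outer"
    using haar_outer_measure_space unfolding outer_measure_space_def
    by (intro P.countably_subadditive_subadditive) auto
  have "haar_outer (A \<inter> V) + haar_outer (A - V) = haar_outer A" if A: "A \<subseteq> carrier K" for A
  proof (rule antisym)
    show "haar_outer (A \<inter> V) + haar_outer (A - V) \<le> haar_outer A"
      unfolding haar_outer_def[of A]
    proof (rule INF_greatest)
      fix W assume "W \<in> {U. openin mtopology U \<and> A \<subseteq> U}"
      then have W: "openin mtopology W" "A \<subseteq> W" by simp_all
      have "haar_outer (A \<inter> V) + haar_outer (A - V) \<le> haar_outer (W \<inter> V) + haar_outer (W - V)"
        using W(2) by (intro add_mono haar_outer_mono) auto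
      also have "\<dots> \<le> haar_content W" by (rule haar_content_split[OF V W(1)])
      finally show "haar_outer (A \<inter> V) + haar_outer (A - V) \<le> haar_content W" .
    qed
    have "haar_outer ((A \<inter> V) \<union> (A - V)) \<le> haar_outer (A \<inter> V) + haar_outer (A - V)"
      using A by (intro subadditiveD[OF sub]) auto
    then show "haar_outer A \<le> haar_outer (A \<inter> V) + haar_outer (A - V)"
      by (simp add: Int_Diff_Un)
  qed
  then show ?thesis
    using openin_subset[OF V] by (simp add: P.lambda_system_eq)
qed

section \<open>Translations and the Haar probability measure\<close>

lemma continuous_map_right_translation:
  assumes "g \<in> carrier K"
  shows "continuous_map mtopology mtopology (\<lambda>x. x \<otimes> g)"
proof -
  have "continuous_map mtopology mtopology ((\<lambda>(x, y). x \<otimes> y) \<circ> (\<lambda>x. (x, g)))"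
    by (rule continuous_map_compose[OF _ continuous_mult])
      (use assms in \<open>simp add: continuous_map_pairwise comp_def\<close>)
  then show ?thesis by (simp add: comp_def)
qed

lemma continuous_map_left_translation:
  assumes "g \<in> carrier K"
  shows "continuous_map mtopology mtopology (\<lambda>x. g \<otimes> x)"
proof -
  have "continuous_map mtopology mtopology ((\<lambda>(x, y). x \<otimes> y) \<circ> (\<lambda>x. (g, x)))"
    by (rule continuous_map_compose[OF _ continuous_mult])
      (use assms in \<open>simp add: continuous_map_pairwise comp_def\<close>)
  then show ?thesis by (simp add: comp_def)
qed

lemma openin_right_translate:
  "openin mtopology U \<Longrightarrow> g \<in> carrier K \<Longrightarrow> openin mtopology {x \<in> carrier K. x \<otimes> g \<in> U}"
  using openin_continuous_map_preimage[OF continuous_map_right_translation, of g U] by simp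

text \<open>Translating by g and then by its inverse restores the set, which turns each one-sided
  estimate below into an equality.\<close>

lemma right_translate_inverse:
  assumes "g \<in> carrier K" "B \<subseteq> carrier K"
  shows "{x \<in> carrier K. x \<otimes> inv g \<in> {x \<in> carrier K. x \<otimes> g \<in> B}} = B"
proof -
  have "x \<otimes> inv g \<otimes> g = x" if "x \<in> carrier K" for x
    using that assms(1) by (simp add: m_assoc)
  then show ?thesis using assms by auto
qed

lemma haar_content_right_translate_le:
  assumes g: "g \<in> carrier K"
  shows "haar_content U \<le> haar_content {x \<in> carrier K. x \<otimes> g \<in> U}"
  unfolding haar_content_def[of U]
proof (rule SUP_least)
  fix f assume f: "f \<in> subordinate U"
  then have fl: "f \<in> lipschitz" by (simp add: subordinate_def)
  have "(\<lambda>x. f (x \<otimes> g)) \<in> subordinate {x \<in> carrier K. x \<otimes> g \<in> U}"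
    using f g lipschitz_right_translate[OF fl g] by (auto simp: subordinate_def)
  from haar_content_upper[OF this]
  show "ennreal (haar_functional f) \<le> haar_content {x \<in> carrier K. x \<otimes> g \<in> U}"
    by (simp add: haar_functional_right_translate[OF fl g])
qed

lemma haar_content_right_translate:
  assumes g: "g \<in> carrier K" and U: "U \<subseteq> carrier K"
  shows "haar_content {x \<in> carrier K. x \<otimes> g \<in> U} = haar_content U"
  using haar_content_right_translate_le[OF inv_closed[OF g], of "{x \<in> carrier K. x \<otimes> g \<in> U}"]
    haar_content_right_translate_le[OF g, of U]
  unfolding right_translate_inverse[OF g U] by (rule antisym)

lemma haar_outer_right_translate_le:
  assumes g: "g \<in> carrier K"
  shows "haar_outer {x \<in> carrier K. x \<otimes> g \<in> B} \<le> haar_outer B"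
  unfolding haar_outer_def[of B]
proof (rule INF_greatest)
  fix W assume "W \<in> {U. openin mtopology U \<and> B \<subseteq> U}"
  then have W: "openin mtopology W" "B \<subseteq> W" by simp_all
  then have "haar_outer {x \<in> carrier K. x \<otimes> g \<in> B} \<le> haar_content {x \<in> carrier K. x \<otimes> g \<in> W}"
    using g by (intro haar_outer_le openin_right_translate) auto
  also have "\<dots> = haar_content W"
    using openin_subset[OF W(1)] g by (intro haar_content_right_translate) simp_all
  finally show "haar_outer {x \<in> carrier K. x \<otimes> g \<in> B} \<le> haar_content W" .
qed

lemma haar_outer_right_translate:
  assumes g: "g \<in> carrier K" and B: "B \<subseteq> carrier K"
  shows "haar_outer {x \<in> carrier K. x \<otimes> g \<in> B} = haar_outer B"
  using haar_outer_right_translate_le[OF inv_closed[OF g], of "{x \<in> carrier K. x \<otimes> g \<in> B}"]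
    haar_outer_right_translate_le[OF g, of B]
  unfolding right_translate_inverse[OF g B] by (rule antisym[rotated])

text \<open>The outer measure is right-invariant, hence its image under inversion is left-invariant.\<close>

theorem haar_probability_exists: "\<exists>m. haar_probability K mtopology m"
proof -
  interpret P: sigma_algebra "carrier K" "Pow (carrier K)" by (rule sigma_algebra_Pow)
  let ?O = "{U. openin mtopology U}"
  let ?S = "sigma_sets (carrier K) ?O"
  define M where "M = measure_of (carrier K) ?O haar_outer"
  have O: "?O \<subseteq> Pow (carrier K)" using openin_subset[of mtopology] by auto
  have L: "measure_space (carrier K) (lambda_system (carrier K) (Pow (carrier K)) haar_outer) haar_outer"
    by (rule P.caratheodory_lemma[OF haar_outer_measure_space])
  then have "sigma_algebra (carrier K) (lambda_system (carrier K) (Pow (carrier K)) haar_outer)"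
    by (simp add: measure_space_def)
  then have "?S \<subseteq> lambda_system (carrier K) (Pow (carrier K)) haar_outer"
    using openin_lambda_system by (intro sigma_algebra.sigma_sets_subset) auto
  then have "measure_space (carrier K) ?S haar_outer"
    by (rule measure_down[OF L sigma_algebra_sigma_sets[OF O]])
  then have pos: "positive ?S haar_outer" and add: "countably_additive ?S haar_outer"
    by (simp_all add: measure_space_def)
  have setsM: "sets M = ?S" and spaceM: "space M = carrier K"
    unfolding M_def using O by (simp_all add: sets_measure_of space_measure_of)
  have emM: "emeasure M A = haar_outer A" if "A \<in> sets M" for A
    using that pos add unfolding setsM by (intro emeasure_measure_of[OF M_def O]) (simp_all add: setsM)
  have meas: "f \<in> measurable M M" if f: "continuous_map mtopology mtopology f" for f
  proof -
    have "f \<in> measurable M (measure_of (carrier K) ?O haar_outer)"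
    proof (rule measurable_measure_of[OF O])
      show "f \<in> space M \<rightarrow> carrier K"
        using continuous_map_funspace[OF f] by (simp add: spaceM)
      fix U assume "U \<in> ?O"
      then have "openin mtopology {x \<in> carrier K. f x \<in> U}"
        using openin_continuous_map_preimage[OF f] by simp
      moreover have "f -` U \<inter> space M = {x \<in> carrier K. f x \<in> U}" by (auto simp: spaceM)
      ultimately show "f -` U \<inter> space M \<in> sets M" by (simp add: setsM sigma_sets.Basic)
    qed
    then show ?thesis by (simp add: M_def)
  qed
  have inv_meas: "(\<lambda>x. inv x) \<in> measurable M M" by (rule meas[OF continuous_inv])
  have K_open: "openin mtopology (carrier K)" using openin_topspace[of mtopology] by simp
  have "emeasure M (space M) = 1"
    using emM[of "carrier K"] haar_outer_open[OF K_open] K_open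
    by (simp add: spaceM setsM sigma_sets.Basic haar_content_carrier)
  then have "prob_space M" by (rule prob_spaceI)
  define m where "m = distr M M (\<lambda>x. inv x)"
  have setsm: "sets m = sets M" by (simp add: m_def)
  have "prob_space m" unfolding m_def by (rule prob_space.prob_space_distr[OF \<open>prob_space M\<close> inv_meas])
  moreover have "sets m = sets (borel_of mtopology)"
    using O by (simp add: setsm setsM borel_of_def sets_measure_of)
  moreover have "emeasure m (g <#\<^bsub>K\<^esub> A) = emeasure m A" if g: "g \<in> carrier K" and A: "A \<in> sets m" for g A
  proof -
    have AK: "A \<subseteq> carrier K" using sets.sets_into_space[OF A] by (simp add: m_def spaceM)
    have gA: "g <#\<^bsub>K\<^esub> A = (\<lambda>x. inv g \<otimes> x) -` A \<inter> space M"
    proof (intro equalityI subsetI)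
      fix x assume "x \<in> g <#\<^bsub>K\<^esub> A"
      then obtain a where a: "a \<in> A" "x = g \<otimes> a" by (auto simp: l_coset_def)
      then have "inv g \<otimes> x = a" using AK g by (auto simp: m_assoc[symmetric])
      then show "x \<in> (\<lambda>x. inv g \<otimes> x) -` A \<inter> space M" using a AK g by (auto simp: spaceM)
    next
      fix x assume x: "x \<in> (\<lambda>x. inv g \<otimes> x) -` A \<inter> space M"
      then have "x = g \<otimes> (inv g \<otimes> x)" using g by (simp add: spaceM m_assoc[symmetric])
      then show "x \<in> g <#\<^bsub>K\<^esub> A" using x by (auto simp: l_coset_def)
    qed
    have gA_sets: "g <#\<^bsub>K\<^esub> A \<in> sets M"
      unfolding gA using meas[OF continuous_map_left_translation[OF inv_closed[OF g]]] A
      by (intro measurable_sets[of _ M M]) (simp_all add: setsm)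
    define B where "B = (\<lambda>x. inv x) -` A \<inter> space M"
    have B: "B \<in> sets M" unfolding B_def using inv_meas A by (intro measurable_sets[of _ M M]) (simp_all add: setsm)
    have BK: "B \<subseteq> carrier K" by (auto simp: B_def spaceM)
    \<comment> \<open>Inversion exchanges the sides: x^{-1} lies in g A exactly if (x g)^{-1} lies
      in A.\<close>
    have eq: "(\<lambda>x. inv x) -` (g <#\<^bsub>K\<^esub> A) \<inter> space M = {x \<in> carrier K. x \<otimes> g \<in> B}"
      unfolding gA B_def using g by (auto simp: spaceM inv_mult_group)
    have "emeasure m (g <#\<^bsub>K\<^esub> A) = emeasure M ((\<lambda>x. inv x) -` (g <#\<^bsub>K\<^esub> A) \<inter> space M)"
      unfolding m_def by (rule emeasure_distr[OF inv_meas gA_sets])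
    also have "\<dots> = haar_outer {x \<in> carrier K. x \<otimes> g \<in> B}"
      using emM[OF measurable_sets[OF inv_meas gA_sets]] unfolding eq .
    also have "\<dots> = haar_outer B" by (rule haar_outer_right_translate[OF g BK])
    also have "\<dots> = emeasure M B" by (rule emM[OF B, symmetric])
    also have "\<dots> = emeasure m A"
      unfolding m_def B_def using A by (intro emeasure_distr[OF inv_meas, symmetric]) (simp add: setsm)
    finally show ?thesis .
  qed
  ultimately show ?thesis unfolding haar_probability_def by blast
qed

corollary measure_metric_group_exists: "\<exists>m. measure_metric_group K d m"
proof -
  obtain m where "haar_probability K mtopology m" using haar_probability_exists ..
  then have "measure_metric_group K d m"
    by unfold_locales (rule metric compact)+
  then show ?thesis ..
qed

end

section \<open>The Wasserstein modulus of a chain of subgroups\<close>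

sublocale measure_metric_group \<subseteq> compact_metric_group K d
  by unfold_locales (rule metric compact)+

section \<open>Integrals against densities and their translates\<close>

context measure_metric_group
begin

lemma haar_left_translate: "h \<in> carrier K \<Longrightarrow> distr m m (\<lambda>g. inv h \<otimes> g) = m"
proof (rule measure_eqI)
  fix A assume h: "h \<in> carrier K" and "A \<in> sets (distr m m (\<lambda>g. inv h \<otimes> g))"
  then have A: "A \<in> sets m" by simp
  have AK: "A \<subseteq> carrier K" using sets.sets_into_space[OF A] by (simp add: space_haar)
  have "(\<lambda>g. inv h \<otimes> g) -` A \<inter> space m = h <#\<^bsub>K\<^esub> A"
  proof (intro equalityI subsetI)
    fix x assume "x \<in> h <#\<^bsub>K\<^esub> A"
    then obtain a where a: "a \<in> A" "x = h \<otimes> a" by (auto simp: l_coset_def)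
    then have "inv h \<otimes> x = a" using AK h by (auto simp: m_assoc[symmetric])
    then show "x \<in> (\<lambda>x. inv h \<otimes> x) -` A \<inter> space m" using a AK h by (auto simp: space_haar)
  next
    fix x assume x: "x \<in> (\<lambda>x. inv h \<otimes> x) -` A \<inter> space m"
    then have "x = h \<otimes> (inv h \<otimes> x)" using h by (simp add: space_haar m_assoc[symmetric])
    then show "x \<in> h <#\<^bsub>K\<^esub> A" using x by (auto simp: l_coset_def)
  qed
  then show "emeasure (distr m m (\<lambda>g. inv h \<otimes> g)) A = emeasure m A"
    using haar h A by (simp add: emeasure_distr[OF translate_measurable] haar_probability_def)
qed simp

lemma integral_left_translate:
  assumes "h \<in> carrier K" "\<psi> \<in> borel_measurable m"
  shows "(\<integral>g. \<psi> (inv h \<otimes> g) \<partial>m) = (\<integral>g. (\<psi> g :: real) \<partial>m)"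
  using integral_distr[OF translate_measurable[OF assms(1)] assms(2)]
  by (simp add: haar_left_translate[OF assms(1)])

lemma left_translate_measurable:
  "k \<in> carrier K \<Longrightarrow> \<psi> \<in> borel_measurable m \<Longrightarrow> (\<lambda>g. \<psi> (k \<otimes> g)) \<in> borel_measurable m"
  using measurable_compose[OF translate_measurable[of "inv k"], of \<psi> borel] by simp

lemma integrable_bounded_mult_density:
  assumes \<phi>: "\<phi> \<in> densities m" and g: "g \<in> borel_measurable m" "\<And>x. x \<in> carrier K \<Longrightarrow> \<bar>g x\<bar> \<le> c"
  shows "integrable m (\<lambda>x. g x * \<phi> x)"
proof (rule Bochner_Integration.integrable_bound)
  show "integrable m (\<lambda>x. c * \<phi> x)" using \<phi> by (simp add: densities_def)
  show "(\<lambda>x. g x * \<phi> x) \<in> borel_measurable m" using \<phi> g(1) by (auto simp: densities_def)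
  show "AE x in m. norm (g x * \<phi> x) \<le> norm (c * \<phi> x)"
  proof (rule AE_I2)
    fix x assume "x \<in> space m"
    then have "\<bar>g x\<bar> \<le> \<bar>c\<bar>" using g(2)[of x] by (simp add: space_haar)
    then show "norm (g x * \<phi> x) \<le> norm (c * \<phi> x)" by (simp add: abs_mult mult_right_mono)
  qed
qed

lemma integral_bounded_mult_density_le:
  assumes \<phi>: "\<phi> \<in> densities m" and g: "g \<in> borel_measurable m" "\<And>x. x \<in> carrier K \<Longrightarrow> \<bar>g x\<bar> \<le> c"
  shows "\<bar>\<integral>x. g x * \<phi> x \<partial>m\<bar> \<le> c"
proof -
  have "\<bar>\<integral>x. g x * \<phi> x \<partial>m\<bar> \<le> (\<integral>x. \<bar>g x * \<phi> x\<bar> \<partial>m)" by (rule integral_abs_bound)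
  also have "\<dots> \<le> (\<integral>x. c * \<phi> x \<partial>m)"
  proof (rule integral_mono_AE)
    show "integrable m (\<lambda>x. \<bar>g x * \<phi> x\<bar>)"
      using integrable_bounded_mult_density[OF \<phi> g] by (rule integrable_abs)
    show "integrable m (\<lambda>x. c * \<phi> x)" using \<phi> by (simp add: densities_def)
    have "AE x in m. 0 \<le> \<phi> x" using \<phi> by (simp add: densities_def)
    then show "AE x in m. \<bar>g x * \<phi> x\<bar> \<le> c * \<phi> x"
    proof (rule AE_mp, intro AE_I2 impI)
      fix x assume "x \<in> space m" "0 \<le> \<phi> x"
      then show "\<bar>g x * \<phi> x\<bar> \<le> c * \<phi> x"
        using g(2)[of x] by (simp add: space_haar abs_mult mult_right_mono)
    qed
  qed
  also have "\<dots> = c" using \<phi> by (simp add: densities_def)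
  finally show ?thesis .
qed

lemma translate_integrable:
  assumes \<phi>: "integrable m \<phi>" and h: "h \<in> carrier K"
  shows "integrable m (translate K h \<phi>)"
proof -
  have "integrable (distr m m (\<lambda>g. inv h \<otimes> g)) \<phi>" using \<phi> by (simp add: haar_left_translate[OF h])
  then show ?thesis
    unfolding translate_def using \<phi> by (subst (asm) integrable_distr_eq[OF translate_measurable[OF h]]) auto
qed

text \<open>Left-invariance of \<open>m\<close> moves the translation by u from g to \<phi>. What
  remains is at most \<open>c\<close> times the L1 norm of the difference of the translate and
  \<phi>, that is, \<open>2 * c\<close> times a total variation.\<close>

lemma integral_translate_difference_le:
  assumes \<phi>: "\<phi> \<in> densities m" and u: "u \<in> carrier K"
    and g: "g \<in> borel_measurable m" "\<And>x. x \<in> carrier K \<Longrightarrow> \<bar>g x\<bar> \<le> c"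
  shows "\<bar>(\<integral>x. g (u \<otimes> x) * \<phi> x \<partial>m) - (\<integral>x. g x * \<phi> x \<partial>m)\<bar>
    \<le> 2 * c * total_variation m (translate K u \<phi>) \<phi>"
proof -
  have \<phi>_int: "integrable m \<phi>" using \<phi> by (simp add: densities_def)
  have t_int: "integrable m (translate K u \<phi>)" by (rule translate_integrable[OF \<phi>_int u])
  \<comment> \<open>Stated for all integrable functions because it is also applied to the difference
    of a translate and \<phi>, which is not a density.\<close>
  have bd: "integrable m (\<lambda>x. g x * \<psi> x)" if "integrable m \<psi>" for \<psi>
  proof (rule Bochner_Integration.integrable_bound)
    show "integrable m (\<lambda>x. c * \<psi> x)" using that by simp
    show "(\<lambda>x. g x * \<psi> x) \<in> borel_measurable m" using that g(1) by auto
    show "AE x in m. norm (g x * \<psi> x) \<le> norm (c * \<psi> x)"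
    proof (rule AE_I2)
      fix x assume "x \<in> space m"
      then have "\<bar>g x\<bar> \<le> \<bar>c\<bar>" using g(2)[of x] by (simp add: space_haar)
      then show "norm (g x * \<psi> x) \<le> norm (c * \<psi> x)" by (simp add: abs_mult mult_right_mono)
    qed
  qed
  have "(\<integral>x. g (u \<otimes> x) * \<phi> x \<partial>m) = (\<integral>x. g (u \<otimes> (inv u \<otimes> x)) * \<phi> (inv u \<otimes> x) \<partial>m)"
    by (rule integral_left_translate[OF u borel_measurable_times[OF left_translate_measurable[OF u g(1)]
            borel_measurable_integrable[OF \<phi>_int]], symmetric])
  also have "\<dots> = (\<integral>x. g x * translate K u \<phi> x \<partial>m)"
    unfolding translate_def using u
    by (intro Bochner_Integration.integral_cong) (simp_all add: space_haar m_assoc[symmetric])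
  finally have "\<bar>(\<integral>x. g (u \<otimes> x) * \<phi> x \<partial>m) - (\<integral>x. g x * \<phi> x \<partial>m)\<bar> =
      \<bar>\<integral>x. g x * (translate K u \<phi> x - \<phi> x) \<partial>m\<bar>"
    using bd[OF t_int] bd[OF \<phi>_int] by (simp add: right_diff_distrib)
  also have "\<dots> \<le> (\<integral>x. \<bar>g x * (translate K u \<phi> x - \<phi> x)\<bar> \<partial>m)" by (rule integral_abs_bound)
  also have "\<dots> \<le> (\<integral>x. c * \<bar>translate K u \<phi> x - \<phi> x\<bar> \<partial>m)"
  proof (rule integral_mono)
    show "integrable m (\<lambda>x. \<bar>g x * (translate K u \<phi> x - \<phi> x)\<bar>)"
      using bd[OF Bochner_Integration.integrable_diff[OF t_int \<phi>_int]] by (rule integrable_abs)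
    show "integrable m (\<lambda>x. c * \<bar>translate K u \<phi> x - \<phi> x\<bar>)" using t_int \<phi>_int by simp
    show "\<bar>g x * (translate K u \<phi> x - \<phi> x)\<bar> \<le> c * \<bar>translate K u \<phi> x - \<phi> x\<bar>" if "x \<in> space m" for x
      using g(2)[of x] that by (simp add: space_haar abs_mult mult_right_mono)
  qed
  also have "\<dots> = 2 * c * total_variation m (translate K u \<phi>) \<phi>"
    by (simp add: total_variation_def)
  finally show ?thesis .
qed

lemma integral_mean:
  assumes "\<And>a. a \<in> set as \<Longrightarrow> integrable m (F a)"
  shows "(\<integral>x. mean as (\<lambda>a. F a x) \<partial>m) = mean as (\<lambda>a. \<integral>x. F a x \<partial>m)"
proof -
  have "(\<integral>x. (\<Sum>i<length as. F (as ! i) x) \<partial>m) = (\<Sum>i<length as. \<integral>x. F (as ! i) x \<partial>m)"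
    by (rule Bochner_Integration.integral_sum) (simp add: assms)
  then show ?thesis unfolding mean_def by simp
qed

section \<open>Averages over one link of a chain\<close>

lemma lipschitz1_subgroup:
  assumes "f \<in> lipschitz1 (carrier K) d" "A \<subseteq> carrier K" "y \<in> carrier K"
  shows "(\<lambda>k. f (k \<otimes> y)) \<in> lipschitz1 A d"
  using lipschitz1_right_translate[OF assms(1,3)] subsetD[OF assms(2)] by (simp add: lipschitz1_def)

text \<open>By right-invariance of the metric, k -> f (k y) is 1-Lipschitz on \<open>A\<close> for
  every y of the whole group, so the list for \<open>A\<close> can be used at arbitrary base points.
  The second part is the approximate left \<open>A\<close>-invariance of the averaged
  function.\<close>

lemma invariant_mean_translates:
  assumes as: "invariant_mean K d A \<delta> as" and A: "A \<subseteq> carrier K"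
    and f: "f \<in> lipschitz1 (carrier K) d" and x: "x \<in> A" and y: "y \<in> carrier K"
  shows "\<bar>mean as (\<lambda>k. f (x \<otimes> (k \<otimes> y))) - mean as (\<lambda>k. f (k \<otimes> y))\<bar> \<le> \<delta>"
    and "\<bar>mean as (\<lambda>k. f (k \<otimes> (x \<otimes> y))) - mean as (\<lambda>k. f (k \<otimes> y))\<bar> \<le> \<delta>"
proof -
  have k: "k \<in> carrier K" if "k \<in> set as" for k
    by (rule subsetD[OF A subsetD[OF invariant_meanD(2)[OF as] that]])
  have xK: "x \<in> carrier K" by (rule subsetD[OF A x])
  have "mean as (\<lambda>k. f (x \<otimes> (k \<otimes> y))) = mean as (\<lambda>k. f (x \<otimes> k \<otimes> y))"
    using xK y by (intro mean_cong) (simp add: k m_assoc)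
  moreover have "mean as (\<lambda>k. f (k \<otimes> (x \<otimes> y))) = mean as (\<lambda>k. f (k \<otimes> x \<otimes> y))"
    using xK y by (intro mean_cong) (simp add: k m_assoc)
  moreover note invariant_meanD(3,4)[OF as lipschitz1_subgroup[OF f A y] x]
  ultimately show "\<bar>mean as (\<lambda>k. f (x \<otimes> (k \<otimes> y))) - mean as (\<lambda>k. f (k \<otimes> y))\<bar> \<le> \<delta>"
    "\<bar>mean as (\<lambda>k. f (k \<otimes> (x \<otimes> y))) - mean as (\<lambda>k. f (k \<otimes> y))\<bar> \<le> \<delta>"
    by simp_all
qed

definition left_average :: "'a list \<Rightarrow> ('a \<Rightarrow> real) \<Rightarrow> 'a \<Rightarrow> real" where
  "left_average as f y = mean as (\<lambda>k. f (k \<otimes> y))"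

lemma mean_left_translate_measurable:
  assumes g: "g \<in> borel_measurable m" and as: "set as \<subseteq> carrier K"
  shows "(\<lambda>y. mean as (\<lambda>k. g (k \<otimes> y))) \<in> borel_measurable m"
proof -
  have "(\<lambda>y. g (as ! i \<otimes> y)) \<in> borel_measurable m" if "i < length as" for i
    by (rule left_translate_measurable[OF subsetD[OF as nth_mem[OF that]] g])
  then have "(\<lambda>y. \<Sum>i<length as. g (as ! i \<otimes> y)) \<in> borel_measurable m"
    by (rule borel_measurable_sum) simp
  then show ?thesis unfolding mean_def by (rule borel_measurable_divide) simp
qed

lemma left_average_measurable:
  assumes "f \<in> lipschitz1 (carrier K) d" "set as \<subseteq> carrier K"
  shows "left_average as f \<in> borel_measurable m"
  unfolding left_average_def[abs_def]
  by (rule mean_left_translate_measurable[OF lipschitz1_measurable[OF assms(1)] assms(2)])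

text \<open>For b in \<open>B\<close> choose a in \<open>A\<close> with b a within \<rho> of the
  identity. Since b k y = (b a) (a^{-1} k y), the average of f (b k y) over \<open>as\<close>
  differs by at most \<rho> from that of f (a^{-1} k y), hence by \<rho> + \<delta> from f_A (y).
  Averaging over b and exchanging the means gives f_B (y) at the cost of another \<delta>.\<close>

lemma left_average_close:
  assumes A: "subgroup A K" and B: "B \<subseteq> carrier K" "A \<subseteq> B"
    and as: "invariant_mean K d A \<delta> as" and bs: "invariant_mean K d B \<delta> bs"
    and \<rho>: "\<And>b. b \<in> B \<Longrightarrow> \<exists>a\<in>A. d \<one> (b \<otimes> a) \<le> \<rho>"
    and f: "f \<in> lipschitz1 (carrier K) d" and y: "y \<in> carrier K"
  shows "\<bar>left_average as f y - left_average bs f y\<bar> \<le> \<rho> + 2 * \<delta>"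
proof -
  have AK: "A \<subseteq> carrier K" by (rule subgroup.subset[OF A])
  note as1 = invariant_meanD(1,2)[OF as] and bs1 = invariant_meanD(1,2)[OF bs]
  have b: "\<bar>mean as (\<lambda>k. f (b \<otimes> (k \<otimes> y))) - left_average as f y\<bar> \<le> \<rho> + \<delta>" if "b \<in> B" for b
  proof -
    have bK: "b \<in> carrier K" using that B by blast
    obtain a where a: "a \<in> A" "d \<one> (b \<otimes> a) \<le> \<rho>" using \<rho>[OF \<open>b \<in> B\<close>] by blast
    have aK: "a \<in> carrier K" using a(1) AK by blast
    have "\<bar>mean as (\<lambda>k. f (b \<otimes> (k \<otimes> y))) - mean as (\<lambda>k. f (inv a \<otimes> (k \<otimes> y)))\<bar> \<le> \<rho>"
    proof (rule mean_abs_le[OF as1(1)])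
      fix k assume "k \<in> set as"
      then have k: "k \<in> carrier K" using as1(2) AK by blast
      let ?w = "inv a \<otimes> (k \<otimes> y)"
      have w: "?w \<in> carrier K" using aK k y by simp
      have "a \<otimes> ?w = a \<otimes> inv a \<otimes> (k \<otimes> y)" by (rule m_assoc[symmetric]) (use aK k y in simp_all)
      also have "\<dots> = k \<otimes> y" using aK k y by simp
      finally have eq: "b \<otimes> (k \<otimes> y) = (b \<otimes> a) \<otimes> ?w"
        by (simp only: m_assoc[OF bK aK w])
      have "\<bar>f (b \<otimes> (k \<otimes> y)) - f (\<one> \<otimes> ?w)\<bar> \<le> d ((b \<otimes> a) \<otimes> ?w) (\<one> \<otimes> ?w)"
        unfolding eq by (rule lipschitz1D[OF f]) (use aK bK w in simp_all)
      also have "\<dots> = d (b \<otimes> a) \<one>" by (rule right_invariant) (use aK bK w in simp_all)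
      finally have "\<bar>f (b \<otimes> (k \<otimes> y)) - f ?w\<bar> \<le> d (b \<otimes> a) \<one>" using w by simp
      then show "\<bar>f (b \<otimes> (k \<otimes> y)) - f ?w\<bar> \<le> \<rho>" using a(2) commute[of \<one> "b \<otimes> a"] by linarith
    qed
    moreover have "\<bar>mean as (\<lambda>k. f (inv a \<otimes> (k \<otimes> y))) - left_average as f y\<bar> \<le> \<delta>"
      unfolding left_average_def
      by (rule invariant_mean_translates(1)[OF as AK f subgroup.m_inv_closed[OF A a(1)] y])
    ultimately show ?thesis by linarith
  qed
  have "\<bar>mean bs (\<lambda>b. mean as (\<lambda>k. f (b \<otimes> (k \<otimes> y)))) - mean bs (\<lambda>_. left_average as f y)\<bar> \<le> \<rho> + \<delta>"
    by (rule mean_abs_le[OF bs1(1)]) (rule b[OF subsetD[OF bs1(2)]])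
  moreover have "\<bar>mean as (\<lambda>k. mean bs (\<lambda>b. f (b \<otimes> (k \<otimes> y)))) - mean as (\<lambda>_. left_average bs f y)\<bar> \<le> \<delta>"
    unfolding left_average_def
    by (rule mean_abs_le[OF as1(1)])
      (rule invariant_mean_translates(2)[OF bs B(1) f subsetD[OF B(2) subsetD[OF as1(2)]] y])
  ultimately show ?thesis
    unfolding mean_swap[of bs as] mean_const[OF as1(1)] mean_const[OF bs1(1)] by linarith
qed

text \<open>Averaging either f_A or f_B over translates by \<open>bs\<close> returns f_B up to
  \<delta>: after exchanging the means, the outer list consists of elements of \<open>B\<close>,
  which hardly affect the inner mean over \<open>bs\<close>.\<close>

lemma left_average_difference_mean_zero:
  assumes B: "B \<subseteq> carrier K" "A \<subseteq> B"
    and as: "invariant_mean K d A \<delta> as" and bs: "invariant_mean K d B \<delta> bs"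
    and f: "f \<in> lipschitz1 (carrier K) d" and y: "y \<in> carrier K"
  shows "\<bar>mean bs (\<lambda>b. left_average as f (b \<otimes> y) - left_average bs f (b \<otimes> y))\<bar> \<le> 2 * \<delta>"
proof -
  note as1 = invariant_meanD(1,2)[OF as] and bs1 = invariant_meanD(1,2)[OF bs]
  have "\<bar>mean as (\<lambda>k. mean bs (\<lambda>b. f (k \<otimes> (b \<otimes> y)))) - mean as (\<lambda>_. left_average bs f y)\<bar> \<le> \<delta>"
    unfolding left_average_def
    by (rule mean_abs_le[OF as1(1)])
      (rule invariant_mean_translates(1)[OF bs B(1) f subsetD[OF B(2) subsetD[OF as1(2)]] y])
  moreover have "\<bar>mean bs (\<lambda>k. mean bs (\<lambda>b. f (k \<otimes> (b \<otimes> y)))) - mean bs (\<lambda>_. left_average bs f y)\<bar> \<le> \<delta>"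
    unfolding left_average_def
    by (rule mean_abs_le[OF bs1(1)])
      (rule invariant_mean_translates(1)[OF bs B(1) f subsetD[OF bs1(2)] y])
  moreover have "mean bs (\<lambda>b. left_average as f (b \<otimes> y) - left_average bs f (b \<otimes> y)) =
      mean as (\<lambda>k. mean bs (\<lambda>b. f (k \<otimes> (b \<otimes> y)))) - mean bs (\<lambda>k. mean bs (\<lambda>b. f (k \<otimes> (b \<otimes> y))))"
    unfolding mean_diff left_average_def by (rule arg_cong2[where f = "(-)"]) (rule mean_swap)+
  ultimately show ?thesis
    unfolding mean_const[OF as1(1)] mean_const[OF bs1(1)] by linarith
qed

text \<open>The integral of D \<phi> is compared with that of D (b y) \<phi>(y) for each b in
  \<open>bs\<close>. Replacing b by \<open>u b\<close> costs 2 \<delta>, as D is nearly left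
  \<open>A\<close>-invariant, and moving \<open>u b\<close> onto \<phi> costs a total variation. The
  mean over b of the shifted integrals is at most 2 \<delta>, whence 4 \<delta> in all. How close
  \<open>u b\<close> is to the identity matters only later, when the total variations are
  bounded.\<close>

lemma left_average_difference_integral:
  assumes A: "subgroup A K" and B: "B \<subseteq> carrier K" "A \<subseteq> B"
    and as: "invariant_mean K d A \<delta> as" and bs: "invariant_mean K d B \<delta> bs"
    and \<rho>: "\<And>b. b \<in> B \<Longrightarrow> \<exists>a\<in>A. d \<one> (b \<otimes> a) \<le> \<rho>"
    and u: "\<And>b. b \<in> B \<Longrightarrow> u b \<in> carrier K" "\<And>b. b \<in> B \<Longrightarrow> \<exists>a\<in>A. b = a \<otimes> u b"
    and f: "f \<in> lipschitz1 (carrier K) d" and \<phi>: "\<phi> \<in> densities m"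
  shows "\<bar>(\<integral>y. left_average as f y * \<phi> y \<partial>m) - (\<integral>y. left_average bs f y * \<phi> y \<partial>m)\<bar>
    \<le> 4 * \<delta> + 2 * (\<rho> + 2 * \<delta>) * mean bs (\<lambda>b. total_variation m (translate K (u b) \<phi>) \<phi>)"
proof -
  have AK: "A \<subseteq> carrier K" by (rule subgroup.subset[OF A])
  note as1 = invariant_meanD(1,2)[OF as] and bs1 = invariant_meanD(1,2)[OF bs]
  define D where "D y = left_average as f y - left_average bs f y" for y
  have D_meas: "D \<in> borel_measurable m"
    unfolding D_def[abs_def] using as1(2) bs1(2) AK B
    by (intro borel_measurable_diff left_average_measurable[OF f]) auto
  have D_le: "\<bar>D y\<bar> \<le> \<rho> + 2 * \<delta>" if "y \<in> carrier K" for y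
    unfolding D_def by (rule left_average_close[OF A B as bs \<rho> f that])
  have D_int: "integrable m (\<lambda>y. D (b \<otimes> y) * \<phi> y)" if "b \<in> carrier K" for b
    by (rule integrable_bounded_mult_density[OF \<phi> left_translate_measurable[OF that D_meas]
          D_le[OF m_closed[OF that]]])
  have avg_int: "integrable m (\<lambda>y. left_average xs f y * \<phi> y)" if xs: "set xs \<subseteq> carrier K" "xs \<noteq> []" for xs
  proof -
    obtain c where c: "\<And>x. x \<in> carrier K \<Longrightarrow> \<bar>f x\<bar> \<le> c" using lipschitz1_bounded[OF f] by blast
    have "\<bar>left_average xs f y\<bar> \<le> c" if "y \<in> carrier K" for y
    proof -
      have "\<bar>mean xs (\<lambda>k. f (k \<otimes> y))\<bar> \<le> mean xs (\<lambda>_. c)"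
        by (rule mean_abs_bound) (use xs(1) that c in auto)
      then show ?thesis unfolding left_average_def mean_const[OF xs(2)] .
    qed
    then show ?thesis
      by (rule integrable_bounded_mult_density[OF \<phi> left_average_measurable[OF f xs(1)]])
  qed
  let ?I = "\<integral>y. D y * \<phi> y \<partial>m"
  have "\<bar>mean bs (\<lambda>b. \<integral>y. D (b \<otimes> y) * \<phi> y \<partial>m)\<bar> \<le> 2 * \<delta>"
  proof -
    have "mean bs (\<lambda>b. \<integral>y. D (b \<otimes> y) * \<phi> y \<partial>m) = (\<integral>y. mean bs (\<lambda>b. D (b \<otimes> y) * \<phi> y) \<partial>m)"
      by (rule integral_mean[symmetric], rule D_int) (use bs1(2) B(1) in blast)
    also have "\<dots> = (\<integral>y. mean bs (\<lambda>b. D (b \<otimes> y)) * \<phi> y \<partial>m)"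
      by (simp add: mean_def sum_distrib_right)
    finally show ?thesis
    proof (rule ssubst, intro integral_bounded_mult_density_le[OF \<phi>])
      show "(\<lambda>y. mean bs (\<lambda>b. D (b \<otimes> y))) \<in> borel_measurable m"
        by (rule mean_left_translate_measurable[OF D_meas order_trans[OF bs1(2) B(1)]])
      show "\<bar>mean bs (\<lambda>b. D (b \<otimes> y))\<bar> \<le> 2 * \<delta>" if "y \<in> carrier K" for y
        unfolding D_def by (rule left_average_difference_mean_zero[OF B as bs f that])
    qed
  qed
  moreover have "\<bar>mean bs (\<lambda>b. ?I - (\<integral>y. D (b \<otimes> y) * \<phi> y \<partial>m))\<bar>
    \<le> mean bs (\<lambda>b. 2 * \<delta> + 2 * (\<rho> + 2 * \<delta>) * total_variation m (translate K (u b) \<phi>) \<phi>)"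
  proof (rule mean_abs_bound)
    fix b assume "b \<in> set bs"
    then have b: "b \<in> B" "b \<in> carrier K" using bs1(2) B(1) by blast+
    obtain a where a: "a \<in> A" "b = a \<otimes> u b" using u(2)[OF b(1)] by blast
    have aK: "a \<in> carrier K" and aB: "a \<in> B" using a(1) AK B(2) by blast+
    note ub = u(1)[OF b(1)]
    have close: "\<bar>D (b \<otimes> y) - D (u b \<otimes> y)\<bar> \<le> 2 * \<delta>" if y: "y \<in> carrier K" for y
    proof -
      have uy: "u b \<otimes> y \<in> carrier K" using ub y by simp
      have by': "b \<otimes> y = a \<otimes> (u b \<otimes> y)" using m_assoc[OF aK ub y] a(2) by simp
      have "\<bar>left_average as f (b \<otimes> y) - left_average as f (u b \<otimes> y)\<bar> \<le> \<delta>"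
        unfolding left_average_def by' by (rule invariant_mean_translates(2)[OF as AK f a(1) uy])
      moreover have "\<bar>left_average bs f (b \<otimes> y) - left_average bs f (u b \<otimes> y)\<bar> \<le> \<delta>"
        unfolding left_average_def by' by (rule invariant_mean_translates(2)[OF bs B(1) f aB uy])
      ultimately show ?thesis unfolding D_def by linarith
    qed
    have "\<bar>(\<integral>y. D (b \<otimes> y) * \<phi> y \<partial>m) - (\<integral>y. D (u b \<otimes> y) * \<phi> y \<partial>m)\<bar> =
        \<bar>\<integral>y. (D (b \<otimes> y) - D (u b \<otimes> y)) * \<phi> y \<partial>m\<bar>"
      using D_int[OF b(2)] D_int[OF ub] by (simp add: left_diff_distrib)
    also have "\<dots> \<le> 2 * \<delta>"
      by (rule integral_bounded_mult_density_le[OF \<phi> _ close])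
        (rule borel_measurable_diff[OF left_translate_measurable[OF b(2) D_meas]
            left_translate_measurable[OF ub D_meas]])
    finally have "\<bar>(\<integral>y. D (b \<otimes> y) * \<phi> y \<partial>m) - (\<integral>y. D (u b \<otimes> y) * \<phi> y \<partial>m)\<bar> \<le> 2 * \<delta>" .
    moreover have "\<bar>(\<integral>y. D (u b \<otimes> y) * \<phi> y \<partial>m) - ?I\<bar>
        \<le> 2 * (\<rho> + 2 * \<delta>) * total_variation m (translate K (u b) \<phi>) \<phi>"
      by (rule integral_translate_difference_le[OF \<phi> ub D_meas D_le])
    ultimately show "\<bar>?I - (\<integral>y. D (b \<otimes> y) * \<phi> y \<partial>m)\<bar>
        \<le> 2 * \<delta> + 2 * (\<rho> + 2 * \<delta>) * total_variation m (translate K (u b) \<phi>) \<phi>"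
      by linarith
  qed
  ultimately have "\<bar>?I\<bar> \<le> 4 * \<delta> + 2 * (\<rho> + 2 * \<delta>) * mean bs (\<lambda>b. total_variation m (translate K (u b) \<phi>) \<phi>)"
    unfolding mean_diff mean_add mean_mult mean_const[OF bs1(1)] by linarith
  moreover have "?I = (\<integral>y. left_average as f y * \<phi> y \<partial>m) - (\<integral>y. left_average bs f y * \<phi> y \<partial>m)"
    unfolding D_def left_diff_distrib
    by (rule Bochner_Integration.integral_diff; rule avg_int) (use as1 bs1 AK B(1) in auto)
  ultimately show ?thesis by simp
qed

end

section \<open>Compact subgroups with the restricted metric\<close>

lemma subgroup_compact_metric_group:
  assumes G: "topological_group G T" and dG: "compatible_right_invariant_metric G T d"
    and H: "subgroup H G" and cH: "compactin T H"
  shows "compact_metric_group (G\<lparr>carrier := H\<rparr>) d"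
proof -
  interpret G: topological_group G T by (rule G)
  interpret H: subgroup H G by (rule H)
  interpret D: Metric_space "carrier G" d
    using dG by (simp add: compatible_right_invariant_metric_def)
  have T: "D.mtopology = T" using dG by (simp add: compatible_right_invariant_metric_def)
  interpret S: Submetric "carrier G" d H by unfold_locales (rule H.subset)
  have top: "S.sub.mtopology = subtopology T H" using S.mtopology_submetric T by simp
  have group: "group (G\<lparr>carrier := H\<rparr>)" by (rule H.subgroup_is_group[OF G.group_axioms])
  have inv_eq: "inv\<^bsub>G\<lparr>carrier := H\<rparr>\<^esub> x = inv\<^bsub>G\<^esub> x" if "x \<in> H" for x
    by (rule G.m_inv_consistent[OF H that])
  show ?thesis
  proof (intro compact_metric_group.intro topological_group.intro group topological_group_axioms.intro
      compact_metric_group_axioms.intro)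
    show "topspace (Metric_space.mtopology (carrier (G\<lparr>carrier := H\<rparr>)) d) = carrier (G\<lparr>carrier := H\<rparr>)"
      by simp
    have "continuous_map (subtopology (prod_topology T T) (H \<times> H)) T (\<lambda>(x, y). x \<otimes>\<^bsub>G\<^esub> y)"
      by (rule continuous_map_from_subtopology[OF G.continuous_mult])
    moreover have "(\<lambda>(x, y). x \<otimes>\<^bsub>G\<^esub> y) \<in> topspace (subtopology (prod_topology T T) (H \<times> H)) \<rightarrow> H"
      by (auto intro: H.m_closed)
    ultimately have "continuous_map (subtopology (prod_topology T T) (H \<times> H)) (subtopology T H) (\<lambda>(x, y). x \<otimes>\<^bsub>G\<^esub> y)"
      by (rule continuous_map_into_subtopology)
    then show "continuous_map (prod_topology (Metric_space.mtopology (carrier (G\<lparr>carrier := H\<rparr>)) d)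
        (Metric_space.mtopology (carrier (G\<lparr>carrier := H\<rparr>)) d))
      (Metric_space.mtopology (carrier (G\<lparr>carrier := H\<rparr>)) d)
      (\<lambda>(x, y). x \<otimes>\<^bsub>G\<lparr>carrier := H\<rparr>\<^esub> y)"
      by (simp add: top subtopology_Times)
    have "continuous_map (subtopology T H) T (\<lambda>x. inv\<^bsub>G\<^esub> x)"
      by (rule continuous_map_from_subtopology[OF G.continuous_inv])
    moreover have "(\<lambda>x. inv\<^bsub>G\<^esub> x) \<in> topspace (subtopology T H) \<rightarrow> H"
      by (auto intro: H.m_inv_closed)
    ultimately have "continuous_map (subtopology T H) (subtopology T H) (\<lambda>x. inv\<^bsub>G\<^esub> x)"
      by (rule continuous_map_into_subtopology)
    then have "continuous_map (subtopology T H) (subtopology T H) (\<lambda>x. inv\<^bsub>G\<lparr>carrier := H\<rparr>\<^esub> x)"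
      by (rule continuous_map_eq) (simp add: inv_eq)
    then show "continuous_map (Metric_space.mtopology (carrier (G\<lparr>carrier := H\<rparr>)) d)
      (Metric_space.mtopology (carrier (G\<lparr>carrier := H\<rparr>)) d) (\<lambda>x. inv\<^bsub>G\<lparr>carrier := H\<rparr>\<^esub> x)"
      by (simp add: top)
    have "\<forall>x\<in>H. \<forall>y\<in>H. \<forall>g\<in>H. d (x \<otimes>\<^bsub>G\<^esub> g) (y \<otimes>\<^bsub>G\<^esub> g) = d x y"
      using dG H.mem_carrier unfolding compatible_right_invariant_metric_def by blast
    then show "compatible_right_invariant_metric (G\<lparr>carrier := H\<rparr>)
        (Metric_space.mtopology (carrier (G\<lparr>carrier := H\<rparr>)) d) d"
      unfolding compatible_right_invariant_metric_def using S.sub.Metric_space_axioms by simp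
    show "compact_space (Metric_space.mtopology (carrier (G\<lparr>carrier := H\<rparr>)) d)"
      using cH by (simp add: top compactin_subspace)
  qed
qed

text \<open>Restricting the carrier leaves the multiplication unchanged, so a list found inside the
  subgroup is also one for the ambient group.\<close>

lemma invariant_mean_exists:
  assumes "compact_metric_group (G\<lparr>carrier := A\<rparr>) d" "\<delta> > 0"
  shows "\<exists>xs. invariant_mean G d A \<delta> xs"
  using compact_metric_group.invariant_mean_carrier_exists[OF assms] by (simp add: invariant_mean_def)

section \<open>From quotient radii to a bound on the Wasserstein modulus\<close>

context measure_metric_group
begin

text \<open>The hypothesis multiplies by elements of \<open>A\<close> on the right, while left
  \<open>A\<close>-invariance calls for a factor on the left. Apply it to b^{-1} and invert: u =
  a^{-1} b is the inverse of b^{-1} a, and right-invariance gives an element and its inverse the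
  same distance from the identity.\<close>

lemma coset_representative_near_one:
  assumes A: "subgroup A K" and B: "subgroup B K"
    and \<rho>: "\<And>b. b \<in> B \<Longrightarrow> \<exists>a\<in>A. d \<one> (b \<otimes> a) \<le> \<rho>" and b: "b \<in> B"
  shows "\<exists>u. u \<in> carrier K \<and> d \<one> u \<le> \<rho> \<and> (\<exists>a\<in>A. b = a \<otimes> u)"
proof -
  have bK: "b \<in> carrier K" by (rule subgroup.mem_carrier[OF B b])
  obtain a where a: "a \<in> A" "d \<one> (inv b \<otimes> a) \<le> \<rho>" using \<rho>[OF subgroup.m_inv_closed[OF B b]] by blast
  have aK: "a \<in> carrier K" by (rule subgroup.mem_carrier[OF A a(1)])
  let ?u = "inv a \<otimes> b"
  have u: "?u \<in> carrier K" using aK bK by simp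
  have "(inv b \<otimes> a) \<otimes> ?u = inv b \<otimes> (a \<otimes> (inv a \<otimes> b))" using aK bK by (simp add: m_assoc)
  also have "a \<otimes> (inv a \<otimes> b) = a \<otimes> inv a \<otimes> b" by (rule m_assoc[symmetric]) (use aK bK in simp_all)
  also have "\<dots> = b" using aK bK by simp
  finally have one: "(inv b \<otimes> a) \<otimes> ?u = \<one>" using bK by simp
  have "d (\<one> \<otimes> ?u) ((inv b \<otimes> a) \<otimes> ?u) = d \<one> (inv b \<otimes> a)"
    by (rule right_invariant) (use aK bK in simp_all)
  then have "d ?u \<one> = d \<one> (inv b \<otimes> a)" unfolding one using u by simp
  then have "d \<one> ?u \<le> \<rho>" using a(2) commute[of \<one> ?u] by linarith
  moreover have "b = a \<otimes> ?u"
  proof -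
    have "a \<otimes> (inv a \<otimes> b) = a \<otimes> inv a \<otimes> b" by (rule m_assoc[symmetric]) (use aK bK in simp_all)
    then show ?thesis using aK bK by simp
  qed
  ultimately show ?thesis using u a(1) by blast
qed

lemma total_variation_nonneg: "0 \<le> total_variation m \<phi> \<psi>"
  unfolding total_variation_def by simp

text \<open>Evaluates the supremum defining v at a single u and passes from extended to real
  integrals, so that finite linear combinations over different u can be integrated over z.\<close>

lemma kernel_total_variation:
  assumes ker: "measurable_kernel m \<zeta> \<Phi>" and v: "kernel_v K d m \<zeta> \<Phi> r \<le> ennreal \<epsilon>" and \<epsilon>: "0 \<le> \<epsilon>"
    and u: "u \<in> carrier K" "d \<one> u \<le> r"
  shows "integrable \<zeta> (\<lambda>z. total_variation m (translate K u (\<Phi> z)) (\<Phi> z))"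
    and "(\<integral>z. total_variation m (translate K u (\<Phi> z)) (\<Phi> z) \<partial>\<zeta>) \<le> \<epsilon>"
proof -
  let ?V = "\<lambda>z. total_variation m (translate K u (\<Phi> z)) (\<Phi> z)"
  have le: "(\<integral>\<^sup>+z. ennreal (?V z) \<partial>\<zeta>) \<le> ennreal \<epsilon>"
  proof (rule order_trans[OF _ v])
    show "(\<integral>\<^sup>+z. ennreal (?V z) \<partial>\<zeta>) \<le> kernel_v K d m \<zeta> \<Phi> r"
      unfolding kernel_v_def by (rule SUP_upper2[of u]) (use u in simp_all)
  qed
  have "(\<lambda>z. enn2real (ennreal (?V z))) \<in> borel_measurable \<zeta>"
    by (rule borel_measurable_enn2real[OF total_variation_measurable[OF ker u(1)]])
  then have meas: "?V \<in> borel_measurable \<zeta>" by (simp add: total_variation_nonneg)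
  show int: "integrable \<zeta> ?V"
  proof (rule integrableI_bounded[OF meas])
    have "(\<integral>\<^sup>+z. ennreal (norm (?V z)) \<partial>\<zeta>) = (\<integral>\<^sup>+z. ennreal (?V z) \<partial>\<zeta>)"
      by (simp add: total_variation_nonneg)
    also have "\<dots> < \<infinity>" using le ennreal_less_top[of \<epsilon>] by (simp add: order_le_less_trans)
    finally show "(\<integral>\<^sup>+z. ennreal (norm (?V z)) \<partial>\<zeta>) < \<infinity>" .
  qed
  have "ennreal (\<integral>z. ?V z \<partial>\<zeta>) \<le> ennreal \<epsilon>"
    using le nn_integral_eq_integral[OF int AE_I2[OF total_variation_nonneg]] by simp
  then show "(\<integral>z. ?V z \<partial>\<zeta>) \<le> \<epsilon>" using \<epsilon> by (simp add: ennreal_le_iff)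
qed

text \<open>For fixed z the differences between consecutive averages telescope from f itself at the
  trivial subgroup to a nearly constant function at the whole group. The resulting bound is the same
  for all f, so the supremum over f is taken before integrating over z.\<close>

lemma kernel_w_chain_bound:
  fixes H :: "nat \<Rightarrow> 'a set"
  assumes H: "\<And>i. i \<le> M \<Longrightarrow> subgroup (H i) K" "\<And>i. i \<le> M \<Longrightarrow> compactin mtopology (H i)"
    and H0: "H 0 = {\<one>}" and HM: "H M = carrier K"
    and mono: "\<And>i. i < M \<Longrightarrow> H i \<subseteq> H (Suc i)"
    and \<rho>: "\<And>i b. i < M \<Longrightarrow> b \<in> H (Suc i) \<Longrightarrow> \<exists>a\<in>H i. d \<one> (b \<otimes> a) \<le> \<rho> i"
    and \<rho>r: "\<And>i. i < M \<Longrightarrow> \<rho> i \<le> r" and \<epsilon>: "0 \<le> \<epsilon>" and \<delta>: "0 < \<delta>"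
    and ker: "measurable_kernel m \<zeta> \<Phi>" and v: "kernel_v K d m \<zeta> \<Phi> r \<le> ennreal \<epsilon>"
  shows "kernel_w K d m \<zeta> \<Phi> \<le> ennreal (2 * \<delta> + (\<Sum>i<M. 4 * \<delta> + 2 * (\<rho> i + 2 * \<delta>) * \<epsilon>))"
proof -
  interpret \<zeta>: prob_space \<zeta> using ker by (simp add: measurable_kernel_def)
  have tg: "topological_group K mtopology" by (rule topological_group_axioms)
  have "\<exists>xs. invariant_mean K d (H i) \<delta> xs" if "i \<le> M" for i
    by (rule invariant_mean_exists[OF subgroup_compact_metric_group[OF tg metric H[OF that]] \<delta>])
  then have "\<forall>i. \<exists>xs. i \<le> M \<longrightarrow> invariant_mean K d (H i) \<delta> xs" by blast
  then obtain xs where "\<forall>i. i \<le> M \<longrightarrow> invariant_mean K d (H i) \<delta> (xs i)" by (rule choice[THEN exE])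
  then have xs: "invariant_mean K d (H i) \<delta> (xs i)" if "i \<le> M" for i using that by blast
  have HK: "H i \<subseteq> carrier K" if "i \<le> M" for i by (rule subgroup.subset[OF H(1)[OF that]])
  \<comment> \<open>The representative is chosen from the stage i and the element b alone, before
    any z or f appears.\<close>
  have "\<forall>p. \<exists>u. fst p < M \<and> snd p \<in> H (Suc (fst p)) \<longrightarrow>
      u \<in> carrier K \<and> d \<one> u \<le> \<rho> (fst p) \<and> (\<exists>a\<in>H (fst p). snd p = a \<otimes> u)"
  proof
    fix p :: "nat \<times> 'a"
    show "\<exists>u. fst p < M \<and> snd p \<in> H (Suc (fst p)) \<longrightarrow>
      u \<in> carrier K \<and> d \<one> u \<le> \<rho> (fst p) \<and> (\<exists>a\<in>H (fst p). snd p = a \<otimes> u)"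
    proof (cases "fst p < M \<and> snd p \<in> H (Suc (fst p))")
      case True
      then have "fst p \<le> M" "Suc (fst p) \<le> M" by simp_all
      from coset_representative_near_one[OF H(1)[OF this(1)] H(1)[OF this(2)] \<rho>, of "snd p"] True
      show ?thesis by blast
    qed blast
  qed
  then obtain u where u: "\<forall>p. fst p < M \<and> snd p \<in> H (Suc (fst p)) \<longrightarrow>
      u p \<in> carrier K \<and> d \<one> (u p) \<le> \<rho> (fst p) \<and> (\<exists>a\<in>H (fst p). snd p = a \<otimes> u p)"
    by (rule choice[THEN exE])
  have u1: "u (i, b) \<in> carrier K" "d \<one> (u (i, b)) \<le> \<rho> i" "\<exists>a\<in>H i. b = a \<otimes> u (i, b)"
    if "i < M" "b \<in> H (Suc i)" for i b
    using u[rule_format, of "(i, b)"] that by simp_all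
  have \<rho>0: "0 \<le> \<rho> i" if i: "i < M" for i
  proof -
    have "\<one> \<in> H (Suc i)" by (rule subgroup.one_closed[OF H(1)]) (use i in simp)
    from u1(2)[OF i this] show ?thesis using nonneg[of \<one> "u (i, \<one>)"] by linarith
  qed
  define V where "V i b z = total_variation m (translate K (u (i, b)) (\<Phi> z)) (\<Phi> z)" for i b z
  \<comment> \<open>This bounds the Wasserstein distance at z. The leading 2 \<delta> is the error
    at the top of the chain, and each summand belongs to one link.\<close>
  define X where "X z = 2 * \<delta> + (\<Sum>i<M. 4 * \<delta> + 2 * (\<rho> i + 2 * \<delta>) * mean (xs (Suc i)) (\<lambda>b. V i b z))" for z
  have xsH: "b \<in> H (Suc i)" if "b \<in> set (xs (Suc i))" "i < M" for i b
    using invariant_meanD(2)[OF xs[of "Suc i"]] that by auto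
  have V_int: "integrable \<zeta> (V i b)" and V_le: "(\<integral>z. V i b z \<partial>\<zeta>) \<le> \<epsilon>"
    if "b \<in> set (xs (Suc i))" "i < M" for i b
  proof -
    note b = xsH[OF that]
    have "d \<one> (u (i, b)) \<le> r" using u1(2)[OF that(2) b] \<rho>r[OF that(2)] by linarith
    note k = kernel_total_variation[OF ker v \<epsilon> u1(1)[OF that(2) b] this]
    show "integrable \<zeta> (V i b)" using k(1) unfolding V_def[abs_def] .
    show "(\<integral>z. V i b z \<partial>\<zeta>) \<le> \<epsilon>" using k(2) unfolding V_def .
  qed
  have V0: "0 \<le> mean (xs (Suc i)) (\<lambda>b. V i b z)" for i z
    unfolding mean_def V_def by (intro divide_nonneg_nonneg sum_nonneg total_variation_nonneg) simp
  have main: "\<bar>(\<integral>y. f y * \<Phi> z y \<partial>m) - (\<integral>y. f y \<partial>m)\<bar> \<le> X z"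
    if z: "z \<in> space \<zeta>" and f: "f \<in> lipschitz1 (carrier K) d" for z f
  proof -
    have \<phi>: "\<Phi> z \<in> densities m" using ker z by (simp add: measurable_kernel_def)
    define I where "I i = (\<integral>y. left_average (xs i) f y * \<Phi> z y \<partial>m)" for i
    have step: "\<bar>I i - I (Suc i)\<bar> \<le> 4 * \<delta> + 2 * (\<rho> i + 2 * \<delta>) * mean (xs (Suc i)) (\<lambda>b. V i b z)"
      if i: "i < M" for i
      unfolding I_def V_def
    proof (rule left_average_difference_integral[where A = "H i" and B = "H (Suc i)" and u = "\<lambda>b. u (i, b)"])
      show "subgroup (H i) K" "H (Suc i) \<subseteq> carrier K" "H i \<subseteq> H (Suc i)"
        "invariant_mean K d (H i) \<delta> (xs i)" "invariant_mean K d (H (Suc i)) \<delta> (xs (Suc i))"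
        using i H(1) HK mono xs by simp_all
      fix b assume b: "b \<in> H (Suc i)"
      show "\<exists>a\<in>H i. d \<one> (b \<otimes> a) \<le> \<rho> i" by (rule \<rho>[OF i b])
      show "u (i, b) \<in> carrier K" by (rule u1(1)[OF i b])
      show "\<exists>a\<in>H i. b = a \<otimes> u (i, b)" by (rule u1(3)[OF i b])
    qed (rule f \<phi>)+
    have "\<bar>I 0 - I M\<bar> = \<bar>\<Sum>i<M. I i - I (Suc i)\<bar>" by (simp add: sum_lessThan_telescope')
    also have "\<dots> \<le> (\<Sum>i<M. \<bar>I i - I (Suc i)\<bar>)" by (rule sum_abs)
    also have "\<dots> \<le> (\<Sum>i<M. 4 * \<delta> + 2 * (\<rho> i + 2 * \<delta>) * mean (xs (Suc i)) (\<lambda>b. V i b z))"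
      by (rule sum_mono) (rule step, simp)
    finally have tele: "\<bar>I 0 - I M\<bar> \<le> (\<Sum>i<M. 4 * \<delta> + 2 * (\<rho> i + 2 * \<delta>) * mean (xs (Suc i)) (\<lambda>b. V i b z))" .
    have I0: "I 0 = (\<integral>y. f y * \<Phi> z y \<partial>m)"
      unfolding I_def
    proof (rule Bochner_Integration.integral_cong[OF refl])
      fix y assume "y \<in> space m"
      then have y: "y \<in> carrier K" by (simp add: space_haar)
      have "left_average (xs 0) f y = mean (xs 0) (\<lambda>_. f y)"
        unfolding left_average_def
      proof (rule mean_cong)
        fix k assume "k \<in> set (xs 0)"
        then have "k = \<one>" using invariant_meanD(2)[OF xs[of 0]] H0 by auto
        then show "f (k \<otimes> y) = f y" using y by simp
      qed
      then show "left_average (xs 0) f y * \<Phi> z y = f y * \<Phi> z y"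
        by (simp add: mean_const[OF invariant_meanD(1)[OF xs[of 0]]])
    qed
    have f_int: "integrable m f" by (rule lipschitz1_integrable[OF f prob_space_axioms refl])
    have xsM: "set (xs M) \<subseteq> carrier K" by (rule order_trans[OF invariant_meanD(2)[OF xs[OF order_refl]] HK[OF order_refl]])
    let ?F = "left_average (xs M) f"
    have close: "\<bar>?F y - mean (xs M) f\<bar> \<le> \<delta>" if "y \<in> carrier K" for y
      unfolding left_average_def
      by (rule invariant_meanD(4)[OF xs[OF order_refl, unfolded HM] f that])
    have F_meas: "?F \<in> borel_measurable m" by (rule left_average_measurable[OF f xsM])
    \<comment> \<open>Used for the density \<open>\<Phi> z\<close> and for the constant density 1:
      both integrals lie within \<delta> of the same number, which gives the 2 \<delta> in
      \<open>X\<close>.\<close>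
    have close_int: "\<bar>(\<integral>y. ?F y * \<psi> y \<partial>m) - mean (xs M) f\<bar> \<le> \<delta>" if \<psi>: "\<psi> \<in> densities m" for \<psi>
    proof -
      have int: "integrable m (\<lambda>y. (?F y - mean (xs M) f) * \<psi> y)"
        by (rule integrable_bounded_mult_density[OF \<psi> _ close]) (use F_meas in simp_all)
      have \<psi>i: "integrable m (\<lambda>y. mean (xs M) f * \<psi> y)" "(\<integral>y. \<psi> y \<partial>m) = 1"
        using \<psi> by (simp_all add: densities_def)
      have "(\<integral>y. ?F y * \<psi> y \<partial>m) = (\<integral>y. (?F y - mean (xs M) f) * \<psi> y + mean (xs M) f * \<psi> y \<partial>m)"
        by (rule Bochner_Integration.integral_cong) (simp_all add: left_diff_distrib)
      also have "\<dots> = (\<integral>y. (?F y - mean (xs M) f) * \<psi> y \<partial>m) + mean (xs M) f"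
        using int \<psi>i by simp
      finally have "(\<integral>y. ?F y * \<psi> y \<partial>m) - mean (xs M) f = (\<integral>y. (?F y - mean (xs M) f) * \<psi> y \<partial>m)" by simp
      moreover have "\<bar>\<integral>y. (?F y - mean (xs M) f) * \<psi> y \<partial>m\<bar> \<le> \<delta>"
        by (rule integral_bounded_mult_density_le[OF \<psi> _ close]) (use F_meas in simp_all)
      ultimately show ?thesis by simp
    qed
    \<comment> \<open>Left-invariance of \<open>m\<close> makes the integral of the averaged
      function equal to that of f exactly.\<close>
    have "(\<integral>y. ?F y \<partial>m) = mean (xs M) (\<lambda>k. \<integral>y. f (k \<otimes> y) \<partial>m)"
      unfolding left_average_def
    proof (rule integral_mean)
      fix k assume "k \<in> set (xs M)"
      then have k: "k \<in> carrier K" using xsM by blast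
      show "integrable m (\<lambda>y. f (k \<otimes> y))"
        using translate_integrable[OF f_int inv_closed[OF k]] k by (simp add: translate_def)
    qed
    also have "\<dots> = mean (xs M) (\<lambda>_. \<integral>y. f y \<partial>m)"
    proof (rule mean_cong)
      fix k assume "k \<in> set (xs M)"
      then have k: "k \<in> carrier K" using xsM by blast
      show "(\<integral>y. f (k \<otimes> y) \<partial>m) = (\<integral>y. f y \<partial>m)"
        using integral_left_translate[OF inv_closed[OF k] lipschitz1_measurable[OF f]] k by simp
    qed
    also have "\<dots> = (\<integral>y. f y \<partial>m)" by (rule mean_const[OF invariant_meanD(1)[OF xs[OF order_refl]]])
    finally have mean_eq: "(\<integral>y. ?F y \<partial>m) = (\<integral>y. f y \<partial>m)" .
    have "(\<lambda>_. 1) \<in> densities m" by (simp add: densities_def prob_space)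
    from close_int[OF this] have "\<bar>(\<integral>y. f y \<partial>m) - mean (xs M) f\<bar> \<le> \<delta>" by (simp add: mean_eq)
    moreover have "\<bar>I M - mean (xs M) f\<bar> \<le> \<delta>" unfolding I_def by (rule close_int[OF \<phi>])
    ultimately show ?thesis using tele unfolding X_def I0 by linarith
  qed
  have m_int: "integrable \<zeta> (\<lambda>z. mean (xs (Suc i)) (\<lambda>b. V i b z))" if "i < M" for i
    unfolding mean_def
    by (rule integrable_divide, rule Bochner_Integration.integrable_sum) (use V_int that in simp)
  have s_int: "integrable \<zeta> (\<lambda>z. 4 * \<delta> + 2 * (\<rho> i + 2 * \<delta>) * mean (xs (Suc i)) (\<lambda>b. V i b z))"
    if "i < M" for i
    by (rule Bochner_Integration.integrable_add[OF \<zeta>.integrable_const integrable_mult_right[OF m_int[OF that]]])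
  have S_int: "integrable \<zeta> (\<lambda>z. \<Sum>i<M. 4 * \<delta> + 2 * (\<rho> i + 2 * \<delta>) * mean (xs (Suc i)) (\<lambda>b. V i b z))"
    by (rule Bochner_Integration.integrable_sum) (rule s_int, simp)
  have X_int: "integrable \<zeta> X"
    unfolding X_def[abs_def] by (rule Bochner_Integration.integrable_add[OF \<zeta>.integrable_const S_int])
  have X_le: "(\<integral>z. X z \<partial>\<zeta>) \<le> 2 * \<delta> + (\<Sum>i<M. 4 * \<delta> + 2 * (\<rho> i + 2 * \<delta>) * \<epsilon>)"
  proof -
    have m_le: "(\<integral>z. mean (xs (Suc i)) (\<lambda>b. V i b z) \<partial>\<zeta>) \<le> \<epsilon>" if i: "i < M" for i
    proof -
      have ne: "xs (Suc i) \<noteq> []" by (rule invariant_meanD(1)[OF xs]) (use i in simp)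
      have "(\<integral>z. mean (xs (Suc i)) (\<lambda>b. V i b z) \<partial>\<zeta>) = mean (xs (Suc i)) (\<lambda>b. \<integral>z. V i b z \<partial>\<zeta>)"
      proof -
        have "(\<integral>z. (\<Sum>j<length (xs (Suc i)). V i (xs (Suc i) ! j) z) \<partial>\<zeta>) =
            (\<Sum>j<length (xs (Suc i)). \<integral>z. V i (xs (Suc i) ! j) z \<partial>\<zeta>)"
          by (rule Bochner_Integration.integral_sum) (use V_int i in simp)
        then show ?thesis unfolding mean_def by simp
      qed
      also have "\<dots> \<le> mean (xs (Suc i)) (\<lambda>_. \<epsilon>)" by (rule mean_mono) (rule V_le[OF _ i])
      finally show ?thesis by (simp add: mean_const[OF ne])
    qed
    have "(\<integral>z. X z \<partial>\<zeta>) = 2 * \<delta> + (\<Sum>i<M. 4 * \<delta> + 2 * (\<rho> i + 2 * \<delta>) * (\<integral>z. mean (xs (Suc i)) (\<lambda>b. V i b z) \<partial>\<zeta>))"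
    proof -
      have "(\<integral>z. X z \<partial>\<zeta>) = (\<integral>z. 2 * \<delta> \<partial>\<zeta>) +
          (\<integral>z. (\<Sum>i<M. 4 * \<delta> + 2 * (\<rho> i + 2 * \<delta>) * mean (xs (Suc i)) (\<lambda>b. V i b z)) \<partial>\<zeta>)"
        unfolding X_def by (rule Bochner_Integration.integral_add[OF \<zeta>.integrable_const S_int])
      also have "(\<integral>z. (\<Sum>i<M. 4 * \<delta> + 2 * (\<rho> i + 2 * \<delta>) * mean (xs (Suc i)) (\<lambda>b. V i b z)) \<partial>\<zeta>) =
          (\<Sum>i<M. \<integral>z. 4 * \<delta> + 2 * (\<rho> i + 2 * \<delta>) * mean (xs (Suc i)) (\<lambda>b. V i b z) \<partial>\<zeta>)"
        by (rule Bochner_Integration.integral_sum) (rule s_int, simp)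
      also have "\<dots> = (\<Sum>i<M. 4 * \<delta> + 2 * (\<rho> i + 2 * \<delta>) * (\<integral>z. mean (xs (Suc i)) (\<lambda>b. V i b z) \<partial>\<zeta>))"
      proof (rule sum.cong[OF refl])
        fix i assume "i \<in> {..<M}"
        then have i: "i < M" by simp
        have "(\<integral>z. 4 * \<delta> + 2 * (\<rho> i + 2 * \<delta>) * mean (xs (Suc i)) (\<lambda>b. V i b z) \<partial>\<zeta>) =
            (\<integral>z. 4 * \<delta> \<partial>\<zeta>) + (\<integral>z. 2 * (\<rho> i + 2 * \<delta>) * mean (xs (Suc i)) (\<lambda>b. V i b z) \<partial>\<zeta>)"
          by (rule Bochner_Integration.integral_add[OF \<zeta>.integrable_const integrable_mult_right[OF m_int[OF i]]])
        then show "(\<integral>z. 4 * \<delta> + 2 * (\<rho> i + 2 * \<delta>) * mean (xs (Suc i)) (\<lambda>b. V i b z) \<partial>\<zeta>) =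
            4 * \<delta> + 2 * (\<rho> i + 2 * \<delta>) * (\<integral>z. mean (xs (Suc i)) (\<lambda>b. V i b z) \<partial>\<zeta>)"
          by (simp add: \<zeta>.prob_space)
      qed
      finally show ?thesis by (simp add: \<zeta>.prob_space)
    qed
    also have "\<dots> \<le> 2 * \<delta> + (\<Sum>i<M. 4 * \<delta> + 2 * (\<rho> i + 2 * \<delta>) * \<epsilon>)"
      using m_le \<rho>0 \<delta> by (intro add_left_mono sum_mono mult_left_mono) auto
    finally show ?thesis .
  qed
  have X0: "0 \<le> X z" for z
    unfolding X_def using \<rho>0 \<delta> V0 by (intro add_nonneg_nonneg sum_nonneg mult_nonneg_nonneg) auto
  have "kernel_w K d m \<zeta> \<Phi> \<le> (\<integral>\<^sup>+z. ennreal (X z) \<partial>\<zeta>)"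
    unfolding kernel_w_def
  proof (rule nn_integral_mono)
    fix z assume z: "z \<in> space \<zeta>"
    have \<phi>: "\<Phi> z \<in> densities m" using ker z by (simp add: measurable_kernel_def)
    show "wasserstein (carrier K) d (density m (\<lambda>g. ennreal (\<Phi> z g))) m \<le> ennreal (X z)"
      unfolding wasserstein_def
    proof (rule SUP_least)
      fix f assume f: "f \<in> lipschitz1 (carrier K) d"
      have "(\<integral>y. f y \<partial>density m (\<lambda>g. ennreal (\<Phi> z g))) = (\<integral>y. \<Phi> z y * f y \<partial>m)"
        using \<phi> by (intro integral_real_density lipschitz1_measurable[OF f]) (auto simp: densities_def)
      then show "ennreal \<bar>(\<integral>x. f x \<partial>density m (\<lambda>g. ennreal (\<Phi> z g))) - (\<integral>x. f x \<partial>m)\<bar> \<le> ennreal (X z)"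
        using main[OF z f] by (intro ennreal_leI) (simp add: mult.commute)
    qed
  qed
  also have "\<dots> = ennreal (\<integral>z. X z \<partial>\<zeta>)" by (rule nn_integral_eq_integral[OF X_int AE_I2[OF X0]])
  also have "\<dots> \<le> ennreal (2 * \<delta> + (\<Sum>i<M. 4 * \<delta> + 2 * (\<rho> i + 2 * \<delta>) * \<epsilon>))" by (rule ennreal_leI[OF X_le])
  finally show ?thesis .
qed

text \<open>The error of the finite means is chosen after \<open>M\<close>, so the terms
  proportional to the length of the chain disappear in the limit and only the sum of the radii
  remains.\<close>

lemma wasserstein_modulus_chain_bound:
  fixes H :: "nat \<Rightarrow> 'a set"
  assumes H: "\<And>i. i \<le> M \<Longrightarrow> subgroup (H i) K" "\<And>i. i \<le> M \<Longrightarrow> compactin mtopology (H i)"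
    and H0: "H 0 = {\<one>}" and HM: "H M = carrier K"
    and mono: "\<And>i. i < M \<Longrightarrow> H i \<subseteq> H (Suc i)"
    and \<rho>: "\<And>i b. i < M \<Longrightarrow> b \<in> H (Suc i) \<Longrightarrow> \<exists>a\<in>H i. d \<one> (b \<otimes> a) \<le> \<rho> i"
    and \<rho>r: "\<And>i. i < M \<Longrightarrow> \<rho> i \<le> r" and \<epsilon>: "0 \<le> \<epsilon>"
  shows "wasserstein_modulus K d m r \<epsilon> \<le> ennreal (2 * (\<Sum>i<M. \<rho> i) * \<epsilon>)"
  unfolding wasserstein_modulus_def
proof (rule SUP_least)
  fix p :: "(nat \<Rightarrow> bool) measure \<times> ((nat \<Rightarrow> bool) \<Rightarrow> 'a \<Rightarrow> real)"
  obtain \<zeta> \<Phi> where p: "p = (\<zeta>, \<Phi>)" by (cases p)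
  assume "p \<in> {(\<zeta>, \<Phi>). measurable_kernel m \<zeta> \<Phi> \<and> kernel_v K d m \<zeta> \<Phi> r \<le> ennreal \<epsilon>}"
  then have ker: "measurable_kernel m \<zeta> \<Phi>" and v: "kernel_v K d m \<zeta> \<Phi> r \<le> ennreal \<epsilon>"
    unfolding p by simp_all
  have "kernel_w K d m \<zeta> \<Phi> \<le> ennreal (2 * (\<Sum>i<M. \<rho> i) * \<epsilon>)"
  proof (rule ennreal_le_epsilon)
    fix e :: real assume e: "0 < e"
    \<comment> \<open>All terms with \<delta> add up to \<delta> \<open>c\<close>: 2 from the top of
      the chain, and 4 + 4 \<epsilon> from each of the \<open>M\<close> links.\<close>
    define c where "c = 2 + 4 * M + 4 * M * \<epsilon>"
    have c: "0 < c" using \<epsilon> by (simp add: c_def add_pos_nonneg)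
    define \<delta> where "\<delta> = e / c"
    have \<delta>: "0 < \<delta>" using e c by (simp add: \<delta>_def)
    have "(\<Sum>i<M. 4 * \<delta> + 2 * (\<rho> i + 2 * \<delta>) * \<epsilon>) = (\<Sum>i<M. 2 * \<epsilon> * \<rho> i) + M * (4 * \<delta> + 4 * \<delta> * \<epsilon>)"
      by (simp add: sum.distrib algebra_simps)
    also have "\<dots> = 2 * (\<Sum>i<M. \<rho> i) * \<epsilon> + M * (4 * \<delta> + 4 * \<delta> * \<epsilon>)"
      by (simp add: sum_distrib_left[symmetric])
    finally have "2 * \<delta> + (\<Sum>i<M. 4 * \<delta> + 2 * (\<rho> i + 2 * \<delta>) * \<epsilon>) = 2 * (\<Sum>i<M. \<rho> i) * \<epsilon> + \<delta> * c"
      by (simp add: c_def algebra_simps)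
    also have "\<delta> * c = e" using c by (simp add: \<delta>_def)
    finally have eq: "2 * \<delta> + (\<Sum>i<M. 4 * \<delta> + 2 * (\<rho> i + 2 * \<delta>) * \<epsilon>) = 2 * (\<Sum>i<M. \<rho> i) * \<epsilon> + e" .
    have "kernel_w K d m \<zeta> \<Phi> \<le> ennreal (2 * \<delta> + (\<Sum>i<M. 4 * \<delta> + 2 * (\<rho> i + 2 * \<delta>) * \<epsilon>))"
      by (rule kernel_w_chain_bound[where H = H and r = r, OF H H0 HM mono \<rho> \<rho>r \<epsilon> \<delta> ker v])
    also have "\<dots> \<le> ennreal (2 * (\<Sum>i<M. \<rho> i) * \<epsilon>) + ennreal e"
      unfolding eq using e by (simp add: ennreal_plus_if)
    finally show "kernel_w K d m \<zeta> \<Phi> \<le> ennreal (2 * (\<Sum>i<M. \<rho> i) * \<epsilon>) + ennreal e" .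
  qed
  then show "(case p of (\<zeta>, \<Phi>) \<Rightarrow> kernel_w K d m \<zeta> \<Phi>) \<le> ennreal (2 * (\<Sum>i<M. \<rho> i) * \<epsilon>)"
    unfolding p by simp
qed

section \<open>Concentration of measure\<close>

lemma concentration_function_nonneg: "0 \<le> concentration_function K d m e"
proof -
  have "(INF A\<in>{A \<in> sets m. 1/2 \<le> measure m A}. measure m (\<Union>a\<in>A. mball a e))
      \<le> measure m (\<Union>a\<in>space m. mball a e)"
    by (rule cINF_lower) (auto intro!: bdd_belowI[of _ 0] simp: prob_space)
  also have "\<dots> \<le> 1" by (rule prob_le_1)
  finally show ?thesis by (simp add: concentration_function_def)
qed

text \<open>If the complement \<open>B\<close> of the \<open>e\<close>-neighbourhood of \<open>A\<close> is not small, then the density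
  proportional to the Lipschitz function \<open>q\<close>, which is positive only far away from \<open>A\<close>, is almost
  invariant under small translations, but its Wasserstein distance to \<open>m\<close> is at least \<open>e / 6\<close>.\<close>

lemma concentration_function_le:
  assumes e: "0 < e" and \<eta>: "0 < \<eta>" and r: "0 < r"
    and small: "wasserstein_modulus K d m r (3 * r / (2 * e * \<eta>)) < ennreal (e / 6)"
  shows "concentration_function K d m e \<le> \<eta>"
proof -
  have "1 - \<eta> \<le> measure m (\<Union>a\<in>A. mball a e)" if A: "A \<in> sets m" "1/2 \<le> measure m A" for A
  proof (rule ccontr)
    assume "\<not> 1 - \<eta> \<le> measure m (\<Union>a\<in>A. mball a e)"
    then have less: "measure m (\<Union>a\<in>A. mball a e) < 1 - \<eta>" by simp
    have AK: "A \<subseteq> carrier K" using sets.sets_into_space[OF A(1)] by (simp add: space_haar)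
    define N where "N = (\<Union>a\<in>A. mball a e)"
    have N: "N \<in> sets m" unfolding N_def by (intro openin_sets_haar openin_Union) auto
    define B where "B = space m - N"
    have B: "B \<in> sets m" "\<eta> < measure m B"
      using N less prob_compl[OF N] by (simp_all add: B_def N_def[symmetric])
    define g where "g = truncated_distance e A"
    have g: "g \<in> lipschitz1 (carrier K) d" unfolding g_def by (rule truncated_distance_lipschitz1[OF AK])
    have g_le: "g x \<le> e" for x unfolding g_def by (rule truncated_distance_le)
    have g0: "0 \<le> g x" for x unfolding g_def using e by (intro truncated_distance_nonneg) simp
    have gA: "g x = 0" if "x \<in> A" for x
      unfolding g_def using e that AK by (intro truncated_distance_eq_0) auto
    have gB: "g x = e" if "x \<in> B" for x
    proof (rule antisym[OF g_le])
      show "e \<le> g x" unfolding g_def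
      proof (rule truncated_distance_ge[OF order_refl])
        fix a assume a: "a \<in> A"
        then have "x \<notin> mball a e" "x \<in> carrier K" using that by (auto simp: B_def N_def space_haar)
        then show "e \<le> d x a" using a AK commute[of x a] by (auto simp: not_less)
      qed
    qed
    \<comment> \<open>The level 2 e / 3 lies between e / 2, which bounds the mean of g because
      \<open>A\<close> has measure at least 1/2, and the value e of g on \<open>B\<close>. Where q
      is positive, g is at least 2 e / 3, which leaves the gap 2 e / 3 - e / 2 = e / 6; on
      \<open>B\<close> the value of q is e / 3.\<close>
    define q where "q x = max 0 (g x - 2 * e / 3)" for x
    have q0: "0 \<le> q x" for x by (simp add: q_def)
    have q_le: "\<bar>q x\<bar> \<le> e" for x using g_le[of x] e by (simp add: q_def)
    have q: "q \<in> lipschitz1 (carrier K) d"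
      unfolding lipschitz1_def
    proof (intro CollectI ballI)
      fix x y assume "x \<in> carrier K" "y \<in> carrier K"
      from lipschitz1D[OF g this] show "\<bar>q x - q y\<bar> \<le> d x y" unfolding q_def by linarith
    qed
    have int: "integrable m f" if "f \<in> lipschitz1 (carrier K) d" for f
      by (rule lipschitz1_integrable[OF that prob_space_axioms refl])
    define s where "s = (\<integral>x. q x \<partial>m)"
    have s: "e / 3 * \<eta> < s"
    proof -
      have "e / 3 * \<eta> < e / 3 * measure m B" using B(2) e by simp
      also have "\<dots> = (\<integral>x. e / 3 * indicator B x \<partial>m)" using B(1) by simp
      also have "\<dots> \<le> s"
        unfolding s_def
      proof (rule integral_mono[OF _ int[OF q]])
        show "integrable m (\<lambda>x. e / 3 * indicator B x)"
          using B(1) by (intro integrable_mult_right integrable_real_indicator) (simp_all add: emeasure_eq_measure)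
        show "e / 3 * indicator B x \<le> q x" for x
          using gB[of x] q0[of x] by (auto simp: q_def indicator_def)
      qed
      finally show ?thesis .
    qed
    have s0: "0 < s" using s e \<eta> by (meson less_trans mult_pos_pos zero_less_divide_iff zero_less_numeral)
    define \<phi> where "\<phi> x = q x / s" for x
    have \<phi>: "\<phi> \<in> densities m"
      unfolding densities_def \<phi>_def using int[OF q] q0 s0 by (simp add: s_def[symmetric])
    have \<phi>_meas: "\<phi> \<in> borel_measurable m" using \<phi> by (auto simp: densities_def)
    \<comment> \<open>A constant kernel, indexed by the group with its Haar measure;
      \<open>kernel_w_le_modulus\<close> compares it with the modulus, whose index spaces have
      another type.\<close>
    have ker: "measurable_kernel m m (\<lambda>_. \<phi>)"
      unfolding measurable_kernel_def case_prod_unfold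
      using \<phi> prob_space_axioms measurable_compose[OF measurable_snd \<phi>_meas] by blast
    \<comment> \<open>Translation by h changes the 1-Lipschitz function q by at most d(h^{-1}, e) =
      d(e, h), hence by at most \<open>r\<close>. Half of r / s together with s > e \<eta> / 3 gives
      the constant.\<close>
    have tv: "total_variation m (translate K h \<phi>) \<phi> \<le> 3 * r / (2 * e * \<eta>)"
      if h: "h \<in> carrier K" "d \<one> h \<le> r" for h
    proof -
      have t_int: "integrable m (translate K h \<phi>)"
        using \<phi> by (intro translate_integrable h) (simp add: densities_def)
      have "(\<integral>x. \<bar>translate K h \<phi> x - \<phi> x\<bar> \<partial>m) \<le> (\<integral>x. r / s \<partial>m)"
      proof (rule integral_mono)
        show "integrable m (\<lambda>x. \<bar>translate K h \<phi> x - \<phi> x\<bar>)"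
          using t_int \<phi> by (simp add: densities_def)
        fix x assume "x \<in> space m"
        then have x: "x \<in> carrier K" by (simp add: space_haar)
        have "\<bar>q (inv h \<otimes> x) - q (\<one> \<otimes> x)\<bar> \<le> d (inv h \<otimes> x) (\<one> \<otimes> x)"
          by (rule lipschitz1D[OF q]) (use x h in simp_all)
        also have "\<dots> = d (inv h) \<one>" by (rule right_invariant) (use x h in simp_all)
        also have "\<dots> = d (inv h \<otimes> h) (\<one> \<otimes> h)" by (rule right_invariant[symmetric]) (use h in simp_all)
        also have "\<dots> \<le> r" using h by simp
        finally have "\<bar>q (inv h \<otimes> x) - q x\<bar> \<le> r" using x by simp
        then have "\<bar>q (inv h \<otimes> x) - q x\<bar> / s \<le> r / s" using s0 by (intro divide_right_mono) simp_all
        then show "\<bar>translate K h \<phi> x - \<phi> x\<bar> \<le> r / s"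
          using s0 unfolding translate_def \<phi>_def diff_divide_distrib[symmetric] by simp
      qed simp
      also have "\<dots> = r / s" by (simp add: prob_space)
      also have "\<dots> \<le> r / (e / 3 * \<eta>)"
        using s r e \<eta> s0 by (intro divide_left_mono) auto
      finally show ?thesis using e \<eta> by (simp add: total_variation_def field_simps)
    qed
    have "kernel_v K d m m (\<lambda>_. \<phi>) r \<le> ennreal (3 * r / (2 * e * \<eta>))"
      unfolding kernel_v_def
    proof (rule SUP_least)
      fix h assume "h \<in> {h \<in> carrier K. d \<one> h \<le> r}"
      then have "ennreal (total_variation m (translate K h \<phi>) \<phi>) \<le> ennreal (3 * r / (2 * e * \<eta>))"
        by (intro ennreal_leI tv) simp_all
      then show "(\<integral>\<^sup>+z. ennreal (total_variation m (translate K h \<phi>) \<phi>) \<partial>m) \<le> ennreal (3 * r / (2 * e * \<eta>))"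
        by (simp add: emeasure_space_1)
    qed
    from kernel_w_le_modulus[OF ker this]
    have "wasserstein (carrier K) d (density m (\<lambda>g. ennreal (\<phi> g))) m
        \<le> wasserstein_modulus K d m r (3 * r / (2 * e * \<eta>))"
      by (simp add: kernel_w_def emeasure_space_1)
    moreover have "ennreal (e / 6) \<le> wasserstein (carrier K) d (density m (\<lambda>g. ennreal (\<phi> g))) m"
      unfolding wasserstein_def
    proof (rule SUP_upper2[OF g], rule ennreal_leI)
      have g\<phi>: "integrable m (\<lambda>x. g x * \<phi> x)"
        by (rule integrable_bounded_mult_density[OF \<phi> lipschitz1_measurable[OF g], of e]) (use g_le g0 in simp)
      have "(\<integral>x. g x \<partial>density m (\<lambda>x. ennreal (\<phi> x))) = (\<integral>x. \<phi> x * g x \<partial>m)"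
        using \<phi> by (intro integral_real_density lipschitz1_measurable[OF g]) (auto simp: densities_def)
      also have "\<dots> = (\<integral>x. g x * \<phi> x \<partial>m)" by (simp add: mult.commute)
      also have "\<dots> \<ge> (\<integral>x. 2 * e / 3 * \<phi> x \<partial>m)"
      proof (rule integral_mono[OF _ g\<phi>])
        show "integrable m (\<lambda>x. 2 * e / 3 * \<phi> x)" using \<phi> by (simp add: densities_def)
        show "2 * e / 3 * \<phi> x \<le> g x * \<phi> x" for x
        proof (cases "2 * e / 3 \<le> g x")
          case True
          then show ?thesis using q0[of x] s0 by (intro mult_right_mono) (simp_all add: \<phi>_def)
        next
          case False
          then show ?thesis by (simp add: \<phi>_def q_def)
        qed
      qed
      also have "(\<integral>x. 2 * e / 3 * \<phi> x \<partial>m) = 2 * e / 3" using \<phi> by (simp add: densities_def)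
      finally have 1: "2 * e / 3 \<le> (\<integral>x. g x \<partial>density m (\<lambda>x. ennreal (\<phi> x)))" .
      have compl: "space m - A \<in> sets m" using A(1) by simp
      have "(\<integral>x. g x \<partial>m) \<le> (\<integral>x. e * indicator (space m - A) x \<partial>m)"
      proof (rule integral_mono[OF int[OF g]])
        show "integrable m (\<lambda>x. e * indicator (space m - A) x)"
          using compl by (intro integrable_mult_right integrable_real_indicator) (simp_all add: emeasure_eq_measure)
        show "g x \<le> e * indicator (space m - A) x" if "x \<in> space m" for x
          using that g_le[of x] gA[of x] by (auto simp: indicator_def)
      qed
      also have "\<dots> = e * measure m (space m - A)" using compl by simp
      also have "\<dots> \<le> e * (1 / 2)"
        using e A by (intro mult_left_mono) (simp_all add: prob_compl)
      finally have 2: "(\<integral>x. g x \<partial>m) \<le> e / 2" by simp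
      show "e / 6 \<le> \<bar>(\<integral>x. g x \<partial>density m (\<lambda>g. ennreal (\<phi> g))) - (\<integral>x. g x \<partial>m)\<bar>"
        using 1 2 by linarith
    qed
    ultimately have "ennreal (e / 6) \<le> wasserstein_modulus K d m r (3 * r / (2 * e * \<eta>))" by (rule order_trans[rotated])
    with small show False by simp
  qed
  moreover have "space m \<in> {A \<in> sets m. 1/2 \<le> measure m A}" by (simp add: prob_space)
  ultimately have "1 - \<eta> \<le> (INF A\<in>{A \<in> sets m. 1/2 \<le> measure m A}. measure m (\<Union>a\<in>A. mball a e))"
    by (intro cINF_greatest) auto
  then show ?thesis by (simp add: concentration_function_def)
qed

end

text \<open>For fixed \<open>e\<close> and \<eta> the argument 3 r / (2 e \<eta>) of the modulus in
  \<open>concentration_function_le\<close> tends to 0 along the radii \<open>r n\<close>. It is thus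
  one of the sequences covered by the definition of a Wasserstein family, and the modulus eventually
  drops below e / 6.\<close>

theorem wasserstein_family_imp_levy_family:
  assumes "wasserstein_family K d m"
  shows "levy_family K d m"
proof -
  obtain r where mmg: "\<And>n. measure_metric_group (K n) (d n) (m n)"
    and r: "\<And>n. 0 < r n" "r \<longlonglongrightarrow> 0"
    and mod: "\<And>\<epsilon>. (\<forall>n. 0 < \<epsilon> n) \<Longrightarrow> \<epsilon> \<longlonglongrightarrow> 0 \<Longrightarrow>
      (\<lambda>n. wasserstein_modulus (K n) (d n) (m n) (r n) (\<epsilon> n)) \<longlonglongrightarrow> 0"
    using assms unfolding wasserstein_family_def by blast
  have "(\<lambda>n. concentration_function (K n) (d n) (m n) e) \<longlonglongrightarrow> 0" if e: "0 < e" for e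
  proof (rule tendstoI)
    fix \<eta>' :: real assume \<eta>': "0 < \<eta>'"
    \<comment> \<open>Halving turns the weak inequality for the concentration function into the
      strict one of the limit.\<close>
    define \<eta> where "\<eta> = \<eta>' / 2"
    have \<eta>: "0 < \<eta>" "\<eta> < \<eta>'" using \<eta>' by (simp_all add: \<eta>_def)
    define \<epsilon> where "\<epsilon> n = 3 * r n / (2 * e * \<eta>)" for n
    have \<epsilon>0: "\<forall>n. 0 < \<epsilon> n" unfolding \<epsilon>_def using r(1) e \<eta>(1) by simp
    have "(\<lambda>n. 3 * r n / (2 * e * \<eta>)) \<longlonglongrightarrow> 3 * 0 / (2 * e * \<eta>)"
      by (intro tendsto_divide tendsto_mult tendsto_const r(2)) (use e \<eta>(1) in simp)
    then have "\<epsilon> \<longlonglongrightarrow> 0" unfolding \<epsilon>_def[abs_def] by simp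
    from mod[OF \<epsilon>0 this]
    have "\<forall>\<^sub>F n in sequentially. wasserstein_modulus (K n) (d n) (m n) (r n) (\<epsilon> n) < ennreal (e / 6)"
      by (rule order_tendstoD(2)) (use e in simp)
    then show "\<forall>\<^sub>F n in sequentially. dist (concentration_function (K n) (d n) (m n) e) 0 < \<eta>'"
    proof (rule eventually_mono)
      fix n assume small: "wasserstein_modulus (K n) (d n) (m n) (r n) (\<epsilon> n) < ennreal (e / 6)"
      have "concentration_function (K n) (d n) (m n) e \<le> \<eta>"
        by (rule measure_metric_group.concentration_function_le[OF mmg e \<eta>(1) r(1) small[unfolded \<epsilon>_def]])
      moreover have "0 \<le> concentration_function (K n) (d n) (m n) e"
        by (rule measure_metric_group.concentration_function_nonneg[OF mmg])
      ultimately show "dist (concentration_function (K n) (d n) (m n) e) 0 < \<eta>'"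
        using \<eta>(2) by simp
    qed
  qed
  then show ?thesis unfolding levy_family_def using mmg by blast
qed

text \<open>Unfolds the supremum of infima, with \<eta> as the slack for the infimum. The real
  supremum is meaningful because h = e bounds each inner infimum by d(e, g), and the compact
  \<open>H\<close> is bounded.\<close>

lemma quotient_radius_approximation:
  assumes G: "topological_group G T" and dG: "compatible_right_invariant_metric G T d"
    and H: "subgroup H G" "compactin T H" and H': "subgroup H' G" and g: "g \<in> H" and \<eta>: "0 < \<eta>"
  shows "\<exists>h\<in>H'. d \<one>\<^bsub>G\<^esub> (g \<otimes>\<^bsub>G\<^esub> h) \<le> quotient_radius G d H H' + \<eta>"
proof -
  interpret G: topological_group G T by (rule G)
  interpret D: Metric_space "carrier G" d
    using dG by (simp add: compatible_right_invariant_metric_def)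
  have T: "D.mtopology = T" using dG by (simp add: compatible_right_invariant_metric_def)
  have HG: "x \<in> carrier G" if "x \<in> H" for x by (rule subgroup.mem_carrier[OF H(1) that])
  have one: "\<one>\<^bsub>G\<^esub> \<in> H" "\<one>\<^bsub>G\<^esub> \<in> H'" by (rule subgroup.one_closed[OF H(1)], rule subgroup.one_closed[OF H'])
  have "D.mbounded H" using D.compactin_imp_mbounded H(2) by (simp add: T)
  then obtain C where C: "\<And>x y. x \<in> H \<Longrightarrow> y \<in> H \<Longrightarrow> d x y \<le> C" unfolding D.mbounded_alt by blast
  have bdd: "bdd_below ((\<lambda>h. d \<one>\<^bsub>G\<^esub> (x \<otimes>\<^bsub>G\<^esub> h)) ` H')" for x
    by (rule bdd_belowI[of _ 0]) auto
  have "bdd_above ((\<lambda>x. INF h\<in>H'. d \<one>\<^bsub>G\<^esub> (x \<otimes>\<^bsub>G\<^esub> h)) ` H)"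
  proof (rule bdd_aboveI2)
    fix x assume x: "x \<in> H"
    have "(INF h\<in>H'. d \<one>\<^bsub>G\<^esub> (x \<otimes>\<^bsub>G\<^esub> h)) \<le> d \<one>\<^bsub>G\<^esub> (x \<otimes>\<^bsub>G\<^esub> \<one>\<^bsub>G\<^esub>)" by (rule cINF_lower[OF bdd one(2)])
    also have "\<dots> = d \<one>\<^bsub>G\<^esub> x" using HG[OF x] by simp
    also have "\<dots> \<le> C" by (rule C[OF one(1) x])
    finally show "(INF h\<in>H'. d \<one>\<^bsub>G\<^esub> (x \<otimes>\<^bsub>G\<^esub> h)) \<le> C" .
  qed
  then have "(INF h\<in>H'. d \<one>\<^bsub>G\<^esub> (g \<otimes>\<^bsub>G\<^esub> h)) \<le> quotient_radius G d H H'"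
    unfolding quotient_radius_def by (rule cSUP_upper[OF g])
  then have "(INF h\<in>H'. d \<one>\<^bsub>G\<^esub> (g \<otimes>\<^bsub>G\<^esub> h)) < quotient_radius G d H H' + \<eta>" using \<eta> by linarith
  then have "\<exists>h\<in>H'. d \<one>\<^bsub>G\<^esub> (g \<otimes>\<^bsub>G\<^esub> h) < quotient_radius G d H H' + \<eta>"
    using one(2) by (subst (asm) cINF_less_iff[OF _ bdd]) auto
  then show ?thesis using less_imp_le by blast
qed

text \<open>With radii slightly above the largest quotient radius, the chain bound makes the modulus
  at most a constant times \<epsilon>, with the same constant for all n. The same metric, subgroups
  and Haar measures witness both conclusions.\<close>

theorem theorem2:
  fixes G :: "('a, 'b) monoid_scheme" and T :: "'a topology" and d :: "'a \<Rightarrow> 'a \<Rightarrow> real"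
    and K :: "nat \<Rightarrow> 'a set" and M :: "nat \<Rightarrow> nat" and H :: "nat \<Rightarrow> nat \<Rightarrow> 'a set"
  assumes "polish_group G T"
    and "compatible_right_invariant_metric G T d"
    and "exhausting_compact_subgroups G T K"
    and "\<And>n i. i \<le> M n \<Longrightarrow> subgroup (H n i) G \<and> compactin T (H n i)"
    and "\<And>n. H n 0 = {\<one>\<^bsub>G\<^esub>}"
    and "\<And>n i. i < M n \<Longrightarrow> H n i \<subseteq> H n (Suc i)"
    and "\<And>n. H n (M n) = K n"
    and "bdd_above (range (\<lambda>n. \<Sum>i = 1..M n. quotient_radius G d (H n i) (H n (i - 1))))"
    and "(\<lambda>n. Max (insert 0 ((\<lambda>i. quotient_radius G d (H n i) (H n (i - 1))) ` {1..M n})))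
           \<longlonglongrightarrow> 0"
  shows "wasserstein_group G T \<and> levy_group G T"
proof -
  have tg: "topological_group G T" using assms(1) by (rule polish_group.axioms(1))
  then interpret G: topological_group G T .
  interpret D: Metric_space "carrier G" d
    using assms(2) by (simp add: compatible_right_invariant_metric_def)
  have T: "D.mtopology = T" using assms(2) by (simp add: compatible_right_invariant_metric_def)
  have K: "subgroup (K n) G" "compactin T (K n)" for n
    using assms(3) unfolding exhausting_compact_subgroups_def by blast+
  have cK: "compact_metric_group (G\<lparr>carrier := K n\<rparr>) d" for n
    by (rule subgroup_compact_metric_group[OF tg assms(2) K])
  then have "\<forall>n. \<exists>m. measure_metric_group (G\<lparr>carrier := K n\<rparr>) d m"
    using compact_metric_group.measure_metric_group_exists by blast
  then obtain m where m: "\<forall>n. measure_metric_group (G\<lparr>carrier := K n\<rparr>) d (m n)" by (rule choice[THEN exE])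
  define \<rho> where "\<rho> n i = quotient_radius G d (H n i) (H n (i - 1))" for n i
  define R where "R n = Max (insert 0 (\<rho> n ` {1..M n}))" for n
  have R0: "R \<longlonglongrightarrow> 0" using assms(9) unfolding R_def[abs_def] \<rho>_def .
  obtain C where C0: "\<And>n. (\<Sum>i = 1..M n. \<rho> n i) \<le> C"
    using assms(8) unfolding bdd_above_def \<rho>_def by auto
  then have C: "(\<Sum>i<M n. \<rho> n (Suc i)) \<le> C" for n
    using C0[of n] sum.atLeast1_atMost_eq[of "\<rho> n" "M n"] by simp
  have \<rho>R: "\<rho> n (Suc i) \<le> R n" if "i < M n" for n i
    unfolding R_def using that by (intro Max_ge) auto
  have Rnonneg: "0 \<le> R n" for n
    unfolding R_def by (intro Max_ge) auto
  have HK: "H n i \<subseteq> K n" if "i \<le> M n" for n i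
    using that
  proof (induction rule: inc_induct)
    case base
    show ?case by (simp add: assms(7))
  next
    case (step j)
    then show ?case using assms(6)[of j n] by blast
  qed
  \<comment> \<open>The summand 1 / (n + 1) keeps the radius positive when all quotient radii
    vanish, and leaves room for enlarging each of them by the \<eta> below.\<close>
  define r where "r n = R n + 1 / Suc n" for n
  have r0: "0 < r n" for n unfolding r_def using Rnonneg[of n] by (simp add: add_nonneg_pos)
  have "(\<lambda>n. R n + 1 / Suc n) \<longlonglongrightarrow> 0 + 0"
    by (intro tendsto_add R0 LIMSEQ_Suc[OF lim_1_over_n])
  then have r_lim: "r \<longlonglongrightarrow> 0" unfolding r_def[abs_def] by simp
  have bound: "wasserstein_modulus (G\<lparr>carrier := K n\<rparr>) d (m n) (r n) \<epsilon> \<le> ennreal (2 * (\<bar>C\<bar> + 1) * \<epsilon>)"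
    if \<epsilon>: "0 < \<epsilon>" for n \<epsilon>
  proof -
    interpret Kn: measure_metric_group "G\<lparr>carrier := K n\<rparr>" d "m n" using m by blast
    interpret S: Submetric "carrier G" d "K n" by unfold_locales (rule subgroup.subset[OF K(1)])
    have top: "S.sub.mtopology = subtopology T (K n)" using S.mtopology_submetric T by simp
    \<comment> \<open>The first factor keeps each enlarged radius below \<open>r n\<close>; the
      second keeps the total enlargement over the \<open>M n\<close> links below 1, whence the
      constant \<open>\<bar>C\<bar> + 1\<close>.\<close>
    define \<eta> where "\<eta> = 1 / real (Suc n) * (1 / real (Suc (M n)))"
    have \<eta>: "0 < \<eta>" by (simp add: \<eta>_def)
    have \<eta>1: "\<eta> \<le> 1 / Suc n" unfolding \<eta>_def by (rule mult_left_le) simp_all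
    have "\<eta> \<le> 1 / Suc (M n)" unfolding \<eta>_def by (rule mult_left_le_one_le) simp_all
    then have "M n * \<eta> \<le> M n * (1 / Suc (M n))" by (rule mult_left_mono) simp
    also have "\<dots> \<le> 1" by simp
    finally have \<eta>2: "M n * \<eta> \<le> 1" .
    have "wasserstein_modulus (G\<lparr>carrier := K n\<rparr>) d (m n) (r n) \<epsilon>
        \<le> ennreal (2 * (\<Sum>i<M n. \<rho> n (Suc i) + \<eta>) * \<epsilon>)"
    proof (rule Kn.wasserstein_modulus_chain_bound[where H = "H n"])
      fix i assume i: "i \<le> M n"
      show "subgroup (H n i) (G\<lparr>carrier := K n\<rparr>)"
        using assms(4)[OF i] HK[OF i] by (intro G.subgroup_incl K(1)) simp_all
      show "compactin Kn.mtopology (H n i)"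
        using assms(4)[OF i] HK[OF i] by (simp add: top compactin_subtopology)
    next
      show "H n 0 = {\<one>\<^bsub>G\<lparr>carrier := K n\<rparr>\<^esub>}" "H n (M n) = carrier (G\<lparr>carrier := K n\<rparr>)"
        by (simp_all add: assms(5,7))
      show "0 \<le> \<epsilon>" using \<epsilon> by simp
    next
      fix i assume i: "i < M n"
      show "H n i \<subseteq> H n (Suc i)" by (rule assms(6)[OF i])
      show "\<rho> n (Suc i) + \<eta> \<le> r n" unfolding r_def using \<rho>R[OF i] \<eta>1 by linarith
      fix b assume b: "b \<in> H n (Suc i)"
      have "subgroup (H n (Suc i)) G" "compactin T (H n (Suc i))" "subgroup (H n i) G"
        using assms(4)[of "Suc i" n] assms(4)[of i n] i by simp_all
      from quotient_radius_approximation[OF tg assms(2) this b \<eta>]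
      show "\<exists>a\<in>H n i. d \<one>\<^bsub>G\<lparr>carrier := K n\<rparr>\<^esub> (b \<otimes>\<^bsub>G\<lparr>carrier := K n\<rparr>\<^esub> a) \<le> \<rho> n (Suc i) + \<eta>"
        by (simp add: \<rho>_def)
    qed
    also have "\<dots> \<le> ennreal (2 * (\<bar>C\<bar> + 1) * \<epsilon>)"
    proof (intro ennreal_leI mult_right_mono mult_left_mono)
      have "(\<Sum>i<M n. \<rho> n (Suc i) + \<eta>) = (\<Sum>i<M n. \<rho> n (Suc i)) + M n * \<eta>"
        by (simp add: sum.distrib)
      then show "(\<Sum>i<M n. \<rho> n (Suc i) + \<eta>) \<le> \<bar>C\<bar> + 1" using C[of n] \<eta>2 by linarith
    qed (use \<epsilon> in simp_all)
    finally show ?thesis .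
  qed
  have family: "wasserstein_family (\<lambda>n. G\<lparr>carrier := K n\<rparr>) (\<lambda>n. d) m"
    unfolding wasserstein_family_def
  proof (intro conjI exI[of _ r] allI impI m[rule_format] r0 r_lim)
    fix \<epsilon> :: "nat \<Rightarrow> real" assume \<epsilon>: "\<forall>n. 0 < \<epsilon> n" "\<epsilon> \<longlonglongrightarrow> 0"
    have "(\<lambda>n. 2 * (\<bar>C\<bar> + 1) * \<epsilon> n) \<longlonglongrightarrow> 2 * (\<bar>C\<bar> + 1) * 0" by (intro tendsto_mult tendsto_const \<epsilon>(2))
    then have "(\<lambda>n. ennreal (2 * (\<bar>C\<bar> + 1) * \<epsilon> n)) \<longlonglongrightarrow> ennreal 0" by (intro tendsto_ennrealI) simp
    then have lim: "(\<lambda>n. ennreal (2 * (\<bar>C\<bar> + 1) * \<epsilon> n)) \<longlonglongrightarrow> 0" by simp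
    show "(\<lambda>n. wasserstein_modulus (G\<lparr>carrier := K n\<rparr>) d (m n) (r n) (\<epsilon> n)) \<longlonglongrightarrow> 0"
      by (rule tendsto_sandwich[OF _ _ tendsto_const lim])
        (use bound \<epsilon>(1) in \<open>simp_all add: always_eventually\<close>)
  qed
  show ?thesis
    unfolding wasserstein_group_def levy_group_def
    using assms(1,2,3) family wasserstein_family_imp_levy_family[OF family] by blast
qed

end
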